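(* Let $\widetilde{\mathbf W}=(\widetilde G,\widetilde m)$ be a $\mathbb Z$-periodic tree with standard weights or with combinatorial weights, and let $\mathbf W=(G,m)$ be its quotient graph with the induced weights. Then the following are equivalent: (1) $\widetilde{\mathbf W}$ has the full spectrum property; (2) $\mathcal S^{\widetilde{\mathbf W}}=\emptyset$; (3) $\widetilde G$ is the lattice $\mathbb Z$; (4) $\mathcal{MS}^{\mathbf W}=\emptyset$; (5) $G$ is a cycle graph; (6) $G$ has no vertex of degree $1$.
   Context: Graphs $G=(V,E,\partial)$, $\partial e=(\partial_-e,\partial_+e)$, may have loops and multiple edges; $\deg v$ counts edge ends at $v$ (loops twice). Standard weights: $m_e=1$, $m(v)=\deg v$; combinatorial weights: $m_e=1$, $m(v)=1$. Relative weight $\rho(v)=\sum_{e\in E_v}m_e/m(v)$ ($E_v$: edges at $v$, loops twice), $\rho_\infty=\sup_v\rho(v)$ (so $\rho_\infty=1$ for standard and $\rho_\infty=\sup_v\deg v$ for combinatorial weights). Vector potential $\alpha:E\to\mathbb R/2\pi\mathbb Z$; $(d_\alpha f)_e=e^{i\alpha_e/2}f(\partial_+e)-e^{-i\alpha_e/2}f(\partial_-e)$; $\Delta^{\mathbf W}_\alpha=d_\alpha^*d_\alpha$ w.r.t. inner products $\sum_v f\bar g\,m(v)$, $\sum_e\eta\bar\zeta\,m_e$; $\Delta^{\mathbf W}=\Delta^{\mathbf W}_0$. Spectral gaps set: $\mathcal S^{\mathbf W}=[0,2\rho_\infty]\setminus\sigma(\Delta^{\mathbf W})$; magnetic spectral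 gaps set: $\mathcal{MS}^{\mathbf W}=[0,2\rho_\infty]\setminus\bigcup_{\alpha}\sigma(\Delta^{\mathbf W}_\alpha)$, union over all vector potentials on $G$. $\widetilde{\mathbf W}$ has the full spectrum property if $\sigma(\Delta^{\widetilde{\mathbf W}})=[0,2\rho_\infty]$. A $\mathbb Z$-periodic tree is a connected infinite tree $\widetilde G$ on which $\mathbb Z$ acts freely on vertices and edges, preserving orientation ($\partial_\pm(\gamma e)=\gamma\partial_\pm e$), with finite quotient graph $G=\widetilde G/\mathbb Z$ (vertices and edges are orbits, with induced orientation); the weights on $\widetilde G$ are $\mathbb Z$-invariant and induce the weights on $G$. A cycle graph is a graph $C_n$ consisting of a single cycle. *)

theory Defs
  imports
    "HOL-Analysis.Analysis"
    "HOL-Algebra.Group_Action"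
    "HOL-Algebra.Elementary_Groups"
    "Graph_Theory.Digraph_Component"
begin

text \<open>
  A graph (loops and multiple edges allowed) is a \<open>pre_digraph\<close>: the initial vertex
  \<open>\<partial>\<^sub>-e\<close> is \<open>tail G e\<close> and the terminal vertex \<open>\<partial>\<^sub>+e\<close> is \<open>head G e\<close>.
  The orientation is only a bookkeeping device, so degrees, connectedness, cycles and
  isomorphisms below all refer to the underlying undirected multigraph.
\<close>

text \<open>A loop occurs both in \<open>in_arcs\<close> and in \<open>out_arcs\<close>, hence counts twice.\<close>

definition degree :: "('v, 'e) pre_digraph \<Rightarrow> 'v \<Rightarrow> nat" where
  "degree G v = in_degree G v + out_degree G v"

text \<open>Every edge may be traversed in both directions; \<open>(e, True)\<close> is \<open>e\<close> traversed forwards.\<close>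

definition bidirect :: "('v, 'e) pre_digraph \<Rightarrow> ('v, 'e \<times> bool) pre_digraph" where
  "bidirect G =
     \<lparr>verts = verts G,
      arcs = arcs G \<times> UNIV,
      tail = (\<lambda>(e, s). if s then tail G e else head G e),
      head = (\<lambda>(e, s). if s then head G e else tail G e)\<rparr>"

text \<open>
  The library predicates \<open>forest\<close> and \<open>tree\<close> only exclude directed cycles. For undirected
  cycles, the edges have to be required to be distinct, since otherwise every edge traversed
  back and forth would be a cycle. Loops and pairs of parallel edges are cycles.
\<close>

definition undirected_cycle :: "('v, 'e) pre_digraph \<Rightarrow> ('e \<times> bool) list \<Rightarrow> bool" where
  "undirected_cycle G p \<longleftrightarrow> pre_digraph.cycle (bidirect G) p \<and> distinct (map fst p)"

definition undirected_tree :: "('v, 'e) pre_digraph \<Rightarrow> bool" where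
  "undirected_tree G \<longleftrightarrow>
     wf_digraph G \<and> Digraph_Component.connected G \<and> (\<nexists>p. undirected_cycle G p)"

definition undirected_iso :: "('v, 'e) pre_digraph \<Rightarrow> ('w, 'f) pre_digraph \<Rightarrow> bool" where
  "undirected_iso G H \<longleftrightarrow>
     (\<exists>h k. bij_betw h (verts G) (verts H) \<and> bij_betw k (arcs G) (arcs H) \<and>
        (\<forall>e\<in>arcs G. {tail H (k e), head H (k e)} = {h (tail G e), h (head G e)}))"

definition lattice_Z :: "(int, int) pre_digraph" where
  "lattice_Z = \<lparr>verts = UNIV, arcs = UNIV, tail = (\<lambda>n. n), head = (\<lambda>n. n + 1)\<rparr>"

text \<open>\<open>C\<^sub>1\<close> is a single loop, \<open>C\<^sub>2\<close> a pair of parallel edges.\<close>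

definition cycle_graph :: "nat \<Rightarrow> (nat, nat) pre_digraph" where
  "cycle_graph n =
     \<lparr>verts = {0..<n}, arcs = {0..<n}, tail = (\<lambda>i. i), head = (\<lambda>i. (i + 1) mod n)\<rparr>"

definition is_cycle_graph :: "('v, 'e) pre_digraph \<Rightarrow> bool" where
  "is_cycle_graph G \<longleftrightarrow> (\<exists>n\<ge>1. undirected_iso G (cycle_graph n))"


record ('v, 'e) weighted_graph =
  graph_of :: "('v, 'e) pre_digraph"
  vweight :: "'v \<Rightarrow> real"
  eweight :: "'e \<Rightarrow> real"

definition standard_weights :: "('v, 'e) weighted_graph \<Rightarrow> bool" where
  "standard_weights W \<longleftrightarrow>
     (\<forall>e\<in>arcs (graph_of W). eweight W e = 1) \<and>
     (\<forall>v\<in>verts (graph_of W). vweight W v = real (degree (graph_of W) v))"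

definition combinatorial_weights :: "('v, 'e) weighted_graph \<Rightarrow> bool" where
  "combinatorial_weights W \<longleftrightarrow>
     (\<forall>e\<in>arcs (graph_of W). eweight W e = 1) \<and>
     (\<forall>v\<in>verts (graph_of W). vweight W v = 1)"

definition rel_weight :: "('v, 'e) weighted_graph \<Rightarrow> 'v \<Rightarrow> real" where
  "rel_weight W v =
     ((\<Sum>e\<in>in_arcs (graph_of W) v. eweight W e) +
      (\<Sum>e\<in>out_arcs (graph_of W) v. eweight W e)) / vweight W v"

definition rho_inf :: "('v, 'e) weighted_graph \<Rightarrow> real" where
  "rho_inf W = (SUP v\<in>verts (graph_of W). rel_weight W v)"


text \<open>
  The weighted space \<open>\<ell>\<^sub>2(A, w)\<close> of functions on the set \<open>A\<close>, represented by functions on the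
  whole type that vanish outside of \<open>A\<close>.
\<close>

definition ell2 :: "'a set \<Rightarrow> ('a \<Rightarrow> real) \<Rightarrow> ('a \<Rightarrow> complex) set" where
  "ell2 A w = {f. (\<forall>x. x \<notin> A \<longrightarrow> f x = 0) \<and> (\<lambda>x. (cmod (f x))\<^sup>2 * w x) summable_on A}"

definition ell2_inner :: "'a set \<Rightarrow> ('a \<Rightarrow> real) \<Rightarrow> ('a \<Rightarrow> complex) \<Rightarrow> ('a \<Rightarrow> complex) \<Rightarrow> complex" where
  "ell2_inner A w f g = (\<Sum>\<^sub>\<infinity>x\<in>A. f x * cnj (g x) * complex_of_real (w x))"

definition ell2_norm :: "'a set \<Rightarrow> ('a \<Rightarrow> real) \<Rightarrow> ('a \<Rightarrow> complex) \<Rightarrow> real" where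
  "ell2_norm A w f = sqrt (\<Sum>\<^sub>\<infinity>x\<in>A. (cmod (f x))\<^sup>2 * w x)"

abbreviation ell2V :: "('v, 'e) weighted_graph \<Rightarrow> ('v \<Rightarrow> complex) set" where
  "ell2V W \<equiv> ell2 (verts (graph_of W)) (vweight W)"

abbreviation ell2V_inner ::
    "('v, 'e) weighted_graph \<Rightarrow> ('v \<Rightarrow> complex) \<Rightarrow> ('v \<Rightarrow> complex) \<Rightarrow> complex" where
  "ell2V_inner W \<equiv> ell2_inner (verts (graph_of W)) (vweight W)"

abbreviation ell2V_norm :: "('v, 'e) weighted_graph \<Rightarrow> ('v \<Rightarrow> complex) \<Rightarrow> real" where
  "ell2V_norm W \<equiv> ell2_norm (verts (graph_of W)) (vweight W)"

abbreviation ell2E_inner ::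
    "('v, 'e) weighted_graph \<Rightarrow> ('e \<Rightarrow> complex) \<Rightarrow> ('e \<Rightarrow> complex) \<Rightarrow> complex" where
  "ell2E_inner W \<equiv> ell2_inner (arcs (graph_of W)) (eweight W)"

text \<open>
  Vector potentials with values in \<open>\<real>/2\<pi>\<int>\<close> are given by real representatives. Changing the
  representative of \<open>\<alpha>\<^sub>e\<close> by \<open>2\<pi>\<close> only changes the sign of \<open>(d\<^sub>\<alpha> f)\<^sub>e\<close>, for all \<open>f\<close>
  simultaneously, and therefore does not change the Laplacian \<open>d\<^sub>\<alpha>\<^sup>* d\<^sub>\<alpha>\<close>.
\<close>

definition magnetic_d ::
    "('v, 'e) weighted_graph \<Rightarrow> ('e \<Rightarrow> real) \<Rightarrow> ('v \<Rightarrow> complex) \<Rightarrow> 'e \<Rightarrow> complex" where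
  "magnetic_d W \<alpha> f =
     (\<lambda>e. if e \<in> arcs (graph_of W)
          then cis (\<alpha> e / 2) * f (head (graph_of W) e) -
               cis (- (\<alpha> e / 2)) * f (tail (graph_of W) e)
          else 0)"

definition magnetic_d_adj ::
    "('v, 'e) weighted_graph \<Rightarrow> ('e \<Rightarrow> real) \<Rightarrow> ('e \<Rightarrow> complex) \<Rightarrow> 'v \<Rightarrow> complex" where
  "magnetic_d_adj W \<alpha> \<eta> =
     (THE g. g \<in> ell2V W \<and>
        (\<forall>f\<in>ell2V W. ell2E_inner W (magnetic_d W \<alpha> f) \<eta> = ell2V_inner W f g))"

definition magnetic_laplacian ::
    "('v, 'e) weighted_graph \<Rightarrow> ('e \<Rightarrow> real) \<Rightarrow> ('v \<Rightarrow> complex) \<Rightarrow> 'v \<Rightarrow> complex" where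
  "magnetic_laplacian W \<alpha> f = magnetic_d_adj W \<alpha> (magnetic_d W \<alpha> f)"

text \<open>\<open>z\<close> is in the resolvent set iff \<open>\<Delta>\<^sub>\<alpha> - z\<close> is bijective on \<open>\<ell>\<^sub>2(V, m)\<close> with bounded inverse.\<close>

definition magnetic_spectrum :: "('v, 'e) weighted_graph \<Rightarrow> ('e \<Rightarrow> real) \<Rightarrow> complex set" where
  "magnetic_spectrum W \<alpha> =
     {z. \<not> (let T = (\<lambda>f v. magnetic_laplacian W \<alpha> f v - z * f v) in
            bij_betw T (ell2V W) (ell2V W) \<and>
            (\<exists>C. \<forall>f\<in>ell2V W. ell2V_norm W f \<le> C * ell2V_norm W (T f)))}"

definition laplacian_spectrum :: "('v, 'e) weighted_graph \<Rightarrow> complex set" where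
  "laplacian_spectrum W = magnetic_spectrum W (\<lambda>_. 0)"

definition spectral_interval :: "('v, 'e) weighted_graph \<Rightarrow> complex set" where
  "spectral_interval W = complex_of_real ` {0..2 * rho_inf W}"

definition full_spectrum_property :: "('v, 'e) weighted_graph \<Rightarrow> bool" where
  "full_spectrum_property W \<longleftrightarrow> laplacian_spectrum W = spectral_interval W"

definition spectral_gaps :: "('v, 'e) weighted_graph \<Rightarrow> complex set" where
  "spectral_gaps W = spectral_interval W - laplacian_spectrum W"

definition magnetic_spectral_gaps :: "('v, 'e) weighted_graph \<Rightarrow> complex set" where
  "magnetic_spectral_gaps W = spectral_interval W - (\<Union>\<alpha>. magnetic_spectrum W \<alpha>)"


text \<open>
  Since \<open>\<partial>\<^sub>\<plusminus>\<close> commutes with the action, the image of the orbit of \<open>e\<close> under \<open>\<partial>\<^sub>\<plusminus>\<close> is the orbit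
  of \<open>\<partial>\<^sub>\<plusminus>e\<close>; and since the weights are invariant, \<open>the_elem\<close> is applied to singletons.
\<close>

definition quotient_graph ::
    "(int \<Rightarrow> 'v \<Rightarrow> 'v) \<Rightarrow> (int \<Rightarrow> 'e \<Rightarrow> 'e) \<Rightarrow> ('v, 'e) pre_digraph \<Rightarrow> ('v set, 'e set) pre_digraph"
  where
  "quotient_graph \<phi> \<psi> G =
     \<lparr>verts = orbits integer_group (verts G) \<phi>,
      arcs = orbits integer_group (arcs G) \<psi>,
      tail = (\<lambda>B. tail G ` B),
      head = (\<lambda>B. head G ` B)\<rparr>"

definition quotient_weighted_graph ::
    "(int \<Rightarrow> 'v \<Rightarrow> 'v) \<Rightarrow> (int \<Rightarrow> 'e \<Rightarrow> 'e) \<Rightarrow> ('v, 'e) weighted_graph \<Rightarrow>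
     ('v set, 'e set) weighted_graph" where
  "quotient_weighted_graph \<phi> \<psi> W =
     \<lparr>graph_of = quotient_graph \<phi> \<psi> (graph_of W),
      vweight = (\<lambda>A. the_elem (vweight W ` A)),
      eweight = (\<lambda>B. the_elem (eweight W ` B))\<rparr>"

locale Z_periodic_tree =
  fixes W :: "('v, 'e) weighted_graph"
    and \<phi> :: "int \<Rightarrow> 'v \<Rightarrow> 'v"
    and \<psi> :: "int \<Rightarrow> 'e \<Rightarrow> 'e"
  assumes tree: "undirected_tree (graph_of W)"
    and infinite_verts: "infinite (verts (graph_of W))"
    and action_verts: "group_action integer_group (verts (graph_of W)) \<phi>"
    and action_arcs: "group_action integer_group (arcs (graph_of W)) \<psi>"
    and free_verts: "\<And>g v. v \<in> verts (graph_of W) \<Longrightarrow> \<phi> g v = v \<Longrightarrow> g = 0"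
    and free_arcs: "\<And>g e. e \<in> arcs (graph_of W) \<Longrightarrow> \<psi> g e = e \<Longrightarrow> g = 0"
    and tail_equivariant:
      "\<And>g e. e \<in> arcs (graph_of W) \<Longrightarrow> tail (graph_of W) (\<psi> g e) = \<phi> g (tail (graph_of W) e)"
    and head_equivariant:
      "\<And>g e. e \<in> arcs (graph_of W) \<Longrightarrow> head (graph_of W) (\<psi> g e) = \<phi> g (head (graph_of W) e)"
    and finite_quotient_verts: "finite (verts (quotient_graph \<phi> \<psi> (graph_of W)))"
    and finite_quotient_arcs: "finite (arcs (quotient_graph \<phi> \<psi> (graph_of W)))"
    and vweight_invariant: "\<And>g v. v \<in> verts (graph_of W) \<Longrightarrow> vweight W (\<phi> g v) = vweight W v"
    and eweight_invariant: "\<And>g e. e \<in> arcs (graph_of W) \<Longrightarrow> eweight W (\<psi> g e) = eweight W e"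

end

theory Submission
  imports Defs
begin

text \<open>
  The chain is: \<open>\<Delta>\<close> on the lattice has full spectrum; \<open>\<S>(W\<^sub>t) = {}\<close> forces \<open>\<M>\<S>(W) = {}\<close>; no magnetic gap
  forces that \<open>G\<close> has no leaf; and without leaves \<open>G\<close> is a cycle and the tree is the lattice.

  The second step is Floquet theory: a finitely supported approximate eigenfunction on the tree is
  averaged against the characters of a large cyclic group, and compactness turns the resulting
  approximate eigenfunctions of magnetic Laplacians on \<open>G\<close> into an eigenfunction. For the third
  step, \<open>G\<close> has as many edges as vertices because the tree is acyclic and \<open>\<int>\<close> acts with one-dimensional
  growth; so if there is a leaf, some vertex \<open>c\<close> of the unique cycle carries a branch \<open>B\<close>, and all
  energies close to the Dirichlet ground state energy of \<open>B\<close>, but different from it, lie in magnetic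
  gaps. For the last step, if all degrees are at least 2, then the edge count shows that they equal 2.
\<close>

section \<open>Weighted sequence spaces\<close>

text \<open>No spectral theorem is used. By self-adjointness a real \<open>t\<close> lies in the
  spectrum iff there are unit vectors with arbitrarily small residual, and every step is phrased
  through such approximate eigenfunctions; the price is one inversion argument in
  \<open>ell2\<close>. Both kinds of weights are treated together: beyond positivity and unit edge
  weights, the general theory sees only the bound deg v \<le> \<rho> m(v), and constancy of the
  vertex weight enters on the lattice alone.

  The gap has to be sought next to the Dirichlet energy q of the branch, not at q itself. If two
  copies of the branch hang at c, the difference of their ground states vanishes at c and is an
  eigenfunction for q whatever the flux through the cycle. An energy t \<noteq> q close to q is
  excluded because its eigenfunctions almost vanish at c, where the cycle is attached, and would
  have to be almost orthogonal to their own limit.\<close>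

locale weighted_set =
  fixes A :: "'a set" and w :: "'a \<Rightarrow> real"
  assumes weight_pos: "x \<in> A \<Longrightarrow> w x > 0"
begin

abbreviation N :: "('a \<Rightarrow> complex) \<Rightarrow> real" where "N \<equiv> ell2_norm A w"
abbreviation ip :: "('a \<Rightarrow> complex) \<Rightarrow> ('a \<Rightarrow> complex) \<Rightarrow> complex" where "ip \<equiv> ell2_inner A w"
text \<open>\<open>L2_set\<close> brings the triangle and Cauchy-Schwarz inequalities for finite
  sums; bounds that are uniform in the finite set \<open>F\<close> are then passed on to the
  infinite sum.\<close>

abbreviation pN :: "('a \<Rightarrow> complex) \<Rightarrow> 'a set \<Rightarrow> real"
  where "pN f F \<equiv> L2_set (\<lambda>x. cmod (f x) * sqrt (w x)) F"

lemma pN_sq: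
  assumes "F \<subseteq> A"
  shows "(pN f F)\<^sup>2 = (\<Sum>x\<in>F. (cmod (f x))\<^sup>2 * w x)"
proof -
  have "(pN f F)\<^sup>2 = (\<Sum>x\<in>F. (cmod (f x) * sqrt (w x))\<^sup>2)"
    by (simp add: L2_set_def sum_nonneg)
  also have "\<dots> = (\<Sum>x\<in>F. (cmod (f x))\<^sup>2 * w x)"
    using assms weight_pos by (intro sum.cong) (auto simp: power_mult_distrib real_sqrt_pow2 less_imp_le subset_iff)
  finally show ?thesis .
qed

lemma N_nonneg [simp]: "N f \<ge> 0"
  by (auto simp: ell2_norm_def intro!: infsum_nonneg real_sqrt_ge_zero mult_nonneg_nonneg less_imp_le[OF weight_pos])

lemma N_sq: "(N f)\<^sup>2 = (\<Sum>\<^sub>\<infinity>x\<in>A. (cmod (f x))\<^sup>2 * w x)"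
  unfolding ell2_norm_def
  by (auto intro!: infsum_nonneg real_sqrt_pow2 mult_nonneg_nonneg less_imp_le[OF weight_pos])

lemma ell2_vanish: "f \<in> ell2 A w \<Longrightarrow> x \<notin> A \<Longrightarrow> f x = 0"
  by (simp add: ell2_def)

lemma ell2_summable: "f \<in> ell2 A w \<Longrightarrow> (\<lambda>x. (cmod (f x))\<^sup>2 * w x) summable_on A"
  by (simp add: ell2_def)

lemma pN_le_N:
  assumes "f \<in> ell2 A w" "finite F" "F \<subseteq> A"
  shows "pN f F \<le> N f"
proof (rule power2_le_imp_le)
  show "(pN f F)\<^sup>2 \<le> (N f)\<^sup>2"
    unfolding pN_sq[OF assms(3)] N_sq
    by (rule finite_sum_le_infsum) (use assms weight_pos in \<open>auto simp: less_imp_le ell2_summable\<close>)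
qed simp

text \<open>For nonnegative terms a uniform bound on finite partial sums yields summability together
  with the bound on the total, so membership and norm estimate come in one step.\<close>

lemma ell2I:
  assumes "\<And>x. x \<notin> A \<Longrightarrow> f x = 0" and le: "\<And>F. finite F \<Longrightarrow> F \<subseteq> A \<Longrightarrow> pN f F \<le> C"
  shows "f \<in> ell2 A w" and "N f \<le> C"
proof -
  have C: "0 \<le> C" using le[of "{}"] by simp
  have b: "(\<Sum>x\<in>F. (cmod (f x))\<^sup>2 * w x) \<le> C\<^sup>2" if "finite F" "F \<subseteq> A" for F
    using power_mono[OF le[OF that], of 2] pN_sq[OF that(2)] by simp
  have s: "(\<lambda>x. (cmod (f x))\<^sup>2 * w x) summable_on A"
    by (rule nonneg_bdd_above_summable_on)
       (use b weight_pos in \<open>auto intro!: bdd_aboveI[of _ "C\<^sup>2"] simp: less_imp_le\<close>)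
  show "f \<in> ell2 A w" using s assms(1) by (simp add: ell2_def)
  have "(N f)\<^sup>2 \<le> C\<^sup>2" unfolding N_sq by (rule infsum_le_finite_sums[OF s b])
  then show "N f \<le> C" using C by (rule power2_le_imp_le)
qed

lemma ell2_0 [simp]: "(\<lambda>_. 0) \<in> ell2 A w" by (simp add: ell2_def)

lemma ell2_finite_support:
  assumes "\<And>x. x \<notin> F \<Longrightarrow> f x = 0" "finite F" "F \<subseteq> A"
  shows "f \<in> ell2 A w"
proof -
  have "(\<lambda>x. (cmod (f x))\<^sup>2 * w x) summable_on F" using assms by simp
  then have "(\<lambda>x. (cmod (f x))\<^sup>2 * w x) summable_on A"
    by (subst summable_on_cong_neutral[where T = F and g = "\<lambda>x. (cmod (f x))\<^sup>2 * w x"]) (use assms in auto)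
  then show ?thesis using assms by (auto simp: ell2_def)
qed

lemma ell2_scale:
  assumes "f \<in> ell2 A w"
  shows "(\<lambda>x. c * f x) \<in> ell2 A w" and "N (\<lambda>x. c * f x) = cmod c * N f"
proof -
  have "(\<lambda>x. (cmod c)\<^sup>2 * ((cmod (f x))\<^sup>2 * w x)) summable_on A"
    by (rule summable_on_cmult_right) (rule ell2_summable[OF assms])
  then show "(\<lambda>x. c * f x) \<in> ell2 A w"
    using ell2_vanish[OF assms] by (simp add: ell2_def norm_mult power_mult_distrib mult.assoc)
  have "(\<Sum>\<^sub>\<infinity>x\<in>A. (cmod (c * f x))\<^sup>2 * w x) = (cmod c)\<^sup>2 * (\<Sum>\<^sub>\<infinity>x\<in>A. (cmod (f x))\<^sup>2 * w x)"
    by (subst infsum_cmult_right'[symmetric]) (simp add: norm_mult power_mult_distrib mult.assoc)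
  then show "N (\<lambda>x. c * f x) = cmod c * N f"
    by (simp add: ell2_norm_def real_sqrt_mult)
qed

lemma ell2_add:
  assumes "f \<in> ell2 A w" "g \<in> ell2 A w"
  shows "(\<lambda>x. f x + g x) \<in> ell2 A w" and "N (\<lambda>x. f x + g x) \<le> N f + N g"
proof -
  have "pN (\<lambda>x. f x + g x) F \<le> N f + N g" if "finite F" "F \<subseteq> A" for F
  proof -
    have "pN (\<lambda>x. f x + g x) F \<le> L2_set (\<lambda>x. cmod (f x) * sqrt (w x) + cmod (g x) * sqrt (w x)) F"
      using that weight_pos
      by (intro L2_set_mono)
         (auto simp: distrib_right[symmetric] less_imp_le subset_iff intro!: mult_right_mono norm_triangle_ineq)
    also have "\<dots> \<le> pN f F + pN g F" by (rule L2_set_triangle_ineq)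
    also have "\<dots> \<le> N f + N g" using that assms by (intro add_mono pN_le_N)
    finally show ?thesis .
  qed
  moreover have "f x + g x = 0" if "x \<notin> A" for x using that assms by (simp add: ell2_vanish)
  ultimately show "(\<lambda>x. f x + g x) \<in> ell2 A w" "N (\<lambda>x. f x + g x) \<le> N f + N g"
    using ell2I[of "\<lambda>x. f x + g x" "N f + N g"] by auto
qed

lemma ell2_diff:
  assumes "f \<in> ell2 A w" "g \<in> ell2 A w"
  shows "(\<lambda>x. f x - g x) \<in> ell2 A w" and "N (\<lambda>x. f x - g x) \<le> N f + N g"
  using ell2_add[OF assms(1) ell2_scale(1)[OF assms(2), of "-1"]] ell2_scale(2)[OF assms(2), of "-1"] by auto

lemma N_minus_commute: "N (\<lambda>x. f x - g x) = N (\<lambda>x. g x - f x)"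
  by (simp add: ell2_norm_def norm_minus_commute)

lemma point_le_N:
  assumes "f \<in> ell2 A w" "x \<in> A"
  shows "cmod (f x) * sqrt (w x) \<le> N f"
  using pN_le_N[OF assms(1), of "{x}"] assms(2) weight_pos[OF assms(2)] by (simp add: L2_set_def)

lemma N_eq_0_iff:
  assumes "f \<in> ell2 A w"
  shows "N f = 0 \<longleftrightarrow> (\<forall>x. f x = 0)"
proof
  assume "N f = 0"
  have "f x = 0" if "x \<in> A" for x
  proof -
    have "cmod (f x) * sqrt (w x) \<le> 0" using point_le_N[OF assms that] \<open>N f = 0\<close> by simp
    moreover have "sqrt (w x) > 0" using weight_pos[OF that] by simp
    ultimately show ?thesis by (simp add: mult_le_0_iff)
  qed
  then show "\<forall>x. f x = 0" using ell2_vanish[OF assms] by blast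
qed (simp add: ell2_norm_def)

lemma ip_abs_summable:
  assumes "f \<in> ell2 A w" "g \<in> ell2 A w"
  shows "(\<lambda>x. cmod (f x * cnj (g x) * complex_of_real (w x))) summable_on A"
    and "(\<Sum>\<^sub>\<infinity>x\<in>A. cmod (f x * cnj (g x) * complex_of_real (w x))) \<le> N f * N g"
proof -
  have b: "(\<Sum>x\<in>F. cmod (f x * cnj (g x) * complex_of_real (w x))) \<le> N f * N g"
    if "finite F" "F \<subseteq> A" for F
  proof -
    have "(\<Sum>x\<in>F. cmod (f x * cnj (g x) * complex_of_real (w x)))
       = (\<Sum>x\<in>F. \<bar>cmod (f x) * sqrt (w x)\<bar> * \<bar>cmod (g x) * sqrt (w x)\<bar>)"
      using that weight_pos by (intro sum.cong) (auto simp: norm_mult abs_mult subset_iff less_imp_le)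
    also have "\<dots> \<le> pN f F * pN g F" by (rule L2_set_mult_ineq)
    also have "\<dots> \<le> N f * N g" using that assms by (intro mult_mono pN_le_N) auto
    finally show ?thesis .
  qed
  show s: "(\<lambda>x. cmod (f x * cnj (g x) * complex_of_real (w x))) summable_on A"
    by (rule nonneg_bdd_above_summable_on) (use b in \<open>auto intro!: bdd_aboveI[of _ "N f * N g"]\<close>)
  show "(\<Sum>\<^sub>\<infinity>x\<in>A. cmod (f x * cnj (g x) * complex_of_real (w x))) \<le> N f * N g"
    by (rule infsum_le_finite_sums[OF s b])
qed

lemma ip_summable:
  assumes "f \<in> ell2 A w" "g \<in> ell2 A w"
  shows "(\<lambda>x. f x * cnj (g x) * complex_of_real (w x)) summable_on A"
  by (rule abs_summable_summable) (rule ip_abs_summable[OF assms])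

lemma Cauchy_Schwarz_ell2:
  assumes "f \<in> ell2 A w" "g \<in> ell2 A w"
  shows "cmod (ip f g) \<le> N f * N g"
  unfolding ell2_inner_def
  using norm_infsum_bound[OF ip_abs_summable(1)[OF assms]] ip_abs_summable(2)[OF assms] by linarith

lemma ip_self:
  assumes "f \<in> ell2 A w"
  shows "ip f f = complex_of_real ((N f)\<^sup>2)"
proof -
  have "complex_of_real ((N f)\<^sup>2) = (\<Sum>\<^sub>\<infinity>x\<in>A. complex_of_real ((cmod (f x))\<^sup>2 * w x))"
    unfolding N_sq
    by (rule infsumI[symmetric]) (rule has_sum_of_real, rule has_sum_infsum, rule ell2_summable[OF assms])
  also have "\<dots> = ip f f" unfolding ell2_inner_def
    by (intro infsum_cong) (simp only: of_real_mult complex_norm_square)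
  finally show ?thesis by simp
qed

lemma ip_sym: "ip g f = cnj (ip f g)"
  unfolding ell2_inner_def by (simp flip: infsum_cnj add: mult.commute mult.left_commute)

lemma ip_add_left:
  assumes "f \<in> ell2 A w" "g \<in> ell2 A w" "h \<in> ell2 A w"
  shows "ip (\<lambda>x. f x + g x) h = ip f h + ip g h"
  unfolding ell2_inner_def distrib_right by (intro infsum_add ip_summable assms)

lemma ip_scale_left: "ip (\<lambda>x. c * f x) h = c * ip f h"
  unfolding ell2_inner_def by (simp flip: infsum_cmult_right' add: mult.assoc)

lemma ip_diff_left:
  assumes "f \<in> ell2 A w" "g \<in> ell2 A w" "h \<in> ell2 A w"
  shows "ip (\<lambda>x. f x - g x) h = ip f h - ip g h"
  using ip_add_left[OF assms(1) ell2_scale(1)[OF assms(2), of "-1"] assms(3)] ip_scale_left[of "-1" g h] by simp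

lemma ip_diff_right:
  assumes "f \<in> ell2 A w" "g \<in> ell2 A w" "h \<in> ell2 A w"
  shows "ip h (\<lambda>x. f x - g x) = ip h f - ip h g"
  using ip_diff_left[OF assms] ip_sym by (metis complex_cnj_diff)

lemma ip_scale_right: "ip h (\<lambda>x. c * f x) = cnj c * ip h f"
  using ip_scale_left[of c f h] ip_sym by (metis complex_cnj_mult)

lemma N_sq_diff:
  assumes "f \<in> ell2 A w" "g \<in> ell2 A w"
  shows "(N (\<lambda>x. f x - g x))\<^sup>2 = (N f)\<^sup>2 - 2 * Re (ip f g) + (N g)\<^sup>2"
proof -
  have "complex_of_real ((N (\<lambda>x. f x - g x))\<^sup>2) = ip f f - ip g f - (ip f g - ip g g)"
    unfolding ip_self[OF ell2_diff(1)[OF assms], symmetric] using assms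
    by (simp add: ip_diff_left ip_diff_right ell2_diff)
  then have "(N (\<lambda>x. f x - g x))\<^sup>2 = Re (ip f f - ip g f - (ip f g - ip g g))"
    by (metis Re_complex_of_real)
  also have "\<dots> = (N f)\<^sup>2 - 2 * Re (ip f g) + (N g)\<^sup>2"
    using ip_sym[of g f] assms by (simp add: ip_self)
  finally show ?thesis .
qed

section \<open>Completeness of \<open>ell2\<close> and an inversion criterion\<close>

lemma ell2_metric: "Metric_space (ell2 A w) (\<lambda>f g. N (\<lambda>x. f x - g x))"
proof
  show "N (\<lambda>x. f x - g x) = N (\<lambda>x. g x - f x)" for f g by (rule N_minus_commute)
  show "(N (\<lambda>x. f x - g x) = 0) = (f = g)" if "f \<in> ell2 A w" "g \<in> ell2 A w" for f g
    using N_eq_0_iff[OF ell2_diff(1)[OF that]] by auto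
  show "N (\<lambda>x. f x - h x) \<le> N (\<lambda>x. f x - g x) + N (\<lambda>x. g x - h x)"
    if "f \<in> ell2 A w" "g \<in> ell2 A w" "h \<in> ell2 A w" for f g h
    using ell2_add(2)[OF ell2_diff(1)[OF that(1,2)] ell2_diff(1)[OF that(2,3)]] by simp
qed simp

text \<open>The norm dominates each \<open>cmod (f x) * sqrt (w x)\<close>, so Cauchy sequences
  converge pointwise. Partial norms over finite sets are continuous under pointwise convergence,
  hence the Cauchy estimate survives in the limit, and \<open>ell2I\<close> turns it into norm
  convergence.\<close>

lemma ell2_complete: "Metric_space.mcomplete (ell2 A w) (\<lambda>f g. N (\<lambda>x. f x - g x))"
proof -
  interpret Metric_space "ell2 A w" "\<lambda>f g. N (\<lambda>x. f x - g x)" by (rule ell2_metric)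
  have "\<exists>f. limitin mtopology s f sequentially" if c: "MCauchy s" for s
  proof -
    have s: "s n \<in> ell2 A w" for n using c by (auto simp: MCauchy_def)
    have cau: "\<exists>M. \<forall>m\<ge>M. \<forall>n\<ge>M. N (\<lambda>x. s m x - s n x) < e" if "e > 0" for e
    proof -
      from c have "\<forall>e>0. \<exists>M. \<forall>m n. M \<le> m \<longrightarrow> M \<le> n \<longrightarrow> N (\<lambda>x. s m x - s n x) < e"
        unfolding MCauchy_def by (rule conjunct2)
      with that show ?thesis by meson
    qed
    have "\<exists>l. (\<lambda>n. s n x) \<longlonglongrightarrow> l" for x
    proof (cases "x \<in> A")
      case True
      have "Cauchy (\<lambda>n. s n x)"
      proof (rule metric_CauchyI)
        fix e :: real assume "e > 0"
        then have e: "e * sqrt (w x) > 0" using weight_pos[OF True] by simp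
        obtain M where M: "\<And>m n. m \<ge> M \<Longrightarrow> n \<ge> M \<Longrightarrow> N (\<lambda>x. s m x - s n x) < e * sqrt (w x)"
          using cau[OF e] by blast
        have "dist (s m x) (s n x) < e" if "m \<ge> M" "n \<ge> M" for m n
        proof -
          have "cmod (s m x - s n x) * sqrt (w x) < e * sqrt (w x)"
            using point_le_N[OF ell2_diff(1)[OF s s] True, of m n] M[OF that] by linarith
          then show ?thesis using weight_pos[OF True] by (simp add: dist_norm)
        qed
        then show "\<exists>M. \<forall>m\<ge>M. \<forall>n\<ge>M. dist (s m x) (s n x) < e" by blast
      qed
      then show ?thesis by (simp add: Cauchy_convergent_iff convergent_def)
    next
      case False
      then show ?thesis using ell2_vanish[OF s] by (intro exI[of _ 0]) simp
    qed
    then obtain f where f: "\<And>x. (\<lambda>n. s n x) \<longlonglongrightarrow> f x" by metis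
    have f0: "f x = 0" if "x \<notin> A" for x
      using f[of x] ell2_vanish[OF s that] by (simp add: LIMSEQ_const_iff)
    have close: "\<exists>M. \<forall>n\<ge>M. (\<lambda>x. s n x - f x) \<in> ell2 A w \<and> N (\<lambda>x. s n x - f x) \<le> e" if e: "e > 0" for e
    proof -
      obtain M where M: "\<And>m n. m \<ge> M \<Longrightarrow> n \<ge> M \<Longrightarrow> N (\<lambda>x. s m x - s n x) < e"
        using cau[OF e] by blast
      have "pN (\<lambda>x. s n x - f x) F \<le> e" if "n \<ge> M" "finite F" "F \<subseteq> A" for n F
      proof (rule tendsto_upperbound)
        show "(\<lambda>m. pN (\<lambda>x. s n x - s m x) F) \<longlonglongrightarrow> pN (\<lambda>x. s n x - f x) F"
          unfolding L2_set_def by (intro tendsto_intros f)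
        show "\<forall>\<^sub>F m in sequentially. pN (\<lambda>x. s n x - s m x) F \<le> e"
          using eventually_ge_at_top[of M]
        proof eventually_elim
          case (elim m)
          show ?case
            using pN_le_N[OF ell2_diff(1)[OF s s] that(2,3), of n m] M[OF that(1) elim] by linarith
        qed
      qed simp
      then show ?thesis using ell2I[of "\<lambda>x. s _ x - f x" e] f0 ell2_vanish[OF s]
        by (intro exI[of _ M]) auto
    qed
    have fin: "f \<in> ell2 A w"
    proof -
      obtain M where "(\<lambda>x. s M x - f x) \<in> ell2 A w" using close[of 1] by auto
      from ell2_diff(1)[OF s[of M] this] show ?thesis by simp
    qed
    have "limitin mtopology s f sequentially"
      unfolding limit_metric_sequentially
    proof (intro conjI allI impI fin)
      fix e :: real assume "e > 0"
      then obtain M where "\<forall>n\<ge>M. N (\<lambda>x. s n x - f x) \<le> e / 2" using close[of "e / 2"] by auto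
      then show "\<exists>M. \<forall>n\<ge>M. s n \<in> ell2 A w \<and> N (\<lambda>x. s n x - f x) < e"
        using s \<open>e > 0\<close> by (intro exI[of _ M]) force
    qed
    then show ?thesis by (rule exI[of _ f])
  qed
  then show ?thesis by (simp add: mcomplete_def)
qed

text \<open>
  Surjectivity: for small \<open>t\<close> the map \<open>f \<mapsto> f - t T\<^sup>*(T f - h)\<close> is a contraction, and its fixed
  point solves \<open>T f = h\<close> because \<open>T\<^sup>*\<close> is injective.
\<close>

lemma bij_betw_ell2_of_bounded_below:
  assumes T: "\<And>f. f \<in> ell2 A w \<Longrightarrow> T f \<in> ell2 A w" and T': "\<And>f. f \<in> ell2 A w \<Longrightarrow> T' f \<in> ell2 A w"
    and T_diff: "\<And>f g. f \<in> ell2 A w \<Longrightarrow> g \<in> ell2 A w \<Longrightarrow> T (\<lambda>x. f x - g x) = (\<lambda>x. T f x - T g x)"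
    and T'_diff: "\<And>f g. f \<in> ell2 A w \<Longrightarrow> g \<in> ell2 A w \<Longrightarrow> T' (\<lambda>x. f x - g x) = (\<lambda>x. T' f x - T' g x)"
    and adj: "\<And>f g. f \<in> ell2 A w \<Longrightarrow> g \<in> ell2 A w \<Longrightarrow> ip (T f) g = ip f (T' g)"
    and T'_bdd: "\<And>f. f \<in> ell2 A w \<Longrightarrow> N (T' f) \<le> M * N f"
    and c: "c > 0" "c \<le> M"
    and T_below: "\<And>f. f \<in> ell2 A w \<Longrightarrow> c * N f \<le> N (T f)"
    and T'_below: "\<And>f. f \<in> ell2 A w \<Longrightarrow> c * N f \<le> N (T' f)"
  shows "bij_betw T (ell2 A w) (ell2 A w)"
proof -
  interpret Metric_space "ell2 A w" "\<lambda>f g. N (\<lambda>x. f x - g x)" by (rule ell2_metric)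
  have inj: "inj_on T (ell2 A w)"
  proof (rule inj_onI)
    fix f g assume fg: "f \<in> ell2 A w" "g \<in> ell2 A w" "T f = T g"
    have "c * N (\<lambda>x. f x - g x) \<le> N (\<lambda>x. T f x - T g x)"
      using T_below[OF ell2_diff(1)[OF fg(1,2)]] T_diff[OF fg(1,2)] by simp
    also have "\<dots> = 0" using fg(3) by (simp add: ell2_norm_def)
    finally have "N (\<lambda>x. f x - g x) \<le> 0" using c(1) by (simp add: mult_le_0_iff)
    then have "N (\<lambda>x. f x - g x) = 0" by (simp add: order_antisym)
    then show "f = g" using fg by simp
  qed
  have surj: "\<exists>f\<in>ell2 A w. T f = h" if h: "h \<in> ell2 A w" for h
  proof -
    \<comment> \<open>With this \<open>t\<close> the quadratic term in the expansion of the squared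
      norm of u - t T'(T u) is at most t |T u|^2, which leaves |u|^2 - t |T u|^2, at most (1 - t
      c^2) |u|^2. The assumption \<open>c \<le> M\<close> keeps 1 - t c^2 nonnegative.\<close>
    define t where "t = 1 / M\<^sup>2"
    have M: "M > 0" using c by linarith
    have t: "t > 0" using M by (simp add: t_def)
    define k where "k = sqrt (1 - t * c\<^sup>2)"
    have tc: "t * c\<^sup>2 \<le> 1" using c M by (simp add: t_def divide_le_eq_1 power_mono)
    have "k < 1" using t c by (simp add: k_def)
    define \<Phi> where "\<Phi> f = (\<lambda>x. f x - complex_of_real t * T' (\<lambda>y. T f y - h y) x)" for f
    have \<Phi>: "\<Phi> f \<in> ell2 A w" if "f \<in> ell2 A w" for f
      unfolding \<Phi>_def by (intro ell2_diff ell2_scale T' T that h)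
    have con: "N (\<lambda>x. \<Phi> f x - \<Phi> g x) \<le> k * N (\<lambda>x. f x - g x)"
      if f: "f \<in> ell2 A w" and g: "g \<in> ell2 A w" for f g
    proof -
      define u where "u = (\<lambda>x. f x - g x)"
      have u: "u \<in> ell2 A w" unfolding u_def by (rule ell2_diff(1)[OF f g])
      have Tu: "T u \<in> ell2 A w" and TTu: "T' (T u) \<in> ell2 A w" by (auto intro: T T' u)
      have *: "T' (T u) = (\<lambda>x. T' (\<lambda>y. T f y - h y) x - T' (\<lambda>y. T g y - h y) x)"
        using T'_diff[OF ell2_diff(1)[OF T[OF f] h] ell2_diff(1)[OF T[OF g] h]] T_diff[OF f g]
        by (simp add: u_def)
      have eq: "(\<lambda>x. \<Phi> f x - \<Phi> g x) = (\<lambda>x. u x - complex_of_real t * T' (T u) x)"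
        unfolding * by (simp add: \<Phi>_def u_def algebra_simps)
      have "(N (\<lambda>x. \<Phi> f x - \<Phi> g x))\<^sup>2
          = (N u)\<^sup>2 - 2 * Re (ip u (\<lambda>x. complex_of_real t * T' (T u) x)) + (t * N (T' (T u)))\<^sup>2"
        unfolding eq using N_sq_diff[OF u ell2_scale(1)[OF TTu]] ell2_scale(2)[OF TTu] t by simp
      also have "ip u (\<lambda>x. complex_of_real t * T' (T u) x) = complex_of_real (t * (N (T u))\<^sup>2)"
        using adj[OF u Tu] by (simp add: ip_scale_right ip_self[OF Tu])
      also have "(t * N (T' (T u)))\<^sup>2 \<le> (t * (M * N (T u)))\<^sup>2"
        using T'_bdd[OF Tu] t by (intro power_mono mult_left_mono) auto
      also have "(t * (M * N (T u)))\<^sup>2 = t * (N (T u))\<^sup>2"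
        using M by (simp add: t_def power_mult_distrib power2_eq_square)
      finally have "(N (\<lambda>x. \<Phi> f x - \<Phi> g x))\<^sup>2 \<le> (N u)\<^sup>2 - t * (N (T u))\<^sup>2" by simp
      also have "\<dots> \<le> (N u)\<^sup>2 - t * (c * N u)\<^sup>2"
        using T_below[OF u] c t by (intro diff_left_mono mult_left_mono power_mono) auto
      also have "\<dots> = (k * N u)\<^sup>2"
        using tc by (simp add: k_def power_mult_distrib algebra_simps)
      finally show ?thesis unfolding u_def[symmetric]
        by (rule power2_le_imp_le) (use tc in \<open>auto simp: k_def\<close>)
    qed
    have ne: "ell2 A w \<noteq> {}" using ell2_0 by blast
    obtain f where f: "f \<in> ell2 A w" "\<Phi> f = f"
    proof (rule Banach_fixedpoint_thm[OF ell2_complete ne _ \<open>k < 1\<close> con])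
      show "\<Phi> \<in> ell2 A w \<rightarrow> ell2 A w" using \<Phi> by blast
    qed
    have Tfh: "(\<lambda>y. T f y - h y) \<in> ell2 A w" by (intro ell2_diff T f h)
    have "T' (\<lambda>y. T f y - h y) x = 0" for x
      using fun_cong[OF f(2), of x] t by (simp add: \<Phi>_def)
    then have "N (T' (\<lambda>y. T f y - h y)) = 0" by (simp add: ell2_norm_def)
    then have "c * N (\<lambda>y. T f y - h y) \<le> 0" using T'_below[OF Tfh] by simp
    then have "N (\<lambda>y. T f y - h y) \<le> 0" using c(1) by (simp add: mult_le_0_iff)
    then have "N (\<lambda>y. T f y - h y) = 0" by (simp add: order_antisym)
    then have "T f = h" using T[OF f(1)] h by simp
    then show ?thesis using f(1) by blast
  qed
  show ?thesis using inj surj T by (auto simp: bij_betw_def)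
qed

end

section \<open>Undirected multigraphs\<close>

text \<open>Connectedness through the edges in \<open>F\<close>, phrased without paths.\<close>

definition linked :: "('v, 'e) pre_digraph \<Rightarrow> 'e set \<Rightarrow> bool" where
  "linked G F \<longleftrightarrow>
     (\<forall>S\<subseteq>verts G. S \<noteq> {} \<longrightarrow> (\<forall>e\<in>F. tail G e \<in> S \<longleftrightarrow> head G e \<in> S) \<longrightarrow> S = verts G)"

definition incident :: "('v, 'e) pre_digraph \<Rightarrow> 'e \<Rightarrow> 'v \<Rightarrow> bool" where
  "incident G e v \<longleftrightarrow> tail G e = v \<or> head G e = v"

text \<open>A pair \<open>(e, s)\<close> is a dart: an edge with a direction of travel, as in
  \<open>bidirect\<close>. A loop has two distinct darts with the same start, so counting darts by
  their start counts loops twice, as \<open>degree\<close> does.\<close>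

definition dtail :: "('v, 'e) pre_digraph \<Rightarrow> 'e \<times> bool \<Rightarrow> 'v" where
  "dtail G d = (if snd d then tail G (fst d) else head G (fst d))"

definition dhead :: "('v, 'e) pre_digraph \<Rightarrow> 'e \<times> bool \<Rightarrow> 'v" where
  "dhead G d = (if snd d then head G (fst d) else tail G (fst d))"

definition flip :: "'e \<times> bool \<Rightarrow> 'e \<times> bool" where
  "flip d = (fst d, \<not> snd d)"

lemma flip_simps [simp]:
  "flip (flip d) = d" "fst (flip d) = fst d" "flip d \<noteq> d" "d \<noteq> flip d" "(flip d = flip d') = (d = d')"
  "dtail G (flip d) = dhead G d" "dhead G (flip d) = dtail G d"
  by (auto simp: flip_def dtail_def dhead_def prod_eq_iff)

lemma fst_eq_dart_cases: "fst d = fst d' \<Longrightarrow> d = d' \<or> d = flip d'"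
  by (cases d; cases d') (auto simp: flip_def)

lemma linkedD:
  assumes "linked G F" "S \<subseteq> verts G" "S \<noteq> {}" "\<And>e. e \<in> F \<Longrightarrow> tail G e \<in> S \<longleftrightarrow> head G e \<in> S"
  shows "S = verts G"
  using assms unfolding linked_def by blast

lemma linked_mono: "linked G F \<Longrightarrow> F \<subseteq> F' \<Longrightarrow> linked G F'"
  unfolding linked_def by blast

lemma connected_imp_linked:
  assumes "Digraph_Component.connected G"
  shows "verts G \<noteq> {}" and "linked G (arcs G)"
proof -
  show "verts G \<noteq> {}"
    using assms by (auto simp: Digraph_Component.connected_def strongly_connected_def mk_symmetric_def)
  show "linked G (arcs G)" unfolding linked_def
  proof (intro allI impI)
    fix S assume S: "S \<subseteq> verts G" "S \<noteq> {}" "\<forall>e\<in>arcs G. (tail G e \<in> S) = (head G e \<in> S)"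
    obtain u where u: "u \<in> S" using S by blast
    have "v \<in> S" if v: "v \<in> verts G" for v
    proof -
      have "(u, v) \<in> rtrancl_on (verts G) (\<Union>e\<in>arcs G. {(tail G e, head G e), (head G e, tail G e)})"
        using assms u v S
        by (auto simp: Digraph_Component.connected_def strongly_connected_def mk_symmetric_def reachable_def)
      then show ?thesis by (induction rule: rtrancl_on_induct) (use u S in auto)
    qed
    then show "S = verts G" using S by blast
  qed
qed

text \<open>Minimality of the return time makes the vertices distinct. An edge used twice in the
  same direction repeats a vertex; used in opposite directions, the second dart starts where the
  first one ends, so by minimality it follows immediately, and this is the reversal that
  \<open>nb\<close> forbids.\<close>

lemma undirected_cycleI:
  assumes wf: "wf_digraph G" and x0: "\<And>k. fst (d k) \<in> arcs G" "\<And>k. dhead G (d k) = dtail G (d (Suc k))"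
    and nb: "\<And>k. d (Suc k) \<noteq> flip (d k)"
    and n: "0 < n" "dtail G (d i) = dtail G (d (i + n))"
    and min: "\<And>a b. a < b \<Longrightarrow> b < a + n \<Longrightarrow> dtail G (d a) \<noteq> dtail G (d b)"
  shows "undirected_cycle G (map d [i..<i + n])"
proof -
  define H where "H = bidirect G"
  have H: "tail H = dtail G" "head H = dhead G" "verts H = verts G" "arcs H = arcs G \<times> UNIV"
    by (auto simp: H_def bidirect_def dtail_def dhead_def fun_eq_iff)
  have cas: "pre_digraph.cas H (dtail G (d i)) (map d [i..<i + m]) (dtail G (d (i + m)))" for i m
  proof (induction m arbitrary: i)
    case 0 then show ?case by (simp add: pre_digraph.cas.simps)
  next
    case (Suc m)
    have "[i..<i + Suc m] = i # [Suc i..<Suc i + m]" by (simp add: upt_conv_Cons)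
    then show ?case using Suc[of "Suc i"] x0(2) H by (simp add: pre_digraph.cas.simps)
  qed
  have ne: "map d [i..<i + n] \<noteq> []" using n by simp
  have dv: "dtail G (d a) \<in> verts G" for a
    using x0(1)[of a] wf_digraph.tail_in_verts[OF wf] wf_digraph.head_in_verts[OF wf] by (auto simp: dtail_def)
  have aw: "pre_digraph.awalk H (dtail G (d i)) (map d [i..<i + n]) (dtail G (d i))"
    unfolding pre_digraph.awalk_def
  proof (intro conjI)
    show "set (map d [i..<i + n]) \<subseteq> arcs H"
    proof
      fix y assume "y \<in> set (map d [i..<i + n])"
      then obtain k where "y = d k" by auto
      then show "y \<in> arcs H" using x0(1)[of k] H by (simp add: mem_Times_iff)
    qed
  qed (use cas[of i n] n dv H in auto)
  have "tl (pre_digraph.awalk_verts H (dtail G (d i)) (map d [i..<i + n])) = map (\<lambda>k. dtail G (d (Suc k))) [i..<i + n]"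
    using pre_digraph.awalk_verts_conv'[OF cas[of i n]] ne x0(2) H by (auto simp: o_def)
  also have "distinct \<dots>"
    unfolding distinct_map
  proof (intro conjI distinct_upt inj_onI)
    fix a b assume ab: "a \<in> set [i..<i + n]" "b \<in> set [i..<i + n]" "dtail G (d (Suc a)) = dtail G (d (Suc b))"
    show "a = b"
      using min[of "Suc a" "Suc b"] min[of "Suc b" "Suc a"] ab by (cases a b rule: linorder_cases) auto
  qed
  finally have di: "distinct (tl (pre_digraph.awalk_verts H (dtail G (d i)) (map d [i..<i + n])))" .
  have df: "fst (d a) \<noteq> fst (d b)" if "a < b" "b < a + n" for a b
  proof
    assume "fst (d a) = fst (d b)"
    then consider "d b = d a" | "d b = flip (d a)" using fst_eq_dart_cases[of "d b" "d a"] by auto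
    then show False
    proof cases
      case 1 then show False using min[OF that] by simp
    next
      case 2
      then have "dtail G (d b) = dtail G (d (Suc a))" using x0(2) by simp
      then have "b = Suc a" using min[of "Suc a" b] that by (cases "Suc a < b") auto
      then show False using nb[of a] 2 by simp
    qed
  qed
  have "distinct (map fst (map d [i..<i + n]))"
    unfolding distinct_map map_map o_def
  proof (intro conjI distinct_upt inj_onI)
    fix a b assume ab: "a \<in> set [i..<i + n]" "b \<in> set [i..<i + n]" "fst (d a) = fst (d b)"
    show "a = b"
      using df[of a b] df[of b a] ab by (cases a b rule: linorder_cases) auto
  qed
  then show ?thesis
    unfolding undirected_cycle_def pre_digraph.cycle_def using aw di ne H_def by blast
qed

text \<open>Walk through \<open>F\<close> without turning back. Since \<open>F\<close> is finite
  some vertex recurs, and the shortest return, minimized over all starting points of the walk,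
  closes up to a cycle.\<close>

lemma undirected_cycle_exists:
  assumes wf: "wf_digraph G" and F: "F \<subseteq> arcs G" "finite F" "F \<noteq> {}"
    and cont: "\<And>d. fst d \<in> F \<Longrightarrow> \<exists>d'. fst d' \<in> F \<and> dtail G d' = dhead G d \<and> d' \<noteq> flip d"
  shows "\<exists>p. undirected_cycle G p"
proof -
  obtain nx where nx: "\<And>d. fst d \<in> F \<Longrightarrow> fst (nx d) \<in> F \<and> dtail G (nx d) = dhead G d \<and> nx d \<noteq> flip d"
    using cont by metis
  obtain e where e: "e \<in> F" using F by blast
  define d where "d k = (nx ^^ k) (e, True)" for k
  have dF: "fst (d k) \<in> F" for k by (induction k) (use e nx in \<open>auto simp: d_def\<close>)
  have ds: "dtail G (d (Suc k)) = dhead G (d k)" "d (Suc k) \<noteq> flip (d k)" for k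
    using nx[OF dF[of k]] by (auto simp: d_def)
  have "finite (range (\<lambda>k. dtail G (d k)))"
    by (rule finite_subset[of _ "tail G ` F \<union> head G ` F"]) (use F dF in \<open>auto simp: dtail_def\<close>)
  then have "\<not> inj (\<lambda>k. dtail G (d k))" using finite_imageD infinite_UNIV_nat by blast
  then obtain i j where ij: "i < j" "dtail G (d i) = dtail G (d j)"
    by (metis injI linorder_neqE_nat)
  define P where "P n \<longleftrightarrow> n > 0 \<and> (\<exists>i. dtail G (d i) = dtail G (d (i + n)))" for n
  have "P (j - i)" using ij unfolding P_def by (intro conjI exI[of _ i]) auto
  then have P: "P (LEAST n. P n)" by (rule LeastI)
  then obtain i0 where i0: "dtail G (d i0) = dtail G (d (i0 + (LEAST n. P n)))" by (auto simp: P_def)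
  have "undirected_cycle G (map d [i0..<i0 + (LEAST n. P n)])"
  proof (rule undirected_cycleI[OF wf])
    fix a b assume ab: "a < b" "b < a + (LEAST n. P n)"
    then have no: "\<not> P (b - a)" using not_less_Least[of "b - a" P] by linarith
    show "dtail G (d a) \<noteq> dtail G (d b)"
    proof
      assume "dtail G (d a) = dtail G (d b)"
      then have "P (b - a)" unfolding P_def using ab by (intro conjI exI[of _ a]) auto
      then show False using no by simp
    qed
  qed (use dF F ds i0 P in \<open>auto simp: P_def\<close>)
  then show ?thesis by blast
qed

text \<open>Without a cycle some dart cannot be continued inside \<open>F\<close>, so its head is a
  leaf of the subgraph formed by \<open>F\<close>. Deleting its edge removes this head from the set
  of end points, and induction on the number of edges applies.\<close>

lemma acyclic_card_le:
  assumes wf: "wf_digraph G" and ac: "\<nexists>p. undirected_cycle G p" and F: "F \<subseteq> arcs G" "finite F"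
  shows "card F \<le> card (tail G ` F \<union> head G ` F)"
  using F
proof (induction "card F" arbitrary: F)
  case 0 then show ?case by simp
next
  case (Suc n)
  then have ne: "F \<noteq> {}" by auto
  obtain d where d: "fst d \<in> F" and only: "\<And>d'. fst d' \<in> F \<Longrightarrow> dtail G d' = dhead G d \<Longrightarrow> d' = flip d"
    using undirected_cycle_exists[OF wf Suc.prems ne] ac by blast
  define F' where "F' = F - {fst d}"
  have F': "card F' = n" "F' \<subseteq> arcs G" "finite F'" using Suc d by (auto simp: F'_def)
  have "dhead G d \<notin> tail G ` F' \<union> head G ` F'"
  proof
    assume "dhead G d \<in> tail G ` F' \<union> head G ` F'"
    then obtain d' where "fst d' \<in> F'" "dtail G d' = dhead G d"
      by (auto simp: dtail_def) (metis fst_conv snd_conv)+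
    then show False using only[of d'] by (auto simp: F'_def)
  qed
  moreover have "dhead G d \<in> tail G ` F \<union> head G ` F" using d by (auto simp: dhead_def)
  moreover have "tail G ` F' \<union> head G ` F' \<subseteq> tail G ` F \<union> head G ` F" by (auto simp: F'_def)
  ultimately have "tail G ` F' \<union> head G ` F' \<subset> tail G ` F \<union> head G ` F" by blast
  then have "card (tail G ` F' \<union> head G ` F') < card (tail G ` F \<union> head G ` F)"
    by (rule psubset_card_mono[rotated]) (use Suc.prems in simp)
  then show ?case using Suc.hyps(1)[OF _ F'(2,3)] F'(1) Suc.hyps(2) by simp
qed

text \<open>The last conjunct says that trees carry no magnetic flux.\<close>

lemma spanning_tree_coboundary:
  fixes G :: "('v, 'e) pre_digraph"
  assumes wf: "wf_digraph G" and fin: "finite (verts G)" and ne: "verts G \<noteq> {}"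
    and E: "E \<subseteq> arcs G" "linked G E"
  shows "\<exists>F\<subseteq>E. finite F \<and> card F + 1 = card (verts G) \<and> linked G F \<and>
           (\<forall>\<sigma> :: 'e \<Rightarrow> 'g :: ab_group_add. \<exists>U. \<forall>e\<in>F. \<sigma> e = U (head G e) - U (tail G e))"
proof -
  \<comment> \<open>\<open>F\<close> is a tree with vertex set \<open>W\<close>: the fifth and sixth
    clauses express that \<open>F\<close> lives on \<open>W\<close> and connects it. Such trees are
    grown one vertex at a time.\<close>
  define Q where "Q W F \<longleftrightarrow> F \<subseteq> E \<and> W \<subseteq> verts G \<and> finite F \<and> card F + 1 = card W \<and>
      (\<forall>e\<in>F. tail G e \<in> W \<and> head G e \<in> W) \<and>
      (\<forall>S\<subseteq>W. S \<noteq> {} \<longrightarrow> (\<forall>e\<in>F. tail G e \<in> S \<longleftrightarrow> head G e \<in> S) \<longrightarrow> S = W) \<and>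
      (\<forall>\<sigma> :: 'e \<Rightarrow> 'g. \<exists>U. \<forall>e\<in>F. \<sigma> e = U (head G e) - U (tail G e))" for W F
  have ex: "\<exists>W F. Q W F \<and> card W = Suc k" if "Suc k \<le> card (verts G)" for k
    using that
  proof (induction k)
    case 0
    obtain r where "r \<in> verts G" using ne by blast
    then have "Q {r} {} \<and> card {r} = Suc 0" by (auto simp: Q_def)
    then show ?case by blast
  next
    case (Suc k)
    then obtain W F where WF: "Q W F" "card W = Suc k" by auto
    have W: "W \<subseteq> verts G" "W \<noteq> {}" "W \<noteq> verts G" "finite W" "F \<subseteq> E" "finite F"
      using WF Suc.prems fin finite_subset unfolding Q_def by auto
    obtain e where e: "e \<in> E" "tail G e \<in> W \<longleftrightarrow> head G e \<notin> W"
      using linkedD[OF E(2) W(1,2)] W(3) by blast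
    define u v where "u = (if tail G e \<in> W then tail G e else head G e)"
      and "v = (if tail G e \<in> W then head G e else tail G e)"
    have uv: "u \<in> W" "v \<notin> W" "v \<in> verts G" "{tail G e, head G e} = {u, v}"
      using e E wf_digraph.tail_in_verts[OF wf] wf_digraph.head_in_verts[OF wf]
      by (auto simp: u_def v_def)
    have Fe: "tail G e' \<in> W" "head G e' \<in> W" if "e' \<in> F" for e' using WF that by (auto simp: Q_def)
    have eF: "e \<notin> F" using Fe e by blast
    have "Q (insert v W) (insert e F)"
      unfolding Q_def
    proof (intro conjI)
      show "card (insert e F) + 1 = card (insert v W)" using WF eF uv W by (auto simp: Q_def)
      show "\<forall>e\<in>insert e F. tail G e \<in> insert v W \<and> head G e \<in> insert v W"
        using Fe uv by (auto simp: doubleton_eq_iff)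
      show "\<forall>S\<subseteq>insert v W. S \<noteq> {} \<longrightarrow> (\<forall>e\<in>insert e F. (tail G e \<in> S) = (head G e \<in> S)) \<longrightarrow> S = insert v W"
      proof (intro allI impI)
        fix S assume S: "S \<subseteq> insert v W" "S \<noteq> {}" "\<forall>e\<in>insert e F. (tail G e \<in> S) = (head G e \<in> S)"
        have us: "u \<in> S \<longleftrightarrow> v \<in> S" using S(3) uv(4) by (auto simp: doubleton_eq_iff)
        then have "S \<inter> W \<noteq> {}" using S uv by blast
        moreover have "\<forall>e\<in>F. tail G e \<in> S \<inter> W \<longleftrightarrow> head G e \<in> S \<inter> W" using S(3) Fe by auto
        ultimately have "S \<inter> W = W" using WF unfolding Q_def by (metis Int_lower2)
        then show "S = insert v W" using us uv S by blast
      qed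
      show "\<forall>\<sigma> :: 'e \<Rightarrow> 'g. \<exists>U. \<forall>e\<in>insert e F. \<sigma> e = U (head G e) - U (tail G e)"
      proof
        fix \<sigma> :: "'e \<Rightarrow> 'g"
        obtain U where U: "\<And>e. e \<in> F \<Longrightarrow> \<sigma> e = U (head G e) - U (tail G e)"
          using WF unfolding Q_def by metis
        \<comment> \<open>The potential at the new vertex is still free, and \<open>e\<close> is the
          only edge of the tree that reaches it, so the equation at \<open>e\<close> dictates its
          value.\<close>
        define U' where "U' = U(v := if v = head G e then U u + \<sigma> e else U u - \<sigma> e)"
        have "\<sigma> e' = U' (head G e') - U' (tail G e')" if "e' \<in> insert e F" for e'
        proof (cases "e' = e")
          case True
          then show ?thesis using uv e by (auto simp: U'_def u_def v_def)
        next
          case False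
          then have "head G e' \<noteq> v" "tail G e' \<noteq> v" using Fe that uv by auto
          then show ?thesis using U False that by (simp add: U'_def)
        qed
        then show "\<exists>U. \<forall>e\<in>insert e F. \<sigma> e = U (head G e) - U (tail G e)" by blast
      qed
    qed (use e W uv in auto)
    moreover have "card (insert v W) = Suc (Suc k)" using WF uv W by simp
    ultimately show ?case by blast
  qed
  have "0 < card (verts G)" using fin ne by (simp add: card_gt_0_iff)
  then obtain W F where WF: "Q W F" "card W = card (verts G)" using ex[of "card (verts G) - 1"] by auto
  note q = WF(1)[unfolded Q_def]
  have "W \<subseteq> verts G" using q by (elim conjE)
  then have W: "W = verts G" by (rule card_subset_eq[OF fin]) (rule WF(2))
  show ?thesis
    unfolding linked_def using q[unfolded W] by (elim conjE) (intro exI[of _ F] conjI; assumption)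
qed

lemma degree_eq_darts:
  assumes "finite (in_arcs G v)" "finite (out_arcs G v)"
  shows "finite {d. fst d \<in> arcs G \<and> dtail G d = v}"
    and "degree G v = card {d. fst d \<in> arcs G \<and> dtail G d = v}"
proof -
  have *: "{d. fst d \<in> arcs G \<and> dtail G d = v} = (\<lambda>e. (e, False)) ` in_arcs G v \<union> (\<lambda>e. (e, True)) ` out_arcs G v"
    by (auto simp: dtail_def image_iff split: if_splits)
  show "finite {d. fst d \<in> arcs G \<and> dtail G d = v}" unfolding * using assms by simp
  have "card ((\<lambda>e. (e, False)) ` in_arcs G v \<union> (\<lambda>e. (e, True)) ` out_arcs G v)
      = card ((\<lambda>e. (e, False)) ` in_arcs G v) + card ((\<lambda>e. (e, True)) ` out_arcs G v)"
    using assms by (intro card_Un_disjoint) auto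
  then show "degree G v = card {d. fst d \<in> arcs G \<and> dtail G d = v}"
    unfolding * degree_def in_degree_def out_degree_def
    by (simp add: card_image inj_on_def)
qed

lemma sum_degree:
  assumes "fin_digraph G"
  shows "(\<Sum>v\<in>verts G. degree G v) = 2 * card (arcs G)"
proof -
  interpret fin_digraph G by fact
  have "(\<Sum>v\<in>verts G. card (in_arcs G v)) = card (\<Union>v\<in>verts G. in_arcs G v)"
    by (rule card_UN_disjoint[symmetric]) auto
  moreover have "(\<Union>v\<in>verts G. in_arcs G v) = arcs G" by auto
  moreover have "(\<Sum>v\<in>verts G. card (out_arcs G v)) = card (\<Union>v\<in>verts G. out_arcs G v)"
    by (rule card_UN_disjoint[symmetric]) auto
  moreover have "(\<Union>v\<in>verts G. out_arcs G v) = arcs G" by auto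
  ultimately show ?thesis by (simp add: degree_def in_degree_def out_degree_def sum.distrib)
qed

text \<open>
  In a connected unicyclic graph with a leaf, some vertex \<open>c\<close> of the cycle carries a branch \<open>B\<close>:
  \<open>e\<^sub>1\<close> is a bridge and \<open>e\<^sub>0\<close> an edge of the cycle, and deleting \<open>e\<^sub>0\<close> leaves a tree.
\<close>

lemma branch_on_cycle:
  fixes G :: "('v, 'e) pre_digraph"
  assumes "fin_digraph G" and lk: "linked G (arcs G)" and cd: "card (arcs G) = card (verts G)"
    and l: "l \<in> verts G" "degree G l = 1"
  shows "\<exists>c e0 e1 b1 B. e0 \<in> arcs G \<and> e1 \<in> arcs G \<and> e0 \<noteq> e1 \<and> incident G e0 c \<and>
     {tail G e1, head G e1} = {c, b1} \<and> B \<subseteq> verts G \<and> c \<in> verts G - B \<and> b1 \<in> B \<and>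
     (\<forall>e\<in>arcs G - {e1}. tail G e \<in> B \<longleftrightarrow> head G e \<in> B) \<and>
     (\<forall>\<sigma> :: 'e \<Rightarrow> 'g :: ab_group_add. \<exists>U. \<forall>e\<in>arcs G - {e0}. \<sigma> e = U (head G e) - U (tail G e))"
proof -
  interpret fin_digraph G by fact
  have ne: "verts G \<noteq> {}" using l by blast
  \<comment> \<open>The edges with \<open>nb\<close> are the non-bridges. A bridge and a non-bridge
    with a common vertex are wanted: the former cuts off the branch, the latter lies on the
    cycle.\<close>
  define nb where "nb e \<longleftrightarrow> linked G (arcs G - {e})" for e
  have "card {d. fst d \<in> arcs G \<and> dtail G d = l} = 1"
    using l degree_eq_darts(2)[of G l] finite_in_arcs finite_out_arcs by simp
  then obtain d where d: "{d. fst d \<in> arcs G \<and> dtail G d = l} = {d}" by (rule card_1_singletonE)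
  \<comment> \<open>The only edge at a leaf is a bridge, since the leaf is isolated without it. This
    edge is no loop, because a loop would give two darts at \<open>l\<close>.\<close>
  have "\<not> nb (fst d)"
  proof
    assume "nb (fst d)"
    have dd: "fst d \<in> arcs G" "dtail G d = l" using d by auto
    have hd: "dhead G d \<noteq> l"
    proof
      assume "dhead G d = l"
      then have "flip d \<in> {d. fst d \<in> arcs G \<and> dtail G d = l}" using dd by simp
      then show False unfolding d by simp
    qed
    have un: "d' = d" if "fst d' \<in> arcs G" "dtail G d' = l" for d' using d that by blast
    have "tail G e \<noteq> l \<and> head G e \<noteq> l" if "e \<in> arcs G - {fst d}" for e
      using un[of "(e, True)"] un[of "(e, False)"] that by (auto simp: dtail_def)
    then have "{l} = verts G"
      using linkedD[of G "arcs G - {fst d}" "{l}"] \<open>nb (fst d)\<close> l by (auto simp: nb_def)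
    moreover have "dhead G d \<in> verts G" using dd by (auto simp: dhead_def)
    ultimately show False using hd by blast
  qed
  then obtain eb where eb: "eb \<in> arcs G" "\<not> nb eb" using d by blast
  \<comment> \<open>A spanning tree has one edge fewer than there are vertices, so by
    \<open>cd\<close> some edge lies outside it, and deleting that edge keeps the graph
    connected.\<close>
  obtain F where F: "F \<subseteq> arcs G" "card F + 1 = card (verts G)" "linked G F"
    using spanning_tree_coboundary[OF wf_digraph finite_verts ne subset_refl lk, where 'g = 'g] by auto
  then obtain en where en: "en \<in> arcs G" "en \<notin> F" using cd by (metis add.right_neutral add_left_cancel subsetI subset_antisym zero_neq_one)
  have "nb en" unfolding nb_def by (rule linked_mono[OF F(3)]) (use F en in auto)
  have "\<exists>c e0 e1. e0 \<in> arcs G \<and> e1 \<in> arcs G \<and> nb e0 \<and> \<not> nb e1 \<and> incident G e0 c \<and> incident G e1 c"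
  proof (rule ccontr)
    assume no: "\<not> ?thesis"
    \<comment> \<open>If bridges and non-bridges never met, no edge could leave the set of vertices
      on non-bridges: both ends of a non-bridge belong to it, and neither end of a bridge
      does.\<close>
    define S where "S = {v \<in> verts G. \<exists>e\<in>arcs G. nb e \<and> incident G e v}"
    have "S = verts G"
    proof (rule linkedD[OF lk])
      have "tail G en \<in> S" using en \<open>nb en\<close> by (auto simp: S_def incident_def)
      then show "S \<noteq> {}" by blast
      fix e assume e: "e \<in> arcs G"
      show "(tail G e \<in> S) = (head G e \<in> S)"
      proof (cases "nb e")
        case True
        then show ?thesis using e by (auto simp: S_def incident_def)
      next
        case False
        have "incident G e (tail G e)" "incident G e (head G e)" by (auto simp: incident_def)
        then show ?thesis using e False no by (auto simp: S_def)
      qed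
    qed (auto simp: S_def)
    moreover have "tail G eb \<notin> S" using no eb by (auto simp: S_def incident_def)
    ultimately show False using eb by auto
  qed
  then obtain c e0 e1 where ce: "e0 \<in> arcs G" "e1 \<in> arcs G" "nb e0" "\<not> nb e1" "incident G e0 c" "incident G e1 c"
    by blast
  obtain S where S: "S \<subseteq> verts G" "S \<noteq> {}" "S \<noteq> verts G"
    "\<And>e. e \<in> arcs G - {e1} \<Longrightarrow> tail G e \<in> S \<longleftrightarrow> head G e \<in> S"
    using ce(4) unfolding nb_def linked_def by blast
  \<comment> \<open>Of the two sides of the cut at \<open>e1\<close>, the one without
    \<open>c\<close>.\<close>
  define B where "B = (if c \<in> S then verts G - S else S)"
  have cV: "c \<in> verts G" using ce by (auto simp: incident_def)
  have B: "B \<subseteq> verts G" "B \<noteq> {}" "c \<notin> B" using S cV by (auto simp: B_def)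
  have Bcl: "tail G e \<in> B \<longleftrightarrow> head G e \<in> B" if "e \<in> arcs G - {e1}" for e
    using S(4)[OF that] that by (auto simp: B_def)
  have "\<not> (tail G e1 \<in> B \<longleftrightarrow> head G e1 \<in> B)"
  proof
    assume "tail G e1 \<in> B \<longleftrightarrow> head G e1 \<in> B"
    then have "B = verts G" using linkedD[OF lk B(1,2)] Bcl by blast
    then show False using B cV by blast
  qed
  then obtain b1 where b1: "{tail G e1, head G e1} = {c, b1}" "b1 \<in> B"
    using ce(6) B(3) by (auto simp: incident_def)
  have "e0 \<noteq> e1" using ce by blast
  obtain F' where F': "F' \<subseteq> arcs G - {e0}" "card F' + 1 = card (verts G)"
    "\<forall>\<sigma> :: 'e \<Rightarrow> 'g. \<exists>U. \<forall>e\<in>F'. \<sigma> e = U (head G e) - U (tail G e)"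
    using spanning_tree_coboundary[OF wf_digraph finite_verts ne, of "arcs G - {e0}", where 'g = 'g] ce(3)
    unfolding nb_def by auto
  \<comment> \<open>By the edge count, a spanning tree that avoids \<open>e0\<close> uses all other
    edges, so the coboundary property holds on all of them.\<close>
  have "F' = arcs G - {e0}"
    by (rule card_subset_eq) (use F' ce cd in auto)
  then show ?thesis using F' ce B Bcl b1 cV \<open>e0 \<noteq> e1\<close>
    by (intro exI[of _ c] exI[of _ e0] exI[of _ e1] exI[of _ b1] exI[of _ B]) auto
qed

section \<open>Two-regular connected graphs: the line and the cycles\<close>

lemma undirected_isoI_inv:
  assumes "wf_digraph H" "bij_betw h (verts H) (verts G)" "bij_betw k (arcs H) (arcs G)"
    and ends: "\<And>e. e \<in> arcs H \<Longrightarrow> {tail G (k e), head G (k e)} = {h (tail H e), h (head H e)}"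
  shows "undirected_iso G H"
proof -
  let ?h = "the_inv_into (verts H) h" and ?k = "the_inv_into (arcs H) k"
  have inj: "inj_on h (verts H)" "inj_on k (arcs H)" using assms by (auto simp: bij_betw_def)
  have "{tail H (?k e), head H (?k e)} = {?h (tail G e), ?h (head G e)}" if e: "e \<in> arcs G" for e
  proof -
    have kk: "?k e \<in> arcs H" "k (?k e) = e"
      using e assms(3) by (auto simp: bij_betw_def the_inv_into_into f_the_inv_into_f)
    have v: "tail H (?k e) \<in> verts H" "head H (?k e) \<in> verts H"
      using kk assms(1) by (auto simp: wf_digraph_def)
    have "?h ` {tail G e, head G e} = ?h ` h ` {tail H (?k e), head H (?k e)}" using ends[OF kk(1)] kk(2) by simp
    also have "\<dots> = {tail H (?k e), head H (?k e)}" using v inj by (simp add: the_inv_into_f_f)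
    finally show ?thesis by simp
  qed
  then show ?thesis unfolding undirected_iso_def
    using bij_betw_the_inv_into[OF assms(2)] bij_betw_the_inv_into[OF assms(3)] by blast
qed

text \<open>The degree counts how often a vertex occurs as an end of an edge, and this number
  depends only on the unordered pair of ends, also for loops; reversing orientations is therefore
  harmless.\<close>

lemma degree_undirected_iso:
  assumes G: "fin_digraph G"
    and h: "bij_betw h (verts G) (verts H)" and k: "bij_betw k (arcs G) (arcs H)"
    and ends: "\<forall>e\<in>arcs G. {tail H (k e), head H (k e)} = {h (tail G e), h (head G e)}"
    and v: "v \<in> verts G"
  shows "degree H (h v) = degree G v"
proof -
  interpret fin_digraph G by fact
  have inj: "inj_on k (arcs G)" "k ` arcs G = arcs H" "inj_on h (verts G)" using h k by (auto simp: bij_betw_def)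
  have fH: "finite (arcs H)" using inj finite_arcs by (metis finite_imageI)
  have dg: "degree X u = (\<Sum>e\<in>arcs X. of_bool (head X e = u) + of_bool (tail X e = u))"
    if "finite (arcs X)" for X :: "('x, 'y) pre_digraph" and u
  proof -
    have "in_arcs X u = {e \<in> arcs X. head X e = u}" "out_arcs X u = {e \<in> arcs X. tail X e = u}" by auto
    then show ?thesis using that
      by (simp add: degree_def in_degree_def out_degree_def sum.distrib of_bool_def sum.If_cases Int_def)
  qed
  have "degree H (h v) = (\<Sum>e\<in>arcs G. of_bool (head H (k e) = h v) + of_bool (tail H (k e) = h v))"
    unfolding dg[OF fH] inj(2)[symmetric] by (subst sum.reindex[OF inj(1)]) simp
  also have "\<dots> = (\<Sum>e\<in>arcs G. of_bool (head G e = v) + of_bool (tail G e = v))"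
  proof (rule sum.cong[OF refl])
    fix e assume e: "e \<in> arcs G"
    have "h (head G e) = h v \<longleftrightarrow> head G e = v" "h (tail G e) = h v \<longleftrightarrow> tail G e = v"
      using inj(3) e v by (auto simp: inj_on_eq_iff)
    then show "(of_bool (head H (k e) = h v) + of_bool (tail H (k e) = h v) :: nat)
        = of_bool (head G e = v) + of_bool (tail G e = v)"
      using bspec[OF ends e] by (auto simp: doubleton_eq_iff)
  qed
  finally show ?thesis using dg[OF finite_arcs] by simp
qed

lemma degree_cycle_graph:
  assumes "i < n"
  shows "degree (cycle_graph n) i = 2"
proof -
  have "out_arcs (cycle_graph n) i = {i}" using assms by (auto simp: cycle_graph_def out_arcs_def)
  \<comment> \<open>The predecessor of 0 is \<open>n - 1\<close>. For \<open>n = 1\<close> this is 0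
    itself, and the loop counts once as incoming and once as outgoing.\<close>
  moreover have "in_arcs (cycle_graph n) i = {if i = 0 then n - 1 else i - 1}"
    using assms by (auto simp: cycle_graph_def in_arcs_def mod_Suc split: if_splits)
  ultimately show ?thesis by (simp add: degree_def in_degree_def out_degree_def)
qed

lemma cycle_graph_regular:
  assumes "fin_digraph G" "is_cycle_graph G" "v \<in> verts G"
  shows "degree G v = 2"
proof -
  obtain n h k where *: "bij_betw h (verts G) (verts (cycle_graph n))" "bij_betw k (arcs G) (arcs (cycle_graph n))"
    "\<forall>e\<in>arcs G. {tail (cycle_graph n) (k e), head (cycle_graph n) (k e)} = {h (tail G e), h (head G e)}"
    using assms unfolding is_cycle_graph_def undirected_iso_def by blast
  have "h v \<in> {0..<n}" using *(1) assms(3) by (auto simp: bij_betw_def cycle_graph_def)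
  then show ?thesis using degree_undirected_iso[OF assms(1) * assms(3)] degree_cycle_graph by simp
qed

text \<open>
  The walk that never turns back does not use an edge in both directions: otherwise, walking on
  from both ends, one meets a dart that equals its own reversal or is followed by it.
\<close>

lemma two_regular_walk:
  fixes G :: "('v, 'e) pre_digraph"
  assumes wf: "wf_digraph G" and lk: "linked G (arcs G)" and ne: "verts G \<noteq> {}"
    and fin: "\<And>v. v \<in> verts G \<Longrightarrow> finite (in_arcs G v) \<and> finite (out_arcs G v)"
    and deg: "\<And>v. v \<in> verts G \<Longrightarrow> degree G v = 2"
  obtains d :: "int \<Rightarrow> 'e \<times> bool"
  where "\<And>k. fst (d k) \<in> arcs G" "\<And>k. dhead G (d k) = dtail G (d (k + 1))"
    "\<And>j k. dtail G (d j) = dtail G (d k) \<longleftrightarrow> d j = d k"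
    "\<And>j k. fst (d j) = fst (d k) \<longleftrightarrow> d j = d k"
    "\<And>j k m. d (j + m) = d (k + m) \<longleftrightarrow> d j = d k"
    "range (\<lambda>k. dtail G (d k)) = verts G" "range (\<lambda>k. fst (d k)) = arcs G"
proof -
  define A :: "('e \<times> bool) set" where "A = {d. fst d \<in> arcs G}"
  define D where "D v = {d \<in> A. dtail G d = v}" for v
  have cardD: "card (D v) = 2" if "v \<in> verts G" for v
    using degree_eq_darts(2)[of G v] fin[OF that] deg[OF that] by (simp add: D_def A_def)
  have inV: "dtail G d \<in> verts G" "dhead G d \<in> verts G" if "d \<in> A" for d
    using that wf by (auto simp: A_def dtail_def dhead_def wf_digraph_def)
  have fA: "flip d \<in> A \<longleftrightarrow> d \<in> A" for d by (simp add: A_def)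
  have other: "\<exists>d'. D (dtail G d) = {d, d'} \<and> d' \<noteq> d" if "d \<in> A" for d
  proof -
    have "d \<in> D (dtail G d)" using that by (simp add: D_def)
    moreover have "card (D (dtail G d)) = 2" by (rule cardD[OF inV(1)[OF that]])
    then obtain p q where "D (dtail G d) = {p, q}" "p \<noteq> q"
      unfolding card_2_iff by blast
    ultimately show ?thesis by (metis doubleton_eq_iff insertE singletonD)
  qed
  define oth where "oth d = (SOME d'. D (dtail G d) = {d, d'} \<and> d' \<noteq> d)" for d
  have oth: "D (dtail G d) = {d, oth d}" "oth d \<noteq> d" if "d \<in> A" for d
    using someI_ex[OF other[OF that]] by (auto simp: oth_def)
  have othA: "oth d \<in> A" "dtail G (oth d) = dtail G d" if "d \<in> A" for d
    using oth(1)[OF that] by (auto simp: D_def)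
  have oo: "oth (oth d) = d" if "d \<in> A" for d
    using oth[OF that] oth[OF othA(1)[OF that]] othA(2)[OF that] by (auto simp: doubleton_eq_iff)
  \<comment> \<open>\<open>nx\<close> leaves the end of \<open>d\<close> by the dart other than the
    reversal of \<open>d\<close>, hence never turns back. Its inverse \<open>pv\<close> extends the
    walk to negative indices.\<close>
  define nx where "nx d = oth (flip d)" for d
  define pv where "pv d = flip (oth d)" for d
  have nxA: "nx d \<in> A" "dtail G (nx d) = dhead G d" "nx d \<noteq> flip d" "pv (nx d) = d" if "d \<in> A" for d
    using that fA othA[of "flip d"] oth[of "flip d"] oo[of "flip d"] by (auto simp: nx_def pv_def)
  have pvA: "pv d \<in> A" "nx (pv d) = d" if "d \<in> A" for d
    using that fA othA oo by (auto simp: nx_def pv_def)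
  obtain v0 where "v0 \<in> verts G" using ne by blast
  then have "D v0 \<noteq> {}" using cardD by fastforce
  then obtain d0 where d0: "d0 \<in> A" by (auto simp: D_def)
  define d where "d k = (if k \<ge> 0 then (nx ^^ nat k) d0 else (pv ^^ nat (- k)) d0)" for k :: int
  have dA: "d k \<in> A" for k
  proof -
    have "(nx ^^ m) d0 \<in> A" "(pv ^^ m) d0 \<in> A" for m by (induction m) (use d0 nxA pvA in auto)
    then show ?thesis by (simp add: d_def)
  qed
  have dn: "d (k + 1) = nx (d k)" for k
  proof (cases "k \<ge> 0")
    case True
    then show ?thesis by (simp add: d_def nat_add_distrib)
  next
    case False
    then have "nat (- k) = Suc (nat (- (k + 1)))" by simp
    then have "d k = pv (d (k + 1))" using False by (cases "k = - 1") (simp_all add: d_def)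
    then show ?thesis using pvA(2)[OF dA] by simp
  qed
  have dp: "pv (d (k + 1)) = d k" for k using dn nxA(4)[OF dA] by simp
  \<comment> \<open>Reversal exchanges walking forwards from \<open>j\<close> with walking backwards
    from \<open>i\<close>.\<close>
  have step: "d (j + 1) = flip (d (i - 1)) \<longleftrightarrow> d j = flip (d i)" for i j
  proof
    assume "d j = flip (d i)"
    then have "d (j + 1) = oth (d i)" by (simp add: dn nx_def)
    then show "d (j + 1) = flip (d (i - 1))" using dp[of "i - 1"] by (simp add: pv_def flip: fst_eq_dart_cases) (metis flip_simps(1))
  next
    assume a: "d (j + 1) = flip (d (i - 1))"
    have "d j = flip (oth (d (j + 1)))" using dp[of j] by (simp add: pv_def)
    also have "\<dots> = flip (nx (d (i - 1)))" using a by (simp add: nx_def)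
    finally show "d j = flip (d i)" using dn[of "i - 1"] by simp
  qed
  have steps: "d (j + int m) = flip (d (i - int m)) \<longleftrightarrow> d j = flip (d i)" for i j m
  proof (induction m)
    case (Suc m)
    then show ?case using step[of "j + int m" "i - int m"] by (simp add: algebra_simps)
  qed simp
  have nf': "d j \<noteq> flip (d i)" if "j \<le> i" for i j
  proof
    assume a: "d j = flip (d i)"
    \<comment> \<open>Half the distance, rounded down: after \<open>m\<close> steps from both sides
      the indices coincide or are neighbours.\<close>
    define m where "m = nat ((i - j) div 2)"
    have m: "int m = (i - j) div 2" using that by (simp add: m_def)
    have e: "d (j + int m) = flip (d (i - int m))" using a steps by simp
    consider "i - int m = j + int m" | "i - int m = j + int m + 1" using m that by linarith
    then show False
    proof cases
      case 1
      show False using e unfolding 1 by (simp only: flip_simps)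
    next
      case 2
      then have "nx (d (j + int m)) = flip (d (j + int m))" using e unfolding 2 dn by (metis flip_simps(1))
      then show False using nxA(3)[OF dA] by simp
    qed
  qed
  have nf: "d j \<noteq> flip (d i)" for i j
    using nf'[of j i] nf'[of i j] by (metis flip_simps(1) linorder_linear)
  \<comment> \<open>The second dart at a vertex of the walk is the reversal of the dart by which the
    walk arrives. As no dart of the walk is the reversal of another, a vertex determines the dart by
    which it is left.\<close>
  have Dk: "D (dtail G (d k)) = {d k, flip (d (k - 1))}" for k
    using oth(1)[OF dA[of k]] dp[of "k - 1"] by (simp add: pv_def) (metis flip_simps(1))
  have tl: "dtail G (d j) = dtail G (d k) \<longleftrightarrow> d j = d k" for j k
  proof
    assume "dtail G (d j) = dtail G (d k)"
    then have "d j \<in> D (dtail G (d k))" using dA by (simp add: D_def)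
    then show "d j = d k" using Dk nf by auto
  qed simp
  have V: "range (\<lambda>k. dtail G (d k)) = verts G"
  proof (rule linkedD[OF lk])
    show "range (\<lambda>k. dtail G (d k)) \<subseteq> verts G" using inV(1)[OF dA] by blast
    have *: "dhead G b \<in> range (\<lambda>k. dtail G (d k))" if b: "b \<in> A" "dtail G b \<in> range (\<lambda>k. dtail G (d k))" for b
    proof -
      obtain k where "dtail G b = dtail G (d k)" using b by auto
      then have "b \<in> D (dtail G (d k))" using b by (simp add: D_def)
      then consider "b = d k" | "b = flip (d (k - 1))" using Dk by auto
      then show ?thesis
      proof cases
        case 1 then show ?thesis using nxA(2)[OF dA[of k]] dn[of k] by (metis rangeI)
      next
        case 2 then show ?thesis by simp
      qed
    qed
    fix e assume "e \<in> arcs G"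
    then show "(tail G e \<in> range (\<lambda>k. dtail G (d k))) = (head G e \<in> range (\<lambda>k. dtail G (d k)))"
      using *[of "(e, True)"] *[of "(e, False)"] by (auto simp: A_def dtail_def dhead_def)
  qed simp
  have E: "range (\<lambda>k. fst (d k)) = arcs G"
  proof
    show "range (\<lambda>k. fst (d k)) \<subseteq> arcs G" using dA by (auto simp: A_def)
    show "arcs G \<subseteq> range (\<lambda>k. fst (d k))"
    proof
      fix e assume e: "e \<in> arcs G"
      then have eA: "(e, True) \<in> A" by (simp add: A_def)
      then obtain k where k: "dtail G (e, True) = dtail G (d k)" using inV(1)[OF eA] V by (metis rangeE)
      then have "(e, True) \<in> D (dtail G (d k))" using eA by (simp add: D_def)
      then have "(e, True) = d k \<or> (e, True) = flip (d (k - 1))" using Dk by auto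
      then have "e = fst (d k) \<or> e = fst (d (k - 1))" by (metis flip_simps(2) fst_conv)
      then show "e \<in> range (\<lambda>k. fst (d k))" by blast
    qed
  qed
  show ?thesis
  proof (rule that)
    show "fst (d j) = fst (d k) \<longleftrightarrow> d j = d k" for j k using fst_eq_dart_cases nf by metis
    have sh: "d (j + int n) = d (k + int n) \<longleftrightarrow> d j = d k" for j k n
    proof (induction n)
      case (Suc n)
      have "d (j + int n + 1) = d (k + int n + 1) \<longleftrightarrow> d (j + int n) = d (k + int n)" using dn dp by metis
      then show ?case using Suc by (simp add: algebra_simps)
    qed simp
    show "d (j + m) = d (k + m) \<longleftrightarrow> d j = d k" for j k m
      using sh[of j "nat m" k] sh[of "j + m" "nat (- m)" "k + m"] by (cases "m \<ge> 0") auto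
    show "dhead G (d k) = dtail G (d (k + 1))" for k using nxA(2)[OF dA] dn by simp
    show "fst (d k) \<in> arcs G" for k using dA by (simp add: A_def)
  qed (use tl V E in auto)
qed

lemma periodic_mod:
  fixes d :: "int \<Rightarrow> 'a"
  assumes "\<And>k. d (k + p) = d k"
  shows "d (k mod p) = d k"
proof -
  have per: "d (k + p * int n) = d k" for k n
  proof (induction n)
    case (Suc n)
    then show ?case using assms[of "k + p * int n"] by (simp add: algebra_simps)
  qed simp
  show ?thesis
  proof (cases "k div p \<ge> 0")
    case True
    then show ?thesis using per[of "k mod p" "nat (k div p)"] by simp
  next
    case False
    then show ?thesis using per[of k "nat (- (k div p))"]
      by (simp add: minus_div_mult_eq_mod[symmetric] algebra_simps)
  qed
qed

lemma dart_ends: "{tail G (fst d), head G (fst d)} = {dtail G d, dhead G d}"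
  by (auto simp: dtail_def dhead_def)

text \<open>The non-backtracking walk meets all vertices and edges. A repeated dart would make it
  periodic and the vertex set finite, so the walk is injective and serves as a coordinate.\<close>

lemma two_regular_infinite:
  assumes wf: "wf_digraph G" and lk: "linked G (arcs G)" and inf: "infinite (verts G)"
    and fin: "\<And>v. v \<in> verts G \<Longrightarrow> finite (in_arcs G v) \<and> finite (out_arcs G v)"
    and deg: "\<And>v. v \<in> verts G \<Longrightarrow> degree G v = 2"
  shows "undirected_iso G lattice_Z"
proof -
  have ne: "verts G \<noteq> {}" using inf by auto
  obtain d :: "int \<Rightarrow> 'b \<times> bool" where d: "\<And>k. fst (d k) \<in> arcs G" "\<And>k. dhead G (d k) = dtail G (d (k + 1))"
    "\<And>j k. dtail G (d j) = dtail G (d k) \<longleftrightarrow> d j = d k"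
    "\<And>j k. fst (d j) = fst (d k) \<longleftrightarrow> d j = d k"
    "\<And>j k m. d (j + m) = d (k + m) \<longleftrightarrow> d j = d k"
    "range (\<lambda>k. dtail G (d k)) = verts G" "range (\<lambda>k. fst (d k)) = arcs G"
    by (rule two_regular_walk[OF wf lk ne fin deg]) (assumption | rule that)+
  have "inj d"
  proof (rule ccontr)
    assume "\<not> inj d"
    then obtain i j where ij: "i < j" "d i = d j" by (metis injI linorder_neqE)
    have "d (k + (j - i)) = d k" for k using d(5)[of j "k - i" i] ij by (simp add: algebra_simps)
    then have perz: "d (k mod (j - i)) = d k" for k by (rule periodic_mod)
    have "verts G \<subseteq> (\<lambda>k. dtail G (d k)) ` {0..<j - i}"
    proof
      fix v assume "v \<in> verts G"
      then obtain k where "v = dtail G (d k)" using d(6) by (metis rangeE)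
      then have "v = dtail G (d (k mod (j - i)))" using perz by simp
      then show "v \<in> (\<lambda>k. dtail G (d k)) ` {0..<j - i}" using ij by (intro image_eqI) auto
    qed
    then show False using inf finite_subset by blast
  qed
  show ?thesis
  proof (rule undirected_isoI_inv[where h = "\<lambda>k. dtail G (d k)" and k = "\<lambda>k. fst (d k)"])
    show "wf_digraph lattice_Z" by (simp add: wf_digraph_def lattice_Z_def)
    show "bij_betw (\<lambda>k. dtail G (d k)) (verts lattice_Z) (verts G)"
      using d(3,6) \<open>inj d\<close> by (auto simp: bij_betw_def lattice_Z_def inj_def)
    show "bij_betw (\<lambda>k. fst (d k)) (arcs lattice_Z) (arcs G)"
      using d(4,7) \<open>inj d\<close> by (auto simp: bij_betw_def lattice_Z_def inj_def)
  qed (use d(2) in \<open>simp add: dart_ends lattice_Z_def\<close>)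
qed

text \<open>In a finite graph the walk repeats a dart. Equality of darts is preserved under shifts
  of the index, so the walk is periodic, and its least period is the length of the cycle.\<close>

lemma two_regular_finite:
  assumes wf: "fin_digraph G" and lk: "linked G (arcs G)" and ne: "verts G \<noteq> {}"
    and deg: "\<And>v. v \<in> verts G \<Longrightarrow> degree G v = 2"
  shows "is_cycle_graph G"
proof -
  interpret fin_digraph G by fact
  obtain d :: "int \<Rightarrow> 'b \<times> bool" where d: "\<And>k. fst (d k) \<in> arcs G" "\<And>k. dhead G (d k) = dtail G (d (k + 1))"
    "\<And>j k. dtail G (d j) = dtail G (d k) \<longleftrightarrow> d j = d k"
    "\<And>j k. fst (d j) = fst (d k) \<longleftrightarrow> d j = d k"
    "\<And>j k m. d (j + m) = d (k + m) \<longleftrightarrow> d j = d k"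
    "range (\<lambda>k. dtail G (d k)) = verts G" "range (\<lambda>k. fst (d k)) = arcs G"
  proof (rule two_regular_walk[OF wf_digraph lk ne _ deg])
    show "finite (in_arcs G v) \<and> finite (out_arcs G v)" for v using finite_in_arcs finite_out_arcs by blast
  qed (assumption | rule that)+
  have "\<not> inj (\<lambda>n. fst (d (int n)))"
  proof
    assume "inj (\<lambda>n. fst (d (int n)))"
    moreover have "finite (range (\<lambda>n. fst (d (int n))))"
      by (rule finite_subset[OF _ finite_arcs]) (use d(1) in auto)
    ultimately show False using finite_imageD infinite_UNIV_nat by blast
  qed
  then obtain i j :: nat where ij: "i < j" "d (int i) = d (int j)" using d(4) unfolding inj_def by (metis linorder_neqE_nat)
  define P where "P n \<longleftrightarrow> n > 0 \<and> d (int n) = d 0" for n :: nat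
  have Pdiff: "P (b - a)" if "a < b" "d (int a) = d (int b)" for a b
    using d(5)[of "int (b - a)" "int a" 0] that by (simp add: P_def of_nat_diff)
  define n where "n = (LEAST n. P n)"
  have "P n" unfolding n_def by (rule LeastI) (rule Pdiff[OF ij])
  then have n: "n > 0" "d (int n) = d 0" by (auto simp: P_def)
  have per: "d (k mod int n) = d k" for k
    by (rule periodic_mod) (use d(5)[of "int n" _ 0] n in \<open>simp add: add.commute\<close>)
  define c where "c k = d (int k)" for k :: nat
  have inj: "c a \<noteq> c b" if "a < b" "b < n" for a b
  proof
    assume "c a = c b"
    then have "P (b - a)" using Pdiff that by (simp add: c_def)
    then show False using not_less_Least[of "b - a" P] that unfolding n_def by linarith
  qed
  have injc: "inj_on c {0..<n}" by (rule inj_onI) (metis atLeastLessThan_iff inj linorder_neqE_nat)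
  have rng: "d k \<in> c ` {0..<n}" for k
    by (rule image_eqI[of _ _ "nat (k mod int n)"]) (use per[of k] n in \<open>auto simp: c_def nat_less_iff\<close>)
  have img: "range d = c ` {0..<n}" using rng by (auto simp: c_def)
  have "undirected_iso G (cycle_graph n)"
  proof (rule undirected_isoI_inv[where h = "\<lambda>k. dtail G (c k)" and k = "\<lambda>k. fst (c k)"])
    show "wf_digraph (cycle_graph n)" by (auto simp: wf_digraph_def cycle_graph_def)
    have "inj_on (\<lambda>k. dtail G (c k)) {0..<n}" "inj_on (\<lambda>k. fst (c k)) {0..<n}"
      using injc d(3,4) by (auto simp: inj_on_def c_def)
    moreover have "(\<lambda>k. dtail G (c k)) ` {0..<n} = verts G" "(\<lambda>k. fst (c k)) ` {0..<n} = arcs G"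
      using d(6,7) img by (metis image_image)+
    ultimately show "bij_betw (\<lambda>k. dtail G (c k)) (verts (cycle_graph n)) (verts G)"
      "bij_betw (\<lambda>k. fst (c k)) (arcs (cycle_graph n)) (arcs G)"
      by (auto simp: bij_betw_def cycle_graph_def)
    fix e :: nat
    have "dhead G (c e) = dtail G (d (int (e + 1)))" using d(2)[of "int e"] by (simp add: c_def add.commute)
    also have "d (int (e + 1)) = c ((e + 1) mod n)" using per[of "int (e + 1)"] by (simp only: c_def of_nat_mod)
    finally show "{tail G (fst (c e)), head G (fst (c e))}
        = {dtail G (c (tail (cycle_graph n) e)), dtail G (c (head (cycle_graph n) e))}"
      by (simp add: dart_ends cycle_graph_def)
  qed
  then show ?thesis unfolding is_cycle_graph_def using n by (intro exI[of _ n]) auto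
qed

section \<open>The magnetic Laplacian\<close>

text \<open>With \<open>g\<close> the head or the tail map, this regroups sums over edges by
  vertices; the fibres are finite because degrees are.\<close>

lemma has_sum_fibres:
  fixes F :: "'e \<Rightarrow> 'b :: banach"
  assumes "(F has_sum S) K" "g ` K \<subseteq> V" "\<And>v. v \<in> V \<Longrightarrow> finite {e \<in> K. g e = v}"
  shows "((\<lambda>v. \<Sum>e | e \<in> K \<and> g e = v. F e) has_sum S) V"
proof -
  let ?S = "Sigma V (\<lambda>v. {e \<in> K. g e = v})"
  have "bij_betw snd ?S K" using assms(2) by (auto simp: bij_betw_def inj_on_def image_iff)
  then have "((\<lambda>p. F (snd p)) has_sum S) ?S" using assms(1) has_sum_reindex_bij_betw by blast
  then show ?thesis
    by (rule has_sum_Sigma[OF isUCont_plus]) (use assms(3) in \<open>auto intro!: has_sum_finiteI\<close>)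
qed

lemma summable_on_fibres:
  fixes F :: "'e \<Rightarrow> real"
  assumes "\<And>e. e \<in> K \<Longrightarrow> F e \<ge> 0" "g ` K \<subseteq> V" and fin: "\<And>v. v \<in> V \<Longrightarrow> finite {e \<in> K. g e = v}"
    and s: "(\<lambda>v. \<Sum>e | e \<in> K \<and> g e = v. F e) summable_on V"
  shows "F summable_on K"
proof (rule nonneg_bdd_above_summable_on)
  have "sum F M \<le> (\<Sum>\<^sub>\<infinity>v\<in>V. \<Sum>e | e \<in> K \<and> g e = v. F e)" if M: "finite M" "M \<subseteq> K" for M
  proof -
    have gM: "g ` M \<subseteq> V" "finite (g ` M)" using M assms(2) by auto
    have "sum F M = (\<Sum>v\<in>g ` M. \<Sum>e | e \<in> M \<and> g e = v. F e)" using M by (simp add: sum.image_gen)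
    also have "\<dots> \<le> (\<Sum>v\<in>g ` M. \<Sum>e | e \<in> K \<and> g e = v. F e)"
      using M gM fin assms(1) by (intro sum_mono sum_mono2) auto
    also have "\<dots> \<le> (\<Sum>\<^sub>\<infinity>v\<in>V. \<Sum>e | e \<in> K \<and> g e = v. F e)"
      by (rule finite_sum_le_infsum[OF s gM(2,1)]) (auto intro!: sum_nonneg assms(1))
    finally show ?thesis .
  qed
  then show "bdd_above (sum F ` {M. M \<subseteq> K \<and> finite M})" by (auto intro!: bdd_aboveI)
qed (use assms(1) in auto)

text \<open>The explicit form of the magnetic Laplacian, with the phase \<open>z e\<close> in place
  of \<open>cis (\<alpha> e)\<close>. Phases range over a compact circle, so limits of potentials
  can be taken without choosing angles, and no summability of \<open>f\<close> is
  presupposed.\<close>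

definition mlap :: "('v, 'e) weighted_graph \<Rightarrow> ('e \<Rightarrow> complex) \<Rightarrow> ('v \<Rightarrow> complex) \<Rightarrow> 'v \<Rightarrow> complex" where
  "mlap W z f v = (let G = graph_of W in
     if v \<in> verts G
     then ((\<Sum>e\<in>in_arcs G v. f v - cnj (z e) * f (tail G e)) +
           (\<Sum>e\<in>out_arcs G v. f v - z e * f (head G e))) / complex_of_real (vweight W v)
     else 0)"

text \<open>Common ground of the tree and its quotient, for standard and combinatorial weights
  alike: \<open>degree_le\<close> is the only relation between weights and degrees.\<close>

locale unit_weighted_graph =
  fixes W :: "('v, 'e) weighted_graph" and \<rho> :: real
  assumes wf: "wf_digraph (graph_of W)"
    and eweight_1: "e \<in> arcs (graph_of W) \<Longrightarrow> eweight W e = 1"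
    and vweight_pos: "v \<in> verts (graph_of W) \<Longrightarrow> vweight W v > 0"
    and fin_in: "v \<in> verts (graph_of W) \<Longrightarrow> finite (in_arcs (graph_of W) v)"
    and fin_out: "v \<in> verts (graph_of W) \<Longrightarrow> finite (out_arcs (graph_of W) v)"
    and degree_le: "v \<in> verts (graph_of W) \<Longrightarrow> real (degree (graph_of W) v) \<le> \<rho> * vweight W v"
    and rho_nonneg: "\<rho> \<ge> 0"
begin

abbreviation "V \<equiv> verts (graph_of W)"
abbreviation "E \<equiv> arcs (graph_of W)"
abbreviation "hd' \<equiv> head (graph_of W)"
abbreviation "tl' \<equiv> tail (graph_of W)"
abbreviation "m \<equiv> vweight W"
abbreviation "H \<equiv> ell2V W"
abbreviation "HE \<equiv> ell2 E (eweight W)"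
abbreviation "fin_at v \<equiv> {e \<in> E. hd' e = v}"
abbreviation "fout_at v \<equiv> {e \<in> E. tl' e = v}"

sublocale V: weighted_set V m by unfold_locales (rule vweight_pos)
sublocale E: weighted_set E "eweight W" by unfold_locales (simp add: eweight_1)

lemma ends_in_V: "e \<in> E \<Longrightarrow> hd' e \<in> V" "e \<in> E \<Longrightarrow> tl' e \<in> V"
  using wf by (auto simp: wf_digraph_def)

lemma arcs_at: "in_arcs (graph_of W) v = fin_at v" "out_arcs (graph_of W) v = fout_at v"
  by auto

lemma finite_at: "v \<in> V \<Longrightarrow> finite (fin_at v)" "v \<in> V \<Longrightarrow> finite (fout_at v)"
  using fin_in fin_out unfolding arcs_at by auto

lemma degree_eq: "degree (graph_of W) v = card (fin_at v) + card (fout_at v)"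
  by (simp add: degree_def in_degree_def out_degree_def arcs_at)

lemma card_at_le: "v \<in> V \<Longrightarrow> real (card (fin_at v)) + real (card (fout_at v)) \<le> \<rho> * m v"
  using degree_le[of v] by (simp add: degree_eq)

text \<open>Summed over all edge ends, the value at \<open>v\<close> is counted as often as the
  degree says, which is at most \<open>\<rho> * m v\<close> times. This estimate is the source of
  every bound by \<open>\<rho>\<close>.\<close>

lemma sum_ends:
  assumes "f \<in> H"
  shows "(\<lambda>e. (cmod (f (hd' e)))\<^sup>2) summable_on E" "(\<lambda>e. (cmod (f (tl' e)))\<^sup>2) summable_on E"
    and "(\<Sum>\<^sub>\<infinity>e\<in>E. (cmod (f (hd' e)))\<^sup>2) + (\<Sum>\<^sub>\<infinity>e\<in>E. (cmod (f (tl' e)))\<^sup>2) \<le> \<rho> * (V.N f)\<^sup>2"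
proof -
  have im: "hd' ` E \<subseteq> V" "tl' ` E \<subseteq> V" using ends_in_V by auto
  let ?w = "\<lambda>v. \<rho> * ((cmod (f v))\<^sup>2 * m v)"
  have sw: "?w summable_on V" by (intro summable_on_cmult_right V.ell2_summable assms)
  have fib: "(\<Sum>e | e \<in> E \<and> g e = v. (cmod (f (g e)))\<^sup>2) = real (card {e \<in> E. g e = v}) * (cmod (f v))\<^sup>2"
    for g v by simp
  have le: "real (card (fin_at v)) * (cmod (f v))\<^sup>2 + real (card (fout_at v)) * (cmod (f v))\<^sup>2 \<le> ?w v"
    if "v \<in> V" for v
    using mult_right_mono[OF card_at_le[OF that], of "(cmod (f v))\<^sup>2"] by (simp add: algebra_simps)
  have si: "(\<lambda>v. real (card (fin_at v)) * (cmod (f v))\<^sup>2) summable_on V"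
    and so: "(\<lambda>v. real (card (fout_at v)) * (cmod (f v))\<^sup>2) summable_on V"
    by (rule summable_on_comparison_test[OF sw]; use le in \<open>force intro: order_trans[rotated]\<close>)+
  show s1: "(\<lambda>e. (cmod (f (hd' e)))\<^sup>2) summable_on E"
    by (rule summable_on_fibres[OF _ im(1)]) (use finite_at si fib in auto)
  show s2: "(\<lambda>e. (cmod (f (tl' e)))\<^sup>2) summable_on E"
    by (rule summable_on_fibres[OF _ im(2)]) (use finite_at so fib in auto)
  have "(\<Sum>\<^sub>\<infinity>e\<in>E. (cmod (f (hd' e)))\<^sup>2) = (\<Sum>\<^sub>\<infinity>v\<in>V. real (card (fin_at v)) * (cmod (f v))\<^sup>2)"
    using has_sum_fibres[OF has_sum_infsum[OF s1] im(1) finite_at(1)] unfolding fib by (simp add: infsumI)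
  moreover have "(\<Sum>\<^sub>\<infinity>e\<in>E. (cmod (f (tl' e)))\<^sup>2) = (\<Sum>\<^sub>\<infinity>v\<in>V. real (card (fout_at v)) * (cmod (f v))\<^sup>2)"
    using has_sum_fibres[OF has_sum_infsum[OF s2] im(2) finite_at(2)] unfolding fib by (simp add: infsumI)
  ultimately have "(\<Sum>\<^sub>\<infinity>e\<in>E. (cmod (f (hd' e)))\<^sup>2) + (\<Sum>\<^sub>\<infinity>e\<in>E. (cmod (f (tl' e)))\<^sup>2)
      = (\<Sum>\<^sub>\<infinity>v\<in>V. real (card (fin_at v)) * (cmod (f v))\<^sup>2 + real (card (fout_at v)) * (cmod (f v))\<^sup>2)"
    by (simp add: infsum_add[OF si so])
  also have "\<dots> \<le> (\<Sum>\<^sub>\<infinity>v\<in>V. ?w v)"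
    by (rule infsum_mono[OF summable_on_add[OF si so] sw]) (rule le)
  also have "\<dots> = \<rho> * (V.N f)\<^sup>2" by (simp add: V.N_sq infsum_cmult_right')
  finally show "(\<Sum>\<^sub>\<infinity>e\<in>E. (cmod (f (hd' e)))\<^sup>2) + (\<Sum>\<^sub>\<infinity>e\<in>E. (cmod (f (tl' e)))\<^sup>2) \<le> \<rho> * (V.N f)\<^sup>2" .
qed

lemma HE_I:
  assumes "\<And>e. e \<notin> E \<Longrightarrow> \<eta> e = 0" "(\<lambda>e. (cmod (\<eta> e))\<^sup>2) summable_on E"
  shows "\<eta> \<in> HE"
proof -
  have "(\<lambda>e. (cmod (\<eta> e))\<^sup>2 * eweight W e) summable_on E \<longleftrightarrow> (\<lambda>e. (cmod (\<eta> e))\<^sup>2) summable_on E"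
    by (rule summable_on_cong) (simp add: eweight_1)
  then show ?thesis using assms by (simp add: ell2_def)
qed

lemma HE_D:
  assumes "\<eta> \<in> HE"
  shows "(\<lambda>e. (cmod (\<eta> e))\<^sup>2) summable_on E"
proof -
  have "(\<lambda>e. (cmod (\<eta> e))\<^sup>2 * eweight W e) summable_on E \<longleftrightarrow> (\<lambda>e. (cmod (\<eta> e))\<^sup>2) summable_on E"
    by (rule summable_on_cong) (simp add: eweight_1)
  then show ?thesis using assms by (simp add: ell2_def)
qed

lemma EN_sq: "(E.N \<eta>)\<^sup>2 = (\<Sum>\<^sub>\<infinity>e\<in>E. (cmod (\<eta> e))\<^sup>2)"
  unfolding E.N_sq by (rule infsum_cong) (simp add: eweight_1)

lemma ends_HE:
  assumes "f \<in> H"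
  shows "(\<lambda>e. if e \<in> E then f (hd' e) else 0) \<in> HE" "(\<lambda>e. if e \<in> E then f (tl' e) else 0) \<in> HE"
proof -
  have "(\<lambda>e. (cmod (if e \<in> E then f (hd' e) else 0))\<^sup>2) summable_on E \<longleftrightarrow> (\<lambda>e. (cmod (f (hd' e)))\<^sup>2) summable_on E"
    "(\<lambda>e. (cmod (if e \<in> E then f (tl' e) else 0))\<^sup>2) summable_on E \<longleftrightarrow> (\<lambda>e. (cmod (f (tl' e)))\<^sup>2) summable_on E"
    by (rule summable_on_cong; simp)+
  then show "(\<lambda>e. if e \<in> E then f (hd' e) else 0) \<in> HE" "(\<lambda>e. if e \<in> E then f (tl' e) else 0) \<in> HE"
    using sum_ends(1,2)[OF assms] by (auto intro!: HE_I)
qed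

lemma parallelogram_le: "(cmod (a - b))\<^sup>2 \<le> 2 * (cmod a)\<^sup>2 + 2 * (cmod b)\<^sup>2"
proof -
  have "(cmod (a - b))\<^sup>2 \<le> (cmod a + cmod b)\<^sup>2" by (intro power_mono norm_triangle_ineq4) simp
  also have "\<dots> \<le> 2 * (cmod a)\<^sup>2 + 2 * (cmod b)\<^sup>2"
    using sum_squares_bound[of "cmod a" "cmod b"] by (simp add: power2_sum)
  finally show ?thesis .
qed

text \<open>The factor 2 comes from |a - b|^2 \<le> 2 |a|^2 + 2 |b|^2, applied on each edge; the
  phases have modulus 1 and disappear. This makes \<open>2 * \<rho>\<close> the upper end of the
  spectral interval.\<close>

lemma magnetic_d_bounded:
  assumes f: "f \<in> H"
  shows "magnetic_d W \<alpha> f \<in> HE" and "(E.N (magnetic_d W \<alpha> f))\<^sup>2 \<le> 2 * \<rho> * (V.N f)\<^sup>2"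
proof -
  have le: "(cmod (magnetic_d W \<alpha> f e))\<^sup>2 \<le> 2 * (cmod (f (hd' e)))\<^sup>2 + 2 * (cmod (f (tl' e)))\<^sup>2" if "e \<in> E" for e
    using parallelogram_le[of "cis (\<alpha> e / 2) * f (hd' e)" "cis (- (\<alpha> e / 2)) * f (tl' e)"] that
    by (simp add: magnetic_d_def norm_mult)
  have s: "(\<lambda>e. 2 * (cmod (f (hd' e)))\<^sup>2 + 2 * (cmod (f (tl' e)))\<^sup>2) summable_on E"
    by (intro summable_on_add summable_on_cmult_right sum_ends f)
  have s': "(\<lambda>e. (cmod (magnetic_d W \<alpha> f e))\<^sup>2) summable_on E"
    by (rule summable_on_comparison_test[OF s]) (use le in auto)
  then show "magnetic_d W \<alpha> f \<in> HE" by (intro HE_I) (auto simp: magnetic_d_def)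
  have "(E.N (magnetic_d W \<alpha> f))\<^sup>2 \<le> (\<Sum>\<^sub>\<infinity>e\<in>E. 2 * (cmod (f (hd' e)))\<^sup>2 + 2 * (cmod (f (tl' e)))\<^sup>2)"
    unfolding EN_sq by (rule infsum_mono[OF s' s]) (rule le)
  also have "\<dots> = 2 * ((\<Sum>\<^sub>\<infinity>e\<in>E. (cmod (f (hd' e)))\<^sup>2) + (\<Sum>\<^sub>\<infinity>e\<in>E. (cmod (f (tl' e)))\<^sup>2))"
    by (subst infsum_add) (auto intro!: summable_on_cmult_right sum_ends f simp: infsum_cmult_right')
  also have "\<dots> \<le> 2 * \<rho> * (V.N f)\<^sup>2" using sum_ends(3)[OF f] by simp
  finally show "(E.N (magnetic_d W \<alpha> f))\<^sup>2 \<le> 2 * \<rho> * (V.N f)\<^sup>2" .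
qed

definition dadj :: "('e \<Rightarrow> real) \<Rightarrow> ('e \<Rightarrow> complex) \<Rightarrow> 'v \<Rightarrow> complex" where
  "dadj \<alpha> \<eta> v = (if v \<in> V then ((\<Sum>e\<in>fin_at v. cis (- (\<alpha> e / 2)) * \<eta> e) -
      (\<Sum>e\<in>fout_at v. cis (\<alpha> e / 2) * \<eta> e)) / complex_of_real (m v) else 0)"

lemma cmod_sum_sq_le:
  assumes "finite I" "\<And>e. e \<in> I \<Longrightarrow> cmod (c e) = 1"
  shows "(cmod (\<Sum>e\<in>I. c e * \<eta> e))\<^sup>2 \<le> real (card I) * (\<Sum>e\<in>I. (cmod (\<eta> e))\<^sup>2)"
proof -
  have "cmod (\<Sum>e\<in>I. c e * \<eta> e) \<le> (\<Sum>e\<in>I. cmod (\<eta> e))"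
    using norm_sum[of "\<lambda>e. c e * \<eta> e" I] assms(2) by (simp add: norm_mult)
  then have "(cmod (\<Sum>e\<in>I. c e * \<eta> e))\<^sup>2 \<le> (\<Sum>e\<in>I. cmod (\<eta> e))\<^sup>2" by (rule power_mono) simp
  also have "\<dots> \<le> real (card I) * (\<Sum>e\<in>I. (cmod (\<eta> e))\<^sup>2)"
    using sum_squared_le_sum_of_squares[of "\<lambda>e. cmod (\<eta> e)" I] by (simp add: mult.commute)
  finally show ?thesis .
qed

lemma dadj_in_H:
  assumes \<eta>: "\<eta> \<in> HE"
  shows "dadj \<alpha> \<eta> \<in> H"
proof -
  let ?X = "\<lambda>v. \<Sum>e\<in>fin_at v. (cmod (\<eta> e))\<^sup>2"
  let ?Y = "\<lambda>v. \<Sum>e\<in>fout_at v. (cmod (\<eta> e))\<^sup>2"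
  have im: "hd' ` E \<subseteq> V" "tl' ` E \<subseteq> V" using ends_in_V by auto
  have sX: "?X summable_on V" and sY: "?Y summable_on V"
    using has_sum_fibres[OF has_sum_infsum[OF HE_D[OF \<eta>]] im(1) finite_at(1)]
      has_sum_fibres[OF has_sum_infsum[OF HE_D[OF \<eta>]] im(2) finite_at(2)]
    by (auto intro: has_sum_imp_summable)
  have le: "(cmod (dadj \<alpha> \<eta> v))\<^sup>2 * m v \<le> 2 * \<rho> * (?X v + ?Y v)" if v: "v \<in> V" for v
  proof -
    let ?A = "\<Sum>e\<in>fin_at v. cis (- (\<alpha> e / 2)) * \<eta> e"
    let ?B = "\<Sum>e\<in>fout_at v. cis (\<alpha> e / 2) * \<eta> e"
    have mv: "m v > 0" by (rule vweight_pos[OF v])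
    have nn: "?X v \<ge> 0" "?Y v \<ge> 0" by (auto intro!: sum_nonneg)
    have ca: "real (card (fin_at v)) \<le> \<rho> * m v" "real (card (fout_at v)) \<le> \<rho> * m v"
      using card_at_le[OF v] by linarith+
    have "(cmod ?A)\<^sup>2 \<le> real (card (fin_at v)) * ?X v"
      by (rule cmod_sum_sq_le) (auto simp: finite_at[OF v])
    also have "\<dots> \<le> \<rho> * m v * ?X v" by (rule mult_right_mono[OF ca(1) nn(1)])
    finally have A: "(cmod ?A)\<^sup>2 \<le> \<rho> * m v * ?X v" .
    have "(cmod ?B)\<^sup>2 \<le> real (card (fout_at v)) * ?Y v"
      by (rule cmod_sum_sq_le) (auto simp: finite_at[OF v])
    also have "\<dots> \<le> \<rho> * m v * ?Y v" by (rule mult_right_mono[OF ca(2) nn(2)])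
    finally have B: "(cmod ?B)\<^sup>2 \<le> \<rho> * m v * ?Y v" .
    have "(cmod (dadj \<alpha> \<eta> v))\<^sup>2 * m v = (cmod (?A - ?B))\<^sup>2 / m v"
      using v mv by (simp add: dadj_def norm_divide power_divide power2_eq_square)
    also have "\<dots> \<le> (2 * (\<rho> * m v * ?X v) + 2 * (\<rho> * m v * ?Y v)) / m v"
      using parallelogram_le[of ?A ?B] A B mv by (intro divide_right_mono) auto
    also have "\<dots> = 2 * \<rho> * (?X v + ?Y v)" using mv by (simp add: field_simps)
    finally show ?thesis .
  qed
  have "(\<lambda>v. (cmod (dadj \<alpha> \<eta> v))\<^sup>2 * m v) summable_on V"
  proof (rule summable_on_comparison_test)
    show "(\<lambda>v. 2 * \<rho> * (?X v + ?Y v)) summable_on V"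
      by (intro summable_on_cmult_right summable_on_add sX sY)
  qed (use le vweight_pos in \<open>auto simp: less_imp_le\<close>)
  then show ?thesis by (simp add: ell2_def dadj_def)
qed

text \<open>Summation by parts: the two terms of the difference are regrouped separately, one by
  heads and one by tails. Cauchy-Schwarz on the edge space provides the absolute convergence that
  permits this.\<close>

lemma dadj_adjoint:
  assumes f: "f \<in> H" and \<eta>: "\<eta> \<in> HE"
  shows "E.ip (magnetic_d W \<alpha> f) \<eta> = V.ip f (dadj \<alpha> \<eta>)"
proof -
  let ?F = "\<lambda>e. cis (\<alpha> e / 2) * f (hd' e) * cnj (\<eta> e)"
  let ?K = "\<lambda>e. cis (- (\<alpha> e / 2)) * f (tl' e) * cnj (\<eta> e)"
  have im: "hd' ` E \<subseteq> V" "tl' ` E \<subseteq> V" using ends_in_V by auto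
  have "(\<lambda>e. cmod ((if e \<in> E then f (hd' e) else 0) * cnj (\<eta> e) * complex_of_real (eweight W e))) summable_on E
      \<longleftrightarrow> (\<lambda>e. cmod (?F e)) summable_on E"
    "(\<lambda>e. cmod ((if e \<in> E then f (tl' e) else 0) * cnj (\<eta> e) * complex_of_real (eweight W e))) summable_on E
      \<longleftrightarrow> (\<lambda>e. cmod (?K e)) summable_on E"
    by (rule summable_on_cong; simp add: norm_mult eweight_1)+
  then have sF: "?F summable_on E" and sK: "?K summable_on E"
    using E.ip_abs_summable(1)[OF ends_HE(1)[OF f] \<eta>] E.ip_abs_summable(1)[OF ends_HE(2)[OF f] \<eta>]
    by (auto intro: abs_summable_summable)
  have hF: "((\<lambda>v. \<Sum>e\<in>fin_at v. ?F e) has_sum infsum ?F E) V"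
    by (rule has_sum_fibres[OF has_sum_infsum[OF sF] im(1) finite_at(1)])
  have hK: "((\<lambda>v. \<Sum>e\<in>fout_at v. ?K e) has_sum infsum ?K E) V"
    by (rule has_sum_fibres[OF has_sum_infsum[OF sK] im(2) finite_at(2)])
  have "E.ip (magnetic_d W \<alpha> f) \<eta> = (\<Sum>\<^sub>\<infinity>e\<in>E. ?F e + - ?K e)"
    unfolding ell2_inner_def by (rule infsum_cong) (simp add: magnetic_d_def eweight_1 algebra_simps)
  also have "\<dots> = infsum ?F E + - infsum ?K E"
    using infsum_add[OF sF summable_on_uminus[THEN iffD2, OF sK]] by (simp add: infsum_uminus)
  finally have "E.ip (magnetic_d W \<alpha> f) \<eta> = infsum ?F E + - infsum ?K E" .
  moreover have "((\<lambda>v. (\<Sum>e\<in>fin_at v. ?F e) + - (\<Sum>e\<in>fout_at v. ?K e)) has_sum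
      (infsum ?F E + - infsum ?K E)) V"
    by (rule has_sum_add[OF hF]) (use hK in \<open>simp add: has_sum_uminus\<close>)
  moreover have "(\<Sum>e\<in>fin_at v. ?F e) + - (\<Sum>e\<in>fout_at v. ?K e)
      = f v * cnj (dadj \<alpha> \<eta> v) * complex_of_real (m v)" if v: "v \<in> V" for v
  proof -
    have "cnj (dadj \<alpha> \<eta> v) * complex_of_real (m v) = (\<Sum>e\<in>fin_at v. cis (\<alpha> e / 2) * cnj (\<eta> e)) -
        (\<Sum>e\<in>fout_at v. cis (- (\<alpha> e / 2)) * cnj (\<eta> e))"
      using v vweight_pos[OF v] by (simp add: dadj_def cis_cnj)
    then have "f v * cnj (dadj \<alpha> \<eta> v) * complex_of_real (m v) =
        f v * ((\<Sum>e\<in>fin_at v. cis (\<alpha> e / 2) * cnj (\<eta> e)) -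
        (\<Sum>e\<in>fout_at v. cis (- (\<alpha> e / 2)) * cnj (\<eta> e)))"
      by (simp add: mult.assoc)
    then show ?thesis by (simp add: right_diff_distrib sum_distrib_left mult_ac)
  qed
  ultimately have "((\<lambda>v. f v * cnj (dadj \<alpha> \<eta> v) * complex_of_real (m v)) has_sum E.ip (magnetic_d W \<alpha> f) \<eta>) V"
    by (metis (no_types, lifting) has_sum_cong)
  then show ?thesis unfolding ell2_inner_def by (simp add: infsumI)
qed

text \<open>The \<open>THE\<close> in the definition of the adjoint is legitimate: the difference of
  two candidates is orthogonal to all of \<open>H\<close>, in particular to itself.\<close>

lemma magnetic_d_adj_eq:
  assumes "\<eta> \<in> HE"
  shows "magnetic_d_adj W \<alpha> \<eta> = dadj \<alpha> \<eta>"
  unfolding magnetic_d_adj_def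
proof (rule the_equality)
  show "dadj \<alpha> \<eta> \<in> H \<and> (\<forall>f\<in>H. E.ip (magnetic_d W \<alpha> f) \<eta> = V.ip f (dadj \<alpha> \<eta>))"
    using dadj_in_H[OF assms] dadj_adjoint[OF _ assms] by blast
  fix g assume g: "g \<in> H \<and> (\<forall>f\<in>H. E.ip (magnetic_d W \<alpha> f) \<eta> = V.ip f g)"
  let ?u = "\<lambda>x. g x - dadj \<alpha> \<eta> x"
  have u: "?u \<in> H" using g dadj_in_H[OF assms] by (intro V.ell2_diff) auto
  have "V.ip ?u g = V.ip ?u (dadj \<alpha> \<eta>)" using g u dadj_adjoint[OF u assms, of \<alpha>] by simp
  then have "V.ip ?u ?u = 0" using g u dadj_in_H[OF assms] by (simp add: V.ip_diff_right)
  then have "V.N ?u = 0" using V.ip_self[OF u] by simp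
  then show "g = dadj \<alpha> \<eta>" using V.N_eq_0_iff[OF u] by auto
qed

text \<open>The half phases of \<open>magnetic_d\<close> and its adjoint cancel at \<open>v\<close>
  itself and add up across an edge, so that only \<open>cis (\<alpha> e)\<close> remains.\<close>

lemma magnetic_laplacian_eq:
  assumes "f \<in> H"
  shows "magnetic_laplacian W \<alpha> f = mlap W (\<lambda>e. cis (\<alpha> e)) f"
proof
  fix v
  have cc: "cis (- (a / 2)) * cis (a / 2) = 1" "cis (a / 2) * cis (- (a / 2)) = 1"
    "cis (a / 2) * cis (a / 2) = cis a" "cis (- (a / 2)) * cis (- (a / 2)) = cis (- a)" for a
    by (simp_all add: cis_mult)
  have cc': "cis (- (a / 2)) * (cis (a / 2) * x) = x" "cis (a / 2) * (cis (- (a / 2)) * x) = x"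
    "cis (a / 2) * (cis (a / 2) * x) = cis a * x" "cis (- (a / 2)) * (cis (- (a / 2)) * x) = cis (- a) * x" for a x
    by (simp_all add: mult.assoc[symmetric] cc)
  have "dadj \<alpha> (magnetic_d W \<alpha> f) v = mlap W (\<lambda>e. cis (\<alpha> e)) f v" if v: "v \<in> V"
  proof -
    have "(\<Sum>e\<in>fin_at v. cis (- (\<alpha> e / 2)) * magnetic_d W \<alpha> f e)
        = (\<Sum>e\<in>fin_at v. f v - cnj (cis (\<alpha> e)) * f (tl' e))"
      by (rule sum.cong) (auto simp: magnetic_d_def right_diff_distrib cc' cis_cnj)
    moreover have "- (\<Sum>e\<in>fout_at v. cis (\<alpha> e / 2) * magnetic_d W \<alpha> f e)
        = (\<Sum>e\<in>fout_at v. f v - cis (\<alpha> e) * f (hd' e))"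
      unfolding sum_negf[symmetric]
      by (rule sum.cong) (auto simp: magnetic_d_def right_diff_distrib cc')
    ultimately show ?thesis using v
      by (simp add: dadj_def mlap_def Let_def arcs_at)
  qed
  then show "magnetic_laplacian W \<alpha> f v = mlap W (\<lambda>e. cis (\<alpha> e)) f v"
    unfolding magnetic_laplacian_def magnetic_d_adj_eq[OF magnetic_d_bounded(1)[OF assms]]
    by (cases "v \<in> V") (simp_all add: dadj_def mlap_def)
qed

context
  fixes \<alpha> :: "'e \<Rightarrow> real" and L :: "('v \<Rightarrow> complex) \<Rightarrow> 'v \<Rightarrow> complex"
  defines "L \<equiv> mlap W (\<lambda>e. cis (\<alpha> e))"
begin

lemma L_eq: "f \<in> H \<Longrightarrow> L f = dadj \<alpha> (magnetic_d W \<alpha> f)"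
  using magnetic_laplacian_eq[of f \<alpha>] magnetic_d_adj_eq[OF magnetic_d_bounded(1), of f \<alpha> \<alpha>]
  by (simp add: L_def magnetic_laplacian_def)

lemma L_in_H: "f \<in> H \<Longrightarrow> L f \<in> H"
  by (simp add: L_eq dadj_in_H magnetic_d_bounded)

lemma L_ip: "f \<in> H \<Longrightarrow> g \<in> H \<Longrightarrow> V.ip f (L g) = E.ip (magnetic_d W \<alpha> f) (magnetic_d W \<alpha> g)"
  by (simp add: L_eq dadj_adjoint magnetic_d_bounded)

lemma L_symmetric: "f \<in> H \<Longrightarrow> g \<in> H \<Longrightarrow> V.ip (L f) g = V.ip f (L g)"
  using L_ip[of f g] L_ip[of g f] V.ip_sym E.ip_sym by metis

lemma L_form: "f \<in> H \<Longrightarrow> V.ip (L f) f = complex_of_real ((E.N (magnetic_d W \<alpha> f))\<^sup>2)"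
  using L_symmetric[of f f] L_ip[of f f] by (simp add: E.ip_self magnetic_d_bounded)

text \<open>Moving one factor of |L f|^2 to the edge space gives the inner product of the images of
  \<open>L f\<close> and \<open>f\<close> under \<open>magnetic_d\<close>. Cauchy-Schwarz and the
  bound \<open>sqrt (2 * \<rho>)\<close> for each image then leave one factor |L f| to
  cancel.\<close>

lemma L_bounded:
  assumes "f \<in> H"
  shows "V.N (L f) \<le> 2 * \<rho> * V.N f"
proof -
  have root: "E.N (magnetic_d W \<alpha> g) \<le> sqrt (2 * \<rho>) * V.N g" if "g \<in> H" for g
    using real_sqrt_le_mono[OF magnetic_d_bounded(2)[OF that, of \<alpha>]] by (simp add: real_sqrt_mult)
  have Lf: "L f \<in> H" by (rule L_in_H[OF assms])
  have "(V.N (L f))\<^sup>2 = cmod (V.ip (L f) (L f))" by (simp add: V.ip_self[OF Lf] norm_power)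
  also have "\<dots> = cmod (E.ip (magnetic_d W \<alpha> (L f)) (magnetic_d W \<alpha> f))" by (simp add: L_ip[OF Lf assms])
  also have "\<dots> \<le> E.N (magnetic_d W \<alpha> (L f)) * E.N (magnetic_d W \<alpha> f)"
    by (intro E.Cauchy_Schwarz_ell2 magnetic_d_bounded Lf assms)
  also have "\<dots> \<le> (sqrt (2 * \<rho>) * V.N (L f)) * (sqrt (2 * \<rho>) * V.N f)"
    by (intro mult_mono root Lf assms) (auto simp: rho_nonneg)
  also have "\<dots> = V.N (L f) * (2 * \<rho> * V.N f)" using rho_nonneg by (simp add: algebra_simps)
  finally have "V.N (L f) * V.N (L f) \<le> V.N (L f) * (2 * \<rho> * V.N f)" by (simp add: power2_eq_square)
  then show ?thesis using rho_nonneg by (cases "V.N (L f) = 0") (auto simp: less_le)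
qed

lemma L_lin: "L (\<lambda>x. f x - g x) = (\<lambda>x. L f x - L g x)" "L (\<lambda>x. c * f x) = (\<lambda>x. c * L f x)"
  by (auto simp: fun_eq_iff L_def mlap_def Let_def sum.distrib sum_subtractf diff_divide_distrib
      add_divide_distrib sum_distrib_left algebra_simps)

text \<open>By symmetry of \<open>L\<close> the adjoint of \<open>L - z\<close> is
  \<open>L - cnj z\<close>, so two lower bounds are all that the inversion criterion asks for; the
  lower bound at \<open>z\<close> also bounds the inverse.\<close>

lemma not_in_spectrum:
  assumes c: "c > 0"
    and z: "\<And>f. f \<in> H \<Longrightarrow> c * V.N f \<le> V.N (\<lambda>v. L f v - z * f v)"
    and z': "\<And>f. f \<in> H \<Longrightarrow> c * V.N f \<le> V.N (\<lambda>v. L f v - cnj z * f v)"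
  shows "z \<notin> magnetic_spectrum W \<alpha>"
proof -
  define T where "T z f = (\<lambda>v. L f v - z * f v)" for z f
  \<comment> \<open>An operator bound for \<open>L - cnj z\<close>; the summand \<open>c\<close>
    secures the comparison \<open>c \<le> M\<close>.\<close>
  define M where "M = c + 2 * \<rho> + cmod z"
  have TH: "T z f \<in> H" if "f \<in> H" for z f
    unfolding T_def using that by (intro V.ell2_diff V.ell2_scale L_in_H)
  have Tlin: "T z (\<lambda>x. f x - g x) = (\<lambda>x. T z f x - T z g x)" for z f g
    by (simp add: T_def L_lin algebra_simps)
  have "bij_betw (T z) H H"
  proof (rule V.bij_betw_ell2_of_bounded_below[where T' = "T (cnj z)" and M = M and c = c])
    fix f g assume f: "f \<in> H" and g: "g \<in> H"
    show "V.ip (T z f) g = V.ip f (T (cnj z) g)"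
      unfolding T_def using f g
      by (simp add: V.ip_diff_left V.ip_diff_right L_in_H V.ell2_scale V.ip_scale_left V.ip_scale_right L_symmetric)
  next
    fix f assume f: "f \<in> H"
    have "V.N (T (cnj z) f) \<le> V.N (L f) + V.N (\<lambda>v. cnj z * f v)"
      unfolding T_def using f by (intro V.ell2_diff L_in_H V.ell2_scale)
    also have "\<dots> \<le> 2 * \<rho> * V.N f + cmod z * V.N f"
      using L_bounded[OF f] V.ell2_scale(2)[OF f, of "cnj z"] by simp
    also have "\<dots> \<le> M * V.N f" using c by (simp add: M_def algebra_simps)
    finally show "V.N (T (cnj z) f) \<le> M * V.N f" .
  qed (use TH Tlin c z z' rho_nonneg in \<open>auto simp: M_def T_def\<close>)
  moreover have "V.N f \<le> (1 / c) * V.N (T z f)" if "f \<in> H" for f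
    using z[OF that] c by (simp add: T_def field_simps)
  ultimately have *: "bij_betw (T z) H H" "\<exists>C. \<forall>f\<in>H. V.N f \<le> C * V.N (T z f)" by blast+
  have eq: "(\<lambda>v. magnetic_laplacian W \<alpha> f v - z * f v) = T z f" if "f \<in> H" for f
    using magnetic_laplacian_eq[OF that] by (simp add: T_def L_def)
  have "bij_betw (\<lambda>f v. magnetic_laplacian W \<alpha> f v - z * f v) H H"
    using *(1) eq by (subst bij_betw_cong[of _ _ "T z"]) auto
  then show ?thesis using *(2) eq unfolding magnetic_spectrum_def Let_def by auto
qed

lemma bounded_below_of_not_in_spectrum:
  assumes "z \<notin> magnetic_spectrum W \<alpha>"
  shows "\<exists>C. \<forall>f\<in>H. V.N f \<le> C * V.N (\<lambda>v. L f v - z * f v)"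
  using assms magnetic_laplacian_eq[of _ \<alpha>] unfolding magnetic_spectrum_def Let_def L_def by auto

text \<open>A numerical range argument: Rayleigh quotients of \<open>L\<close> lie in the interval,
  so its distance \<open>c\<close> from \<open>z\<close> bounds \<open>L - z\<close> from below. The
  interval is real, so \<open>cnj z\<close> has the same distance.\<close>

lemma spectrum_subset: "magnetic_spectrum W \<alpha> \<subseteq> complex_of_real ` {0..2 * \<rho>}"
proof
  fix z assume z: "z \<in> magnetic_spectrum W \<alpha>"
  show "z \<in> complex_of_real ` {0..2 * \<rho>}"
  proof (rule ccontr)
    assume nin: "z \<notin> complex_of_real ` {0..2 * \<rho>}"
    have cl: "closed (complex_of_real ` {0..2 * \<rho>})" "complex_of_real ` {0..2 * \<rho>} \<noteq> {}"
      using rho_nonneg by (auto intro!: compact_imp_closed compact_continuous_image continuous_intros)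
    define c where "c = infdist z (complex_of_real ` {0..2 * \<rho>})"
    have c: "c > 0" unfolding c_def using infdist_pos_not_in_closed[OF cl nin] .
    have dist: "c \<le> cmod (complex_of_real q - y)" if q: "0 \<le> q" "q \<le> 2 * \<rho>" and y: "y = z \<or> y = cnj z" for q y
    proof -
      have "c \<le> dist z (complex_of_real q)" unfolding c_def by (rule infdist_le) (use q in auto)
      moreover have "dist z (complex_of_real q) = dist (cnj z) (complex_of_real q)"
        by (metis complex_cnj_complex_of_real complex_cnj_diff complex_mod_cnj dist_norm)
      ultimately show ?thesis using y by (auto simp: dist_norm norm_minus_commute)
    qed
    have below: "c * V.N f \<le> V.N (\<lambda>v. L f v - y * f v)" if f: "f \<in> H" and y: "y = z \<or> y = cnj z" for f y
    proof (cases "V.N f = 0")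
      case False
      then have Nf: "V.N f > 0" by (simp add: less_le)
      define q where "q = (E.N (magnetic_d W \<alpha> f))\<^sup>2 / (V.N f)\<^sup>2"
      have q: "0 \<le> q" "q \<le> 2 * \<rho>" using magnetic_d_bounded(2)[OF f, of \<alpha>] Nf by (auto simp: q_def field_simps)
      have Tf: "(\<lambda>v. L f v - y * f v) \<in> H" using f by (intro V.ell2_diff L_in_H V.ell2_scale)
      have "V.ip (\<lambda>v. L f v - y * f v) f = complex_of_real ((E.N (magnetic_d W \<alpha> f))\<^sup>2) - y * complex_of_real ((V.N f)\<^sup>2)"
        using f by (simp add: V.ip_diff_left L_in_H V.ell2_scale V.ip_scale_left L_form V.ip_self)
      also have "\<dots> = (complex_of_real q - y) * complex_of_real ((V.N f)\<^sup>2)"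
        using Nf by (simp add: q_def left_diff_distrib)
      finally have "cmod (complex_of_real q - y) * (V.N f)\<^sup>2 = cmod (V.ip (\<lambda>v. L f v - y * f v) f)"
        by (simp add: norm_mult norm_power)
      also have "\<dots> \<le> V.N (\<lambda>v. L f v - y * f v) * V.N f" by (rule V.Cauchy_Schwarz_ell2[OF Tf f])
      finally have "c * (V.N f)\<^sup>2 \<le> V.N (\<lambda>v. L f v - y * f v) * V.N f"
        using mult_right_mono[OF dist[OF q y], of "(V.N f)\<^sup>2"] by simp
      then show ?thesis using Nf by (simp add: power2_eq_square)
    qed simp
    show False using not_in_spectrum[OF c below below] z by blast
  qed
qed

end

end

section \<open>Approximate eigenfunctions, gauge transformations and compactness\<close>

lemma bounded_family_convergent_subseq:
  fixes f :: "nat \<Rightarrow> 'a \<Rightarrow> 'b :: heine_borel"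
  assumes "finite A" "\<And>x. x \<in> A \<Longrightarrow> bounded (range (\<lambda>k. f k x))"
  shows "\<exists>r l. strict_mono (r :: nat \<Rightarrow> nat) \<and> (\<forall>x\<in>A. (\<lambda>k. f (r k) x) \<longlonglongrightarrow> l x)"
  using assms
proof (induction A rule: finite_induct)
  case empty
  show ?case by (intro exI[of _ id]) (simp add: strict_mono_def)
next
  case (insert a A)
  then obtain r l where r: "strict_mono (r :: nat \<Rightarrow> nat)" "\<forall>x\<in>A. (\<lambda>k. f (r k) x) \<longlonglongrightarrow> l x" by auto
  have "bounded (range (\<lambda>k. f (r k) a))"
    by (rule bounded_subset[OF insert.prems[of a]]) auto
  then obtain l' s where s: "strict_mono (s :: nat \<Rightarrow> nat)" "((\<lambda>k. f (r k) a) \<circ> s) \<longlonglongrightarrow> l'"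
    using bounded_imp_convergent_subsequence by blast
  have "(\<lambda>k. f ((r \<circ> s) k) x) \<longlonglongrightarrow> (l(a := l')) x" if "x \<in> insert a A" for x
    using that s insert.hyps LIMSEQ_subseq_LIMSEQ[OF bspec[OF r(2)] s(1), of x] by (auto simp: o_def)
  then show ?case using strict_mono_o[OF r(1) s(1)] by blast
qed

abbreviation residual ::
    "('v, 'e) weighted_graph \<Rightarrow> ('e \<Rightarrow> complex) \<Rightarrow> real \<Rightarrow> ('v \<Rightarrow> complex) \<Rightarrow> 'v \<Rightarrow> complex" where
  "residual W z t f \<equiv> (\<lambda>v. mlap W z f v - complex_of_real t * f v)"

lemma residual_scale: "residual W z t (\<lambda>v. c * f v) = (\<lambda>v. c * residual W z t f v)"
  by (auto simp: fun_eq_iff mlap_def Let_def sum_distrib_left algebra_simps add_divide_distrib)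

context unit_weighted_graph
begin

text \<open>A real \<open>t\<close> is its own conjugate, so the two lower bounds of
  \<open>not_in_spectrum\<close> become one. Its failure for every constant, after normalization, is
  the existence of approximate eigenfunctions.\<close>

lemma real_spectrum_iff:
  "complex_of_real t \<in> magnetic_spectrum W \<alpha> \<longleftrightarrow>
     (\<forall>\<epsilon>>0. \<exists>f\<in>H. V.N f = 1 \<and> V.N (residual W (\<lambda>e. cis (\<alpha> e)) t f) < \<epsilon>)"
  (is "_ \<longleftrightarrow> (\<forall>\<epsilon>>0. \<exists>f\<in>H. _ \<and> V.N (?T f) < \<epsilon>)")
proof
  assume a: "complex_of_real t \<in> magnetic_spectrum W \<alpha>"
  show "\<forall>\<epsilon>>0. \<exists>f\<in>H. V.N f = 1 \<and> V.N (?T f) < \<epsilon>"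
  proof (intro allI impI)
    fix \<epsilon> :: real assume e: "\<epsilon> > 0"
    have "\<not> (\<forall>f\<in>H. \<epsilon> * V.N f \<le> V.N (?T f))"
      using not_in_spectrum[OF e, where z = "complex_of_real t" and \<alpha> = \<alpha>] a
      unfolding complex_cnj_complex_of_real by blast
    then obtain f where f: "f \<in> H" "V.N (?T f) < \<epsilon> * V.N f" by (auto simp: not_le)
    then have Nf: "V.N f > 0" using V.N_nonneg[of "?T f"] e
      by (metis V.N_nonneg less_le mult_zero_right not_le)
    define c where "c = complex_of_real (1 / V.N f)"
    have c: "cmod c = 1 / V.N f" using Nf by (simp add: c_def norm_divide)
    have "?T f \<in> H" using f by (intro V.ell2_diff V.ell2_scale L_in_H)
    then have "V.N (?T (\<lambda>v. c * f v)) = V.N (?T f) / V.N f"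
      unfolding residual_scale using V.ell2_scale(2)[of "?T f" c] c by simp
    then have "V.N (?T (\<lambda>v. c * f v)) < \<epsilon>" using f Nf by (simp add: pos_divide_less_eq)
    moreover have "V.N (\<lambda>v. c * f v) = 1" using V.ell2_scale(2)[OF f(1), of c] c Nf by simp
    ultimately show "\<exists>f\<in>H. V.N f = 1 \<and> V.N (?T f) < \<epsilon>" using V.ell2_scale(1)[OF f(1), of c] by blast
  qed
next
  assume a: "\<forall>\<epsilon>>0. \<exists>f\<in>H. V.N f = 1 \<and> V.N (?T f) < \<epsilon>"
  show "complex_of_real t \<in> magnetic_spectrum W \<alpha>"
  proof (rule ccontr)
    assume "complex_of_real t \<notin> magnetic_spectrum W \<alpha>"
    then obtain C where C: "\<And>f. f \<in> H \<Longrightarrow> V.N f \<le> C * V.N (?T f)"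
      using bounded_below_of_not_in_spectrum by blast
    have "1 / (\<bar>C\<bar> + 1) > 0" by (simp add: add_nonneg_pos)
    then obtain f where f: "f \<in> H" "V.N f = 1" "V.N (?T f) < 1 / (\<bar>C\<bar> + 1)" using a by blast
    have "1 \<le> C * V.N (?T f)" using C[OF f(1)] f(2) by simp
    also have "\<dots> \<le> \<bar>C\<bar> * V.N (?T f)" by (intro mult_right_mono) auto
    also have "\<dots> \<le> \<bar>C\<bar> * (1 / (\<bar>C\<bar> + 1))" using f(3) by (intro mult_left_mono) auto
    also have "\<dots> < 1" by (simp add: field_simps)
    finally show False by simp
  qed
qed

text \<open>Limits provide unimodular phases; this reads them as a vector potential again.\<close>

lemma cis_Arg_unit: "(\<And>e. cmod (z e) = 1) \<Longrightarrow> (\<lambda>e. cis (Arg (z e))) = z"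
proof
  fix e assume "\<And>e. cmod (z e) = 1"
  then have "z e \<noteq> 0" "sgn (z e) = z e" by (metis norm_zero zero_neq_one, simp add: sgn_eq)
  then show "cis (Arg (z e)) = z e" by (simp add: cis_Arg)
qed

lemma mlap_symmetric:
  assumes "\<And>e. cmod (z e) = 1" "f \<in> H" "g \<in> H"
  shows "V.ip (mlap W z f) g = V.ip f (mlap W z g)"
  using L_symmetric[OF assms(2,3), where \<alpha> = "\<lambda>e. Arg (z e)"] cis_Arg_unit[of z, OF assms(1)] by simp

text \<open>Gauge covariance: multiplication by \<open>cis (U v)\<close> absorbs the coboundary of
  \<open>U\<close>, so a potential matters only modulo coboundaries.\<close>

lemma mlap_gauge:
  assumes "\<And>e. e \<in> E \<Longrightarrow> \<alpha> e = \<beta> e + (U (hd' e) - U (tl' e))"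
  shows "mlap W (\<lambda>e. cis (\<beta> e)) (\<lambda>v. cis (U v) * f v) v = cis (U v) * mlap W (\<lambda>e. cis (\<alpha> e)) f v"
proof -
  have i: "cis (U v) * f v - cnj (cis (\<beta> e)) * (cis (U (tl' e)) * f (tl' e))
      = cis (U v) * (f v - cnj (cis (\<alpha> e)) * f (tl' e))" if "e \<in> E" "hd' e = v" for e
  proof -
    have "cnj (cis (\<beta> e)) * cis (U (tl' e)) = cis (U v) * cnj (cis (\<alpha> e))"
      using assms[OF that(1)] that(2) by (simp add: cis_cnj cis_mult)
    then show ?thesis by (simp add: right_diff_distrib mult.assoc[symmetric])
  qed
  have o: "cis (U v) * f v - cis (\<beta> e) * (cis (U (hd' e)) * f (hd' e))
      = cis (U v) * (f v - cis (\<alpha> e) * f (hd' e))" if "e \<in> E" "tl' e = v" for e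
  proof -
    have "cis (\<beta> e) * cis (U (hd' e)) = cis (U v) * cis (\<alpha> e)"
      using assms[OF that(1)] that(2) by (simp add: cis_mult algebra_simps)
    then show ?thesis by (simp add: right_diff_distrib mult.assoc[symmetric])
  qed
  have "(\<Sum>e\<in>fin_at v. cis (U v) * f v - cnj (cis (\<beta> e)) * (cis (U (tl' e)) * f (tl' e)))
      = cis (U v) * (\<Sum>e\<in>fin_at v. f v - cnj (cis (\<alpha> e)) * f (tl' e))"
    "(\<Sum>e\<in>fout_at v. cis (U v) * f v - cis (\<beta> e) * (cis (U (hd' e)) * f (hd' e)))
      = cis (U v) * (\<Sum>e\<in>fout_at v. f v - cis (\<alpha> e) * f (hd' e))"
    unfolding sum_distrib_left by (rule sum.cong; use i o in blast)+
  then show ?thesis by (simp add: mlap_def Let_def arcs_at distrib_left)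
qed

lemma gauge_N:
  assumes "f \<in> H"
  shows "(\<lambda>v. cis (U v) * f v) \<in> H" "V.N (\<lambda>v. cis (U v) * f v) = V.N f"
  using assms by (auto simp: ell2_def ell2_norm_def norm_mult)

end

locale finite_weighted_graph = unit_weighted_graph W \<rho> for W :: "('v, 'e) weighted_graph" and \<rho> +
  assumes finite_V: "finite V" and finite_E: "finite E"
begin

lemma ip_finite: "V.ip f g = (\<Sum>v\<in>V. f v * cnj (g v) * complex_of_real (m v))"
  using finite_V by (simp add: ell2_inner_def)

lemma N_finite: "(V.N f)\<^sup>2 = (\<Sum>v\<in>V. (cmod (f v))\<^sup>2 * m v)"
  using finite_V by (simp add: V.N_sq)

lemma H_finite: "(\<And>v. v \<notin> V \<Longrightarrow> f v = 0) \<Longrightarrow> f \<in> H"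
  using V.ell2_finite_support[of V f] finite_V by auto

lemma tendsto_mlap:
  assumes "\<And>e. e \<in> E \<Longrightarrow> (\<lambda>k. z k e) \<longlonglongrightarrow> z' e" "\<And>v. v \<in> V \<Longrightarrow> (\<lambda>k. f k v) \<longlonglongrightarrow> f' v"
  shows "(\<lambda>k. mlap W (z k) (f k) v) \<longlonglongrightarrow> mlap W z' f' v"
proof (cases "v \<in> V")
  case True
  then have "complex_of_real (m v) \<noteq> 0" using vweight_pos[OF True] by simp
  then show ?thesis using True ends_in_V
    by (auto simp: mlap_def Let_def arcs_at intro!: tendsto_intros assms)
qed (simp add: mlap_def)

text \<open>Over a finite graph, normalized functions and unimodular phases form compact sets, and
  \<open>mlap\<close> is continuous in both. Phases and energies may vary with \<open>k\<close>, so
  the same limit serves Floquet fluxes at a fixed energy and exact eigenfunctions at moving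
  energies.\<close>

lemma approximate_eigenvector_limit:
  assumes z: "\<And>k e. cmod (z k e) = 1" and f: "\<And>k. f k \<in> H" "\<And>k. V.N (f k) = 1"
    and t: "t \<longlonglongrightarrow> t'"
    and res: "(\<lambda>k. V.N (residual W (z k) (t k) (f k))) \<longlonglongrightarrow> 0"
  obtains r z' f' where "strict_mono (r :: nat \<Rightarrow> nat)"
    "\<And>e. e \<in> E \<Longrightarrow> (\<lambda>k. z (r k) e) \<longlonglongrightarrow> z' e" "\<And>v. (\<lambda>k. f (r k) v) \<longlonglongrightarrow> f' v"
    "\<And>e. cmod (z' e) = 1" "f' \<in> H" "V.N f' = 1" "\<And>v. mlap W z' f' v = complex_of_real t' * f' v"
proof -
  have "bounded (range (\<lambda>k. f k v))" if v: "v \<in> V" for v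
  proof -
    have "cmod (f k v) \<le> 1 / sqrt (m v)" for k
      using V.point_le_N[OF f(1)[of k] v] f(2)[of k] vweight_pos[OF v] by (simp add: field_simps)
    then show ?thesis by (auto simp: bounded_iff)
  qed
  then obtain r0 f0 where r0: "strict_mono (r0 :: nat \<Rightarrow> nat)" "\<And>v. v \<in> V \<Longrightarrow> (\<lambda>k. f (r0 k) v) \<longlonglongrightarrow> f0 v"
    using bounded_family_convergent_subseq[OF finite_V, of f] by blast
  have "bounded (range (\<lambda>k. z (r0 k) e))" for e
    by (auto simp: bounded_iff z intro!: exI[of _ 1])
  then obtain s z0 where s: "strict_mono (s :: nat \<Rightarrow> nat)" "\<And>e. e \<in> E \<Longrightarrow> (\<lambda>k. z (r0 (s k)) e) \<longlonglongrightarrow> z0 e"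
    using bounded_family_convergent_subseq[OF finite_E, of "\<lambda>k. z (r0 k)"] by blast
  define r where "r = r0 \<circ> s"
  \<comment> \<open>The default 1 off \<open>E\<close> makes the limit phase unimodular everywhere,
    as the symmetry of \<open>mlap\<close> and the passage to \<open>Arg\<close> require.\<close>
  define z' where "z' e = (if e \<in> E then z0 e else 1)" for e
  define f' where "f' v = (if v \<in> V then f0 v else 0)" for v
  have r: "strict_mono r" unfolding r_def by (rule strict_mono_o[OF r0(1) s(1)])
  have zl: "(\<lambda>k. z (r k) e) \<longlonglongrightarrow> z' e" if "e \<in> E" for e using s(2)[OF that] that by (simp add: r_def z'_def)
  have fl: "(\<lambda>k. f (r k) v) \<longlonglongrightarrow> f' v" for v
  proof (cases "v \<in> V")
    case True
    then show ?thesis using LIMSEQ_subseq_LIMSEQ[OF r0(2)[OF True] s(1)] by (simp add: r_def f'_def o_def)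
  next
    case False
    then show ?thesis using V.ell2_vanish[OF f(1) False] by (simp add: f'_def)
  qed
  have z1: "cmod (z' e) = 1" for e
  proof (cases "e \<in> E")
    case True
    have "(\<lambda>k. cmod (z (r k) e)) \<longlonglongrightarrow> cmod (z' e)" by (intro tendsto_norm zl True)
    then show ?thesis using z by (simp add: LIMSEQ_const_iff)
  qed (simp add: z'_def)
  have fH: "f' \<in> H" by (rule H_finite) (simp add: f'_def)
  have "(\<lambda>k. (V.N (f (r k)))\<^sup>2) \<longlonglongrightarrow> (V.N f')\<^sup>2"
    unfolding N_finite by (intro tendsto_intros fl)
  then have "(V.N f')\<^sup>2 = 1" using f(2) by (simp add: LIMSEQ_const_iff)
  then have N1: "V.N f' = 1" using V.N_nonneg[of f'] by (simp add: power2_eq_1_iff)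
  have ev: "mlap W z' f' v = complex_of_real t' * f' v" for v
  proof (cases "v \<in> V")
    case True
    let ?g = "\<lambda>k. residual W (z (r k)) (t (r k)) (f (r k))"
    have tr: "(\<lambda>k. t (r k)) \<longlonglongrightarrow> t'" using LIMSEQ_subseq_LIMSEQ[OF t r] by (simp add: o_def)
    have "(\<lambda>k. ?g k v) \<longlonglongrightarrow> mlap W z' f' v - complex_of_real t' * f' v"
      by (intro tendsto_intros tendsto_mlap zl fl tr)
    moreover have "(\<lambda>k. ?g k v) \<longlonglongrightarrow> 0"
    proof (rule Lim_null_comparison)
      show "(\<lambda>k. V.N (?g k) / sqrt (m v)) \<longlonglongrightarrow> 0"
        using LIMSEQ_subseq_LIMSEQ[OF res r] by (auto simp: o_def intro!: tendsto_divide_zero)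
      have gH: "?g k \<in> H" for k
        by (rule H_finite) (use V.ell2_vanish[OF f(1)] in \<open>simp add: mlap_def\<close>)
      have "norm (?g k v) \<le> V.N (?g k) / sqrt (m v)" for k
        using V.point_le_N[OF gH True] vweight_pos[OF True] by (simp add: pos_le_divide_eq)
      then show "\<forall>\<^sub>F k in sequentially. norm (?g k v) \<le> V.N (?g k) / sqrt (m v)"
        by (rule always_eventually[OF allI])
    qed
    ultimately show ?thesis using LIMSEQ_unique by fastforce
  next
    case False
    then show ?thesis by (simp add: mlap_def f'_def)
  qed
  show ?thesis by (rule that[OF r zl fl z1 fH N1 ev])
qed

text \<open>On a finite graph approximate eigenfunctions subconverge to genuine ones, so the spectra
  consist of eigenvalues; conversely \<open>Arg\<close> recovers a potential from the
  phases.\<close>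

lemma in_magnetic_spectra_iff:
  "complex_of_real t \<in> (\<Union>\<alpha>. magnetic_spectrum W \<alpha>) \<longleftrightarrow>
     (\<exists>z f. (\<forall>e. cmod (z e) = 1) \<and> f \<in> H \<and> V.N f = 1 \<and> (\<forall>v. mlap W z f v = complex_of_real t * f v))"
proof
  assume "complex_of_real t \<in> (\<Union>\<alpha>. magnetic_spectrum W \<alpha>)"
  then obtain \<alpha> where "complex_of_real t \<in> magnetic_spectrum W \<alpha>" by blast
  then have ex: "\<exists>f\<in>H. V.N f = 1 \<and> V.N (residual W (\<lambda>e. cis (\<alpha> e)) t f) < 1 / real (Suc k)" for k
    unfolding real_spectrum_iff by simp
  obtain f where f: "\<And>k. f k \<in> H" "\<And>k. V.N (f k) = 1"
    "\<And>k. V.N (residual W (\<lambda>e. cis (\<alpha> e)) t (f k)) < 1 / real (Suc k)"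
    using ex by metis
  have res: "(\<lambda>k. V.N (residual W (\<lambda>e. cis (\<alpha> e)) t (f k))) \<longlonglongrightarrow> 0"
    by (rule tendsto_sandwich[OF _ _ tendsto_const lim_inverse_n'[THEN LIMSEQ_Suc]])
       (use f(3) in \<open>auto intro!: always_eventually less_imp_le\<close>)
  show "\<exists>z f. (\<forall>e. cmod (z e) = 1) \<and> f \<in> H \<and> V.N f = 1 \<and> (\<forall>v. mlap W z f v = complex_of_real t * f v)"
    by (rule approximate_eigenvector_limit[OF _ f(1,2) tendsto_const res]) (simp, blast)
next
  assume "\<exists>z f. (\<forall>e. cmod (z e) = 1) \<and> f \<in> H \<and> V.N f = 1 \<and> (\<forall>v. mlap W z f v = complex_of_real t * f v)"
  then obtain z f where zf: "\<And>e. cmod (z e) = 1" "f \<in> H" "V.N f = 1" "\<And>v. mlap W z f v = complex_of_real t * f v"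
    by blast
  have "V.N (\<lambda>v. 0) = 0" by (simp add: ell2_norm_def)
  then have "complex_of_real t \<in> magnetic_spectrum W (\<lambda>e. Arg (z e))"
    unfolding real_spectrum_iff cis_Arg_unit[of z, OF zf(1)] using zf by auto
  then show "complex_of_real t \<in> (\<Union>\<alpha>. magnetic_spectrum W \<alpha>)" by blast
qed

end

text \<open>A first-variation argument: if the linear coefficient were nonzero, a small
  \<open>t\<close> of the opposite sign would give a negative value. The choice of \<open>s\<close>
  ensures s a < 2, so that the quadratic term cannot compensate.\<close>

lemma linear_coeff_zero:
  fixes a b :: real
  assumes "\<And>t. 2 * t * b + t\<^sup>2 * a \<ge> 0"
  shows "b = 0"
proof (rule ccontr)
  assume b: "b \<noteq> 0"
  define s where "s = 1 / (1 + \<bar>a\<bar>)"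
  have s: "s > 0" "s * \<bar>a\<bar> < 1" by (auto simp: s_def field_simps)
  have "2 * (- (s * b)) * b + (- (s * b))\<^sup>2 * a = s * b\<^sup>2 * (s * a - 2)"
    by (simp add: power2_eq_square algebra_simps)
  moreover have "s * a \<le> s * \<bar>a\<bar>" using s by (intro mult_left_mono) auto
  then have "s * a - 2 < 0" using s by linarith
  then have "s * b\<^sup>2 * (s * a - 2) < 0" using s b by (simp add: mult_pos_neg)
  ultimately show False using assms[of "- (s * b)"] by linarith
qed

section \<open>Dirichlet ground states and magnetic gaps\<close>

context finite_weighted_graph
begin

text \<open>The quadratic form of the Laplacian without potential, on real functions. Real functions
  suffice because the branch to which it is applied does not touch the edge that carries the
  flux.\<close>

definition energy :: "('v \<Rightarrow> real) \<Rightarrow> real" where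
  "energy f = (\<Sum>e\<in>E. (f (hd' e) - f (tl' e))\<^sup>2)"

definition mass :: "('v \<Rightarrow> real) \<Rightarrow> real" where
  "mass f = (\<Sum>v\<in>V. (f v)\<^sup>2 * m v)"

lemma energy_scale: "energy (\<lambda>v. c * f v) = c\<^sup>2 * energy f"
  by (simp add: energy_def sum_distrib_left power_mult_distrib flip: right_diff_distrib)

lemma mass_scale: "mass (\<lambda>v. c * f v) = c\<^sup>2 * mass f"
  by (simp add: mass_def sum_distrib_left power_mult_distrib mult.assoc)

lemma mass_nonneg: "mass f \<ge> 0"
  unfolding mass_def using vweight_pos by (intro sum_nonneg) (simp add: less_imp_le)

lemma energy_abs_le: "energy (\<lambda>v. \<bar>f v\<bar>) \<le> energy f"
  unfolding energy_def
  by (intro sum_mono) (metis abs_triangle_ineq3 abs_ge_zero abs_le_square_iff abs_abs)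

lemma energy_le:
  assumes "\<And>v. v \<notin> V \<Longrightarrow> f v = 0"
  shows "energy f \<le> 2 * \<rho> * mass f"
proof -
  let ?F = "\<lambda>v. complex_of_real (f v)"
  have "(E.N (magnetic_d W (\<lambda>_. 0) ?F))\<^sup>2 = energy f"
    unfolding EN_sq energy_def using finite_E
    by (auto simp: magnetic_d_def simp flip: of_real_diff intro!: sum.cong)
  moreover have "(V.N ?F)\<^sup>2 = mass f" by (simp add: N_finite mass_def)
  moreover have "?F \<in> H" by (rule H_finite) (use assms in simp)
  ultimately show ?thesis using magnetic_d_bounded(2)[of ?F "\<lambda>_. 0"] by simp
qed

text \<open>Nonnegative normalized functions on \<open>B\<close> form a compact set. The restriction
  to nonnegative functions costs nothing, since taking absolute values keeps the mass and does not
  increase the energy.\<close>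

lemma energy_minimizer:
  assumes B: "B \<subseteq> V" "b \<in> B"
  obtains \<phi> where "\<And>v. \<phi> v \<ge> 0" "\<And>v. v \<notin> B \<Longrightarrow> \<phi> v = 0" "mass \<phi> = 1"
    "\<forall>g. (\<forall>v. v \<notin> B \<longrightarrow> g v = 0) \<longrightarrow> energy \<phi> * mass g \<le> energy g"
proof -
  define S where "S = {f. (\<forall>v. v \<notin> B \<longrightarrow> f v = 0) \<and> (\<forall>v. f v \<ge> 0) \<and> mass f = 1}"
  have norm_in_S: "(\<lambda>v. (1 / sqrt (mass g)) * \<bar>g v\<bar>) \<in> S" and
    energy_norm: "energy (\<lambda>v. (1 / sqrt (mass g)) * \<bar>g v\<bar>) \<le> energy g / mass g"
    if "\<And>v. v \<notin> B \<Longrightarrow> g v = 0" "mass g \<noteq> 0" for g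
  proof -
    have mg: "mass g > 0" using that(2) mass_nonneg[of g] by simp
    have "mass (\<lambda>v. \<bar>g v\<bar>) = mass g" by (simp add: mass_def)
    then show "(\<lambda>v. (1 / sqrt (mass g)) * \<bar>g v\<bar>) \<in> S"
      unfolding S_def using that mg mass_scale[of "1 / sqrt (mass g)" "\<lambda>v. \<bar>g v\<bar>"] by (simp add: power_divide)
    show "energy (\<lambda>v. (1 / sqrt (mass g)) * \<bar>g v\<bar>) \<le> energy g / mass g"
      using mg energy_abs_le[of g] unfolding energy_scale by (simp add: power_divide divide_right_mono)
  qed
  have "mass (\<lambda>v. of_bool (v = b)) = (\<Sum>v\<in>V. if v = b then m v else 0)"
    unfolding mass_def by (rule sum.cong) auto
  also have "\<dots> = m b" using B finite_V by auto
  finally have mb: "mass (\<lambda>v. of_bool (v = b)) \<noteq> 0" using B vweight_pos[of b] by auto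
  have S0: "S \<noteq> {}" using norm_in_S[of "\<lambda>v. of_bool (v = b)", OF _ mb] B by auto
  have en: "energy f \<ge> 0" for f by (simp add: energy_def sum_nonneg)
  have bdd: "bdd_below (energy ` S)" using en by (auto intro!: bdd_belowI[of _ 0])
  define q where "q = Inf (energy ` S)"
  have q_le: "q \<le> energy f" if "f \<in> S" for f unfolding q_def using bdd that by (intro cInf_lower) auto
  have "\<exists>f\<in>S. energy f < q + 1 / real (Suc k)" for k
    using cInf_lessD[of "energy ` S" "q + 1 / real (Suc k)"] S0 by (auto simp: q_def)
  then obtain f where f: "\<And>k. f k \<in> S" "\<And>k. energy (f k) < q + 1 / real (Suc k)" by metis
  have "bounded (range (\<lambda>k. f k v))" if v: "v \<in> V" for v
  proof -
    have "\<bar>f k v\<bar> \<le> 1 / sqrt (m v)" for k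
    proof -
      have "(f k v)\<^sup>2 * m v \<le> mass (f k)" unfolding mass_def
        by (rule member_le_sum[OF v]) (use finite_V vweight_pos in \<open>auto simp: less_imp_le\<close>)
      then have "(f k v)\<^sup>2 \<le> 1 / m v" using f(1)[of k] vweight_pos[OF v] by (simp add: S_def field_simps)
      then have "sqrt ((f k v)\<^sup>2) \<le> sqrt (1 / m v)" by (rule real_sqrt_le_mono)
      then show ?thesis by (simp add: real_sqrt_divide)
    qed
    then show ?thesis by (auto simp: bounded_iff)
  qed
  then obtain r l where r: "strict_mono (r :: nat \<Rightarrow> nat)" "\<And>v. v \<in> V \<Longrightarrow> (\<lambda>k. f (r k) v) \<longlonglongrightarrow> l v"
    using bounded_family_convergent_subseq[OF finite_V, of f] by blast
  define \<phi> where "\<phi> v = (if v \<in> V then l v else 0)" for v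
  have lim: "(\<lambda>k. f (r k) v) \<longlonglongrightarrow> \<phi> v" for v
  proof (cases "v \<in> V")
    case True then show ?thesis using r(2) by (simp add: \<phi>_def)
  next
    case False
    then have "f k v = 0" for k using f(1)[of k] B by (auto simp: S_def)
    then show ?thesis using False by (simp add: \<phi>_def)
  qed
  have nn: "\<phi> v \<ge> 0" for v
    by (rule LIMSEQ_le_const[OF lim]) (use f(1) in \<open>auto simp: S_def\<close>)
  have z: "\<phi> v = 0" if "v \<notin> B" for v
    using lim[of v] f(1) that by (simp add: S_def LIMSEQ_const_iff)
  have "(\<lambda>k. mass (f (r k))) \<longlonglongrightarrow> mass \<phi>" unfolding mass_def by (intro tendsto_intros lim)
  then have m1: "mass \<phi> = 1" using f(1) by (simp add: S_def LIMSEQ_const_iff)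
  have e1: "(\<lambda>k. energy (f (r k))) \<longlonglongrightarrow> energy \<phi>" unfolding energy_def by (intro tendsto_intros lim)
  have "(\<lambda>k. q + 1 / real (Suc k)) \<longlonglongrightarrow> q + 0" by (intro tendsto_intros lim_inverse_n'[THEN LIMSEQ_Suc])
  then have "(\<lambda>k. q + 1 / real (Suc (r k))) \<longlonglongrightarrow> q" using LIMSEQ_subseq_LIMSEQ[OF _ r(1)] by (force simp: o_def)
  then have "energy \<phi> \<le> q"
    by (rule LIMSEQ_le[OF e1]) (use f(2) in \<open>auto intro!: exI[of _ 0] less_imp_le\<close>)
  then have least: "energy \<phi> \<le> energy g" if "g \<in> S" for g using q_le[OF that] by linarith
  show ?thesis
  proof (rule that)
    have "energy \<phi> * mass g \<le> energy g" if g: "\<And>v. v \<notin> B \<Longrightarrow> g v = 0" for g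
    proof (cases "mass g = 0")
      case False
      have "energy \<phi> \<le> energy g / mass g"
        using least[OF norm_in_S[of g, OF g False]] energy_norm[of g, OF g False] by linarith
      then show ?thesis using False mass_nonneg[of g] by (simp add: pos_le_divide_eq)
    qed (use en in simp)
    then show "\<forall>g. (\<forall>v. v \<notin> B \<longrightarrow> g v = 0) \<longrightarrow> energy \<phi> * mass g \<le> energy g" by blast
  qed (fact nn z m1)+
qed

text \<open>The last clause is the Euler-Lagrange equation of the minimization problem.\<close>

lemma Dirichlet_ground_state:
  assumes B: "B \<subseteq> V" "b \<in> B"
  obtains \<phi> q where "\<And>v. \<phi> v \<ge> 0" "\<And>v. v \<notin> B \<Longrightarrow> \<phi> v = 0" "\<exists>v. \<phi> v \<noteq> 0" "0 \<le> q" "q \<le> 2 * \<rho>"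
    "\<And>v. v \<in> B \<Longrightarrow> (\<Sum>e\<in>fin_at v. \<phi> v - \<phi> (tl' e)) +
      (\<Sum>e\<in>fout_at v. \<phi> v - \<phi> (hd' e)) = q * m v * \<phi> v"
proof -
  obtain \<phi> where \<phi>: "\<And>v. \<phi> v \<ge> 0" "\<And>v. v \<notin> B \<Longrightarrow> \<phi> v = 0" "mass \<phi> = 1"
    "\<forall>g. (\<forall>v. v \<notin> B \<longrightarrow> g v = 0) \<longrightarrow> energy \<phi> * mass g \<le> energy g"
    by (rule energy_minimizer[OF B]) (rule that; assumption)
  define q where "q = energy \<phi>"
  have EL: "(\<Sum>e\<in>fin_at v. \<phi> v - \<phi> (tl' e)) +
      (\<Sum>e\<in>fout_at v. \<phi> v - \<phi> (hd' e)) = q * m v * \<phi> v" if v: "v \<in> B" for v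
  proof -
    \<comment> \<open>Variation of \<open>\<phi>\<close> at the single vertex \<open>v\<close>. As a
      function of \<open>t\<close>, energy minus \<open>q\<close> times mass is a nonnegative
      quadratic polynomial whose constant term vanishes, so its linear coefficient \<open>b\<close>
      vanishes too.\<close>
    define \<delta> where "\<delta> u = (of_bool (u = v) :: real)" for u
    define b where "b = (\<Sum>e\<in>E. (\<phi> (hd' e) - \<phi> (tl' e)) * (\<delta> (hd' e) - \<delta> (tl' e))) - q * (m v * \<phi> v)"
    have vV: "v \<in> V" using v B by blast
    have "2 * t * b + t\<^sup>2 * (energy \<delta> - q * mass \<delta>) \<ge> 0" for t
    proof -
      have "energy (\<lambda>u. \<phi> u + t * \<delta> u) =
          (\<Sum>e\<in>E. (\<phi> (hd' e) - \<phi> (tl' e))\<^sup>2 + 2 * t * ((\<phi> (hd' e) - \<phi> (tl' e)) * (\<delta> (hd' e) - \<delta> (tl' e)))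
            + t\<^sup>2 * (\<delta> (hd' e) - \<delta> (tl' e))\<^sup>2)"
        unfolding energy_def by (rule sum.cong) (auto simp: power2_eq_square algebra_simps)
      also have "\<dots> = q + 2 * t * (\<Sum>e\<in>E. (\<phi> (hd' e) - \<phi> (tl' e)) * (\<delta> (hd' e) - \<delta> (tl' e))) + t\<^sup>2 * energy \<delta>"
        by (simp add: sum.distrib sum_distrib_left energy_def q_def)
      finally have e: "energy (\<lambda>u. \<phi> u + t * \<delta> u) =
          q + 2 * t * (\<Sum>e\<in>E. (\<phi> (hd' e) - \<phi> (tl' e)) * (\<delta> (hd' e) - \<delta> (tl' e))) + t\<^sup>2 * energy \<delta>" .
      have "mass (\<lambda>u. \<phi> u + t * \<delta> u) = (\<Sum>u\<in>V. (\<phi> u)\<^sup>2 * m u + 2 * t * (\<phi> u * \<delta> u * m u) + t\<^sup>2 * ((\<delta> u)\<^sup>2 * m u))"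
        unfolding mass_def by (rule sum.cong) (auto simp: power2_eq_square algebra_simps)
      also have "\<dots> = mass \<phi> + 2 * t * (\<Sum>u\<in>V. \<phi> u * \<delta> u * m u) + t\<^sup>2 * mass \<delta>"
        by (simp add: sum.distrib sum_distrib_left mass_def)
      also have "(\<Sum>u\<in>V. \<phi> u * \<delta> u * m u) = (\<Sum>u\<in>V. if u = v then m v * \<phi> v else 0)"
        by (rule sum.cong) (auto simp: \<delta>_def)
      also have "\<dots> = m v * \<phi> v" using vV finite_V by simp
      finally have ma: "mass (\<lambda>u. \<phi> u + t * \<delta> u) = 1 + 2 * t * (m v * \<phi> v) + t\<^sup>2 * mass \<delta>" by (simp add: \<phi>(3))
      have "q * mass (\<lambda>u. \<phi> u + t * \<delta> u) \<le> energy (\<lambda>u. \<phi> u + t * \<delta> u)"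
        unfolding q_def by (rule \<phi>(4)[rule_format]) (use v \<phi>(2) in \<open>auto simp: \<delta>_def\<close>)
      then show ?thesis unfolding e ma b_def by (simp add: algebra_simps)
    qed
    then have b0: "b = 0" by (rule linear_coeff_zero)
    have "(\<Sum>e\<in>E. (\<phi> (hd' e) - \<phi> (tl' e)) * (\<delta> (hd' e) - \<delta> (tl' e)))
        = (\<Sum>e\<in>E. (if hd' e = v then \<phi> v - \<phi> (tl' e) else 0) + (if tl' e = v then \<phi> v - \<phi> (hd' e) else 0))"
      by (rule sum.cong) (auto simp: \<delta>_def)
    also have "\<dots> = (\<Sum>e\<in>fin_at v. \<phi> v - \<phi> (tl' e)) + (\<Sum>e\<in>fout_at v. \<phi> v - \<phi> (hd' e))"
      using finite_E by (simp add: sum.distrib sum.inter_filter)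
    finally show ?thesis using b0 by (simp add: b_def algebra_simps)
  qed
  show ?thesis
  proof (rule that[OF \<phi>(1,2) _ _ _ EL])
    show "\<exists>v. \<phi> v \<noteq> 0"
    proof (rule ccontr)
      assume "\<not> ?thesis"
      then show False using \<phi>(3) by (simp add: mass_def)
    qed
    show "0 \<le> q" by (simp add: q_def energy_def sum_nonneg)
    show "q \<le> 2 * \<rho>" using energy_le[of \<phi>] \<phi>(2,3) B by (auto simp: q_def)
  qed
qed

text \<open>
  Suppose that every \<open>t\<close> is an eigenvalue for some potential. Take eigenvalues \<open>t\<^sub>k \<rightarrow> q\<close>, \<open>t\<^sub>k \<noteq> q\<close>,
  where \<open>q\<close> is the Dirichlet ground state energy of the branch \<open>B\<close>, with normalized eigenfunctions
  \<open>f\<^sub>k \<rightarrow> f\<close>. Testing with the ground state \<open>\<phi>\<close> gives \<open>f\<^sub>k(c) = O(q - t\<^sub>k)\<close>. Hence \<open>f(c) = 0\<close>, so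
  that the potential, gauged to live on the edge \<open>e\<^sub>0\<close> at \<open>c\<close>, affects \<open>f\<close> only at \<open>c\<close>. Testing with \<open>f\<close>
  then gives \<open>\<langle>f\<^sub>k, f\<rangle> \<rightarrow> 0\<close>, whereas \<open>\<langle>f\<^sub>k, f\<rangle> \<rightarrow> 1\<close>.
\<close>

theorem magnetic_gap:
  assumes lk: "linked (graph_of W) E" and \<rho>: "\<rho> > 0"
    and e: "e0 \<in> E" "e1 \<in> E" "e0 \<noteq> e1" "incident (graph_of W) e0 c" "{tl' e1, hd' e1} = {c, b}"
    and B: "B \<subseteq> V" "c \<in> V" "c \<notin> B" "b \<in> B"
    and cl: "\<And>e. e \<in> E \<Longrightarrow> e \<noteq> e1 \<Longrightarrow> tl' e \<in> B \<longleftrightarrow> hd' e \<in> B"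
    and gauge: "\<forall>\<sigma> :: 'e \<Rightarrow> real. \<exists>U. \<forall>e\<in>E - {e0}. \<sigma> e = U (hd' e) - U (tl' e)"
  shows "\<exists>t\<in>{0..2 * \<rho>}. complex_of_real t \<notin> (\<Union>\<alpha>. magnetic_spectrum W \<alpha>)"
proof (rule ccontr)
  assume no_gap: "\<not> ?thesis"
  \<comment> \<open>By \<open>gauge\<close> every potential can be transformed so that all phases
    are 1 except the one at \<open>e0\<close>, which carries the flux of the cycle.\<close>
  define tw where "tw \<zeta> e = (if e = e0 then \<zeta> else (1 :: complex))" for \<zeta> e
  have tw1: "cmod (tw \<zeta> e) = 1" if "cmod \<zeta> = 1" for \<zeta> e using that by (simp add: tw_def)
  have bc: "b \<noteq> c" using B by blast
  obtain \<phi> q where nn: "\<And>v. \<phi> v \<ge> 0" and z: "\<And>v. v \<notin> B \<Longrightarrow> \<phi> v = 0" and ne: "\<exists>v. \<phi> v \<noteq> 0"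
    and q: "0 \<le> q" "q \<le> 2 * \<rho>"
    and EL: "\<And>v. v \<in> B \<Longrightarrow> (\<Sum>e\<in>fin_at v. \<phi> v - \<phi> (tl' e)) +
      (\<Sum>e\<in>fout_at v. \<phi> v - \<phi> (hd' e)) = q * m v * \<phi> v"
    by (rule Dirichlet_ground_state[OF B(1,4)]) (rule that; assumption)
  \<comment> \<open>At a zero of the nonnegative \<open>\<phi>\<close> inside \<open>B\<close> the
    equation forces all neighbours to be zeros. If \<open>b\<close> were one as well, no edge could
    leave the support of \<open>\<phi>\<close>, not even \<open>e1\<close>, and connectedness would
    make the support all of \<open>V\<close>.\<close>
  have \<phi>b: "\<phi> b \<noteq> 0"
  proof
    assume b0: "\<phi> b = 0"
    define Z where "Z = {v. \<phi> v \<noteq> 0}"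
    have ZB: "Z \<subseteq> B" using z by (auto simp: Z_def)
    have nbr: "(\<forall>e\<in>fin_at w. \<phi> (tl' e) = 0) \<and> (\<forall>e\<in>fout_at w. \<phi> (hd' e) = 0)" if "w \<in> B" "\<phi> w = 0" for w
    proof -
      have "(\<Sum>e\<in>fin_at w. \<phi> (tl' e)) + (\<Sum>e\<in>fout_at w. \<phi> (hd' e)) = 0"
        using EL[OF that(1)] that(2) by (simp add: sum_negf)
      moreover have "(\<Sum>e\<in>fin_at w. \<phi> (tl' e)) \<ge> 0" "(\<Sum>e\<in>fout_at w. \<phi> (hd' e)) \<ge> 0"
        by (auto intro!: sum_nonneg nn)
      ultimately have "(\<Sum>e\<in>fin_at w. \<phi> (tl' e)) = 0" "(\<Sum>e\<in>fout_at w. \<phi> (hd' e)) = 0" by linarith+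
      then show ?thesis using finite_E nn by (simp add: sum_nonneg_eq_0_iff)
    qed
    have "Z = V"
    proof (rule linkedD[OF lk])
      show "Z \<subseteq> V" using ZB B by blast
      show "Z \<noteq> {}" using ne by (auto simp: Z_def)
      fix e' assume e': "e' \<in> E"
      show "(tl' e' \<in> Z) = (hd' e' \<in> Z)"
      proof (cases "e' = e1")
        case True
        then show ?thesis using e(5) b0 z[OF B(3)] by (auto simp: Z_def doubleton_eq_iff)
      next
        case False
        then show ?thesis using cl[OF e' False] e' nbr[of "tl' e'"] nbr[of "hd' e'"] z[of "tl' e'"] z[of "hd' e'"]
          by (auto simp: Z_def)
      qed
    qed
    then show False using ZB B by blast
  qed
  define \<Phi> where "\<Phi> v = complex_of_real (\<phi> v)" for v
  have \<Phi>H: "\<Phi> \<in> H" by (rule H_finite) (use z B in \<open>auto simp: \<Phi>_def\<close>)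
  \<comment> \<open>Extended by zero, \<open>\<phi>\<close> solves the eigenvalue equation
    everywhere except at \<open>c\<close>, where the edge \<open>e1\<close> contributes the source
    \<open>\<phi> b\<close>.\<close>
  have K: "(\<Sum>e\<in>fin_at v. \<phi> v - \<phi> (tl' e)) + (\<Sum>e\<in>fout_at v. \<phi> v - \<phi> (hd' e))
      = q * m v * \<phi> v - (if v = c then \<phi> b else 0)" for v
  proof (cases "v \<in> B")
    case True
    then show ?thesis using EL B by auto
  next
    case False
    have i: "\<phi> (tl' e') = (if e' = e1 then \<phi> b else 0)" if "e' \<in> E" "hd' e' = v" for e'
      using cl[OF that(1)] that(2) False z e(5) B bc by (auto simp: doubleton_eq_iff)
    have o: "\<phi> (hd' e') = (if e' = e1 then \<phi> b else 0)" if "e' \<in> E" "tl' e' = v" for e'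
      using cl[OF that(1)] that(2) False z e(5) B bc by (auto simp: doubleton_eq_iff)
    have "(\<Sum>e\<in>fin_at v. \<phi> v - \<phi> (tl' e)) = (\<Sum>e'\<in>fin_at v. if e' = e1 then - \<phi> b else 0)"
      by (rule sum.cong) (use i z[OF False] in auto)
    also have "\<dots> = (if hd' e1 = v then - \<phi> b else 0)" using finite_E e by simp
    finally have si: "(\<Sum>e\<in>fin_at v. \<phi> v - \<phi> (tl' e)) = (if hd' e1 = v then - \<phi> b else 0)" .
    have "(\<Sum>e\<in>fout_at v. \<phi> v - \<phi> (hd' e)) = (\<Sum>e'\<in>fout_at v. if e' = e1 then - \<phi> b else 0)"
      by (rule sum.cong) (use o z[OF False] in auto)
    also have "\<dots> = (if tl' e1 = v then - \<phi> b else 0)" using finite_E e by simp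
    finally have so: "(\<Sum>e\<in>fout_at v. \<phi> v - \<phi> (hd' e)) = (if tl' e1 = v then - \<phi> b else 0)" .
    show ?thesis unfolding si so using z[OF False] e(5) False B bc by (auto simp: doubleton_eq_iff)
  qed
  have H\<Phi>: "mlap W (tw \<zeta>) \<Phi> v * complex_of_real (m v)
      = complex_of_real q * \<Phi> v * complex_of_real (m v) - (if v = c then \<Phi> b else 0)" if v: "v \<in> V" for \<zeta> v
  proof -
    \<comment> \<open>The twisted edge does not touch the branch, so \<open>\<phi>\<close> vanishes
      at both of its ends and the twist drops out.\<close>
    have e0B: "\<phi> (tl' e0) = 0" "\<phi> (hd' e0) = 0"
      using cl[OF e(1,3)] e(4) B z by (auto simp: incident_def)
    have "mlap W (tw \<zeta>) \<Phi> v * complex_of_real (m v) =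
        (\<Sum>e\<in>fin_at v. \<Phi> v - cnj (tw \<zeta> e) * \<Phi> (tl' e)) +
        (\<Sum>e\<in>fout_at v. \<Phi> v - tw \<zeta> e * \<Phi> (hd' e))"
      using v vweight_pos[OF v] by (simp add: mlap_def Let_def arcs_at)
    also have "\<dots> = (\<Sum>e\<in>fin_at v. complex_of_real (\<phi> v - \<phi> (tl' e))) +
        (\<Sum>e\<in>fout_at v. complex_of_real (\<phi> v - \<phi> (hd' e)))"
      by (intro arg_cong2[of _ _ _ _ "(+)"] sum.cong) (auto simp: \<Phi>_def tw_def e0B)
    also have "\<dots> = complex_of_real (q * m v * \<phi> v - (if v = c then \<phi> b else 0))"
      unfolding K[symmetric] by simp
    finally show ?thesis by (simp add: \<Phi>_def)
  qed
  have ex: "\<exists>\<zeta> f. cmod \<zeta> = 1 \<and> f \<in> H \<and> V.N f = 1 \<and> (\<forall>v. mlap W (tw \<zeta>) f v = complex_of_real t * f v)"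
    if t: "t \<in> {0..2 * \<rho>}" for t
  proof -
    have "complex_of_real t \<in> (\<Union>\<alpha>. magnetic_spectrum W \<alpha>)" using no_gap t by blast
    then obtain z f where zf: "\<And>e. cmod (z e) = 1" "f \<in> H" "V.N f = 1" "\<And>v. mlap W z f v = complex_of_real t * f v"
      unfolding in_magnetic_spectra_iff by blast
    obtain U where U: "\<forall>e\<in>E - {e0}. Arg (z e) = U (hd' e) - U (tl' e)"
      using spec[OF gauge, of "\<lambda>e. Arg (z e)"] by blast
    define \<zeta> where "\<zeta> = cis (Arg (z e0) - (U (hd' e0) - U (tl' e0)))"
    define \<beta> where "\<beta> e = (if e = e0 then Arg (z e0) - (U (hd' e0) - U (tl' e0)) else 0)" for e
    have "tw \<zeta> = (\<lambda>e. cis (\<beta> e))" by (auto simp: tw_def \<zeta>_def \<beta>_def)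
    moreover have "mlap W (\<lambda>e. cis (\<beta> e)) (\<lambda>v. cis (U v) * f v) v = complex_of_real t * (cis (U v) * f v)" for v
      using mlap_gauge[of "\<lambda>e. Arg (z e)" \<beta> U f v] U zf(4) cis_Arg_unit[of z, OF zf(1)] by (auto simp: \<beta>_def)
    ultimately show ?thesis using gauge_N[OF zf(2), of U] zf(3)
      by (intro exI[of _ \<zeta>] exI[of _ "\<lambda>v. cis (U v) * f v"]) (simp add: \<zeta>_def)
  qed
  \<comment> \<open>An end point of the interval different from \<open>q\<close>. The energies
    \<open>t k\<close> run from \<open>p\<close> towards \<open>q\<close> inside the interval and
    never reach \<open>q\<close>.\<close>
  define p where "p = (if q = 0 then 2 * \<rho> else 0)"
  define t where "t k = q + (p - q) * (1 / real (Suc k))" for k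
  have pq: "p \<noteq> q" "0 \<le> p" "p \<le> 2 * \<rho>" using \<rho> by (auto simp: p_def)
  have tq: "t k \<noteq> q" for k using pq by (simp add: t_def)
  have tI: "t k \<in> {0..2 * \<rho>}" for k
  proof -
    define s where "s = 1 / real (Suc k)"
    have s: "0 \<le> s" "s \<le> 1" by (auto simp: s_def)
    have "t k = (1 - s) * q + s * p" unfolding t_def s_def[symmetric] by (simp add: algebra_simps)
    moreover have "0 \<le> (1 - s) * q + s * p" using s q pq by simp
    moreover have "(1 - s) * q + s * p \<le> 2 * \<rho>" by (rule convex_bound_le) (use s q pq in auto)
    ultimately show ?thesis by simp
  qed
  have "t \<longlonglongrightarrow> q + (p - q) * 0"
    unfolding t_def by (intro tendsto_intros lim_inverse_n'[THEN LIMSEQ_Suc])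
  then have tl: "t \<longlonglongrightarrow> q" by simp
  obtain \<zeta> f where zf: "\<And>k. cmod (\<zeta> k) = 1" "\<And>k. f k \<in> H" "\<And>k. V.N (f k) = 1"
    "\<And>k v. mlap W (tw (\<zeta> k)) (f k) v = complex_of_real (t k) * f k v"
    using ex[OF tI] by metis
  have res: "(\<lambda>k. V.N (residual W (tw (\<zeta> k)) (t k) (f k))) \<longlonglongrightarrow> 0"
    by (simp add: zf(4) ell2_norm_def)
  obtain r z' f' where r: "strict_mono (r :: nat \<Rightarrow> nat)"
    and zl: "\<And>e. e \<in> E \<Longrightarrow> (\<lambda>k. tw (\<zeta> (r k)) e) \<longlonglongrightarrow> z' e" and fl: "\<And>v. (\<lambda>k. f (r k) v) \<longlonglongrightarrow> f' v"
    and z1: "\<And>e. cmod (z' e) = 1" and f'H: "f' \<in> H" and f'1: "V.N f' = 1"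
    and ev: "\<And>v. mlap W z' f' v = complex_of_real q * f' v"
    by (rule approximate_eigenvector_limit[OF tw1[OF zf(1)] zf(2,3) tl res]) (rule that; assumption)
  have z'1: "z' e = 1" if "e \<in> E" "e \<noteq> e0" for e
    using zl[OF that(1)] that(2) by (simp add: tw_def LIMSEQ_const_iff)
  have ipl: "(\<lambda>k. V.ip (f (r k)) g) \<longlonglongrightarrow> V.ip f' g" for g
    unfolding ip_finite by (intro tendsto_intros fl)
  have eq1: "f (r k) c * \<Phi> b = complex_of_real (q - t (r k)) * V.ip (f (r k)) \<Phi>" for k
  proof -
    have "complex_of_real (t (r k)) * V.ip (f (r k)) \<Phi> = V.ip (mlap W (tw (\<zeta> (r k))) (f (r k))) \<Phi>"
      unfolding zf(4)[abs_def] by (simp add: V.ip_scale_left)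
    also have "\<dots> = V.ip (f (r k)) (mlap W (tw (\<zeta> (r k))) \<Phi>)"
      by (rule mlap_symmetric[OF tw1[OF zf(1)] zf(2) \<Phi>H])
    also have "\<dots> = (\<Sum>v\<in>V. f (r k) v * cnj (mlap W (tw (\<zeta> (r k))) \<Phi> v * complex_of_real (m v)))"
      unfolding ip_finite by (rule sum.cong) (simp_all add: mult.assoc)
    also have "\<dots> = (\<Sum>v\<in>V. complex_of_real q * (f (r k) v * cnj (\<Phi> v) * complex_of_real (m v)) -
        (if v = c then f (r k) c * \<Phi> b else 0))"
      by (intro sum.cong refl, subst H\<Phi>, assumption) (auto simp: \<Phi>_def algebra_simps)
    also have "\<dots> = complex_of_real q * V.ip (f (r k)) \<Phi> - f (r k) c * \<Phi> b"
      using finite_V B by (simp add: sum_subtractf ip_finite sum_distrib_left)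
    finally show ?thesis by (simp add: algebra_simps)
  qed
  have \<Phi>b: "\<Phi> b \<noteq> 0" using \<phi>b by (simp add: \<Phi>_def)
  have trl: "(\<lambda>k. t (r k)) \<longlonglongrightarrow> q" using LIMSEQ_subseq_LIMSEQ[OF tl r] by (simp add: o_def)
  have "(\<lambda>k. f (r k) c * \<Phi> b) \<longlonglongrightarrow> complex_of_real (q - q) * V.ip f' \<Phi>"
    unfolding eq1 by (intro tendsto_intros ipl trl)
  moreover have "(\<lambda>k. f (r k) c * \<Phi> b) \<longlonglongrightarrow> f' c * \<Phi> b" by (intro tendsto_intros fl)
  ultimately have "f' c * \<Phi> b = complex_of_real (q - q) * V.ip f' \<Phi>" by (rule LIMSEQ_unique[rotated])
  then have f'c: "f' c = 0" using \<Phi>b by simp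
  \<comment> \<open>The defect at \<open>c\<close> of the limit function with respect to the k-th
    twist; it tends to 0 because the twists converge.\<close>
  define D where "D k = (mlap W (tw (\<zeta> (r k))) f' c - mlap W z' f' c) * complex_of_real (m c)" for k
  have Dl: "D \<longlonglongrightarrow> (mlap W z' f' c - mlap W z' f' c) * complex_of_real (m c)"
    unfolding D_def by (intro tendsto_intros tendsto_mlap zl)
  have off: "mlap W (tw (\<zeta> (r k))) f' v = complex_of_real q * f' v" if v: "v \<noteq> c" for k v
  proof -
    have i: "cnj (tw (\<zeta> (r k)) e) * f' (tl' e) = cnj (z' e) * f' (tl' e)" if "e \<in> E" "hd' e = v" for e
      using that v z'1 e(4) f'c by (cases "e = e0") (auto simp: tw_def incident_def)
    have o: "tw (\<zeta> (r k)) e * f' (hd' e) = z' e * f' (hd' e)" if "e \<in> E" "tl' e = v" for e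
      using that v z'1 e(4) f'c by (cases "e = e0") (auto simp: tw_def incident_def)
    have "mlap W (tw (\<zeta> (r k))) f' v = mlap W z' f' v"
      unfolding mlap_def Let_def arcs_at
      by (intro if_cong refl arg_cong2[of _ _ _ _ "(/)"] arg_cong2[of _ _ _ _ "(+)"] sum.cong) (auto simp: i o)
    then show ?thesis using ev by simp
  qed
  have eq2: "complex_of_real (t (r k) - q) * V.ip (f (r k)) f' = f (r k) c * cnj (D k)" for k
  proof -
    have "complex_of_real (t (r k)) * V.ip (f (r k)) f' = V.ip (mlap W (tw (\<zeta> (r k))) (f (r k))) f'"
      unfolding zf(4)[abs_def] by (simp add: V.ip_scale_left)
    also have "\<dots> = V.ip (f (r k)) (mlap W (tw (\<zeta> (r k))) f')"
      by (rule mlap_symmetric[OF tw1[OF zf(1)] zf(2) f'H])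
    also have "\<dots> = (\<Sum>v\<in>V. complex_of_real q * (f (r k) v * cnj (f' v) * complex_of_real (m v)) +
        (if v = c then f (r k) c * cnj (D k) else 0))"
      unfolding ip_finite
      by (rule sum.cong) (auto simp: off D_def ev f'c algebra_simps)
    also have "\<dots> = complex_of_real q * V.ip (f (r k)) f' + f (r k) c * cnj (D k)"
      using finite_V B by (simp add: sum.distrib ip_finite sum_distrib_left)
    finally show ?thesis by (simp add: algebra_simps)
  qed
  \<comment> \<open>The value at \<open>c\<close> is eliminated between \<open>eq1\<close> and
    \<open>eq2\<close>, and the common factor \<open>t (r k) - q\<close> is cancelled; this is where
    the energies must differ from \<open>q\<close>.\<close>
  have eq3: "V.ip (f (r k)) f' * \<Phi> b = - (V.ip (f (r k)) \<Phi> * cnj (D k))" for k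
  proof -
    have "complex_of_real (t (r k) - q) * (V.ip (f (r k)) f' * \<Phi> b) = (f (r k) c * \<Phi> b) * cnj (D k)"
      using eq2[of k] by (simp add: mult.assoc[symmetric])
    also have "\<dots> = complex_of_real (t (r k) - q) * - (V.ip (f (r k)) \<Phi> * cnj (D k))"
      unfolding eq1 by (simp add: algebra_simps)
    finally have "complex_of_real (t (r k) - q) * (V.ip (f (r k)) f' * \<Phi> b)
        = complex_of_real (t (r k) - q) * - (V.ip (f (r k)) \<Phi> * cnj (D k))" .
    moreover have "complex_of_real (t (r k) - q) \<noteq> 0" using tq[of "r k"] by simp
    ultimately show ?thesis by (simp only: mult_cancel_left) simp
  qed
  have l1: "(\<lambda>k. V.ip (f (r k)) f' * \<Phi> b) \<longlonglongrightarrow> V.ip f' f' * \<Phi> b" by (intro tendsto_intros ipl)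
  have l2: "(\<lambda>k. V.ip (f (r k)) f' * \<Phi> b) \<longlonglongrightarrow>
      - (V.ip f' \<Phi> * cnj ((mlap W z' f' c - mlap W z' f' c) * complex_of_real (m c)))"
    unfolding eq3 by (intro tendsto_intros ipl Dl)
  have "V.ip f' f' * \<Phi> b = - (V.ip f' \<Phi> * cnj ((mlap W z' f' c - mlap W z' f' c) * complex_of_real (m c)))"
    by (rule LIMSEQ_unique[OF l1 l2])
  then show False using \<Phi>b V.ip_self[OF f'H] f'1 by simp
qed

end

section \<open>Quotients by free actions of the integers\<close>

locale free_Z_action =
  fixes X :: "'a set" and \<phi> :: "int \<Rightarrow> 'a \<Rightarrow> 'a"
  assumes action: "group_action integer_group X \<phi>"
    and free: "x \<in> X \<Longrightarrow> \<phi> k x = x \<Longrightarrow> k = 0"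
begin

text \<open>\<open>sec\<close> chooses a representative of each orbit, and \<open>idx\<close> is the
  integer that carries it to the given point, unique by freeness. The pair of \<open>pr\<close> and
  \<open>idx\<close> identifies \<open>X\<close> with the product of the orbit space and the
  integers.\<close>

definition pr :: "'a \<Rightarrow> 'a set" where "pr = orbit integer_group \<phi>"
definition sec :: "'a set \<Rightarrow> 'a" where "sec A = (SOME x. x \<in> X \<and> pr x = A)"
definition idx :: "'a \<Rightarrow> int" where "idx x = (SOME k. x = \<phi> k (sec (pr x)))"

lemma act_0: "x \<in> X \<Longrightarrow> \<phi> 0 x = x"
  using group_action.id_eq_one[OF action] by (metis one_integer_group restrict_apply')

lemma act_add: "x \<in> X \<Longrightarrow> \<phi> (a + b) x = \<phi> a (\<phi> b x)"
  using group_action.composition_rule[OF action, of x a b] by simp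

lemma act_in: "x \<in> X \<Longrightarrow> \<phi> k x \<in> X"
  using group_action.element_image[OF action, of k x] by simp

lemma act_minus: "x \<in> X \<Longrightarrow> \<phi> (- k) (\<phi> k x) = x"
  using act_add[of x "- k" k] act_0 by simp

lemma act_inj: "x \<in> X \<Longrightarrow> \<phi> a x = \<phi> b x \<Longrightarrow> a = b"
  using free[of x "a - b"] act_add[of x "- b" a] act_minus[of x b] by (simp add: algebra_simps)

lemma pr_range: "pr x = range (\<lambda>k. \<phi> k x)"
  by (auto simp: pr_def orbit_def)

lemma pr_act:
  assumes "x \<in> X"
  shows "pr (\<phi> k x) = pr x"
proof -
  have "\<phi> j x \<in> range (\<lambda>i. \<phi> i (\<phi> k x))" for j
    using act_add[OF assms, of "j - k" k] by (simp add: image_iff) (metis diff_add_cancel)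
  then show ?thesis using act_add[OF assms, symmetric] by (auto simp: pr_range)
qed

lemma pr_eq_iff: "x \<in> X \<Longrightarrow> y \<in> X \<Longrightarrow> pr x = pr y \<longleftrightarrow> (\<exists>k. y = \<phi> k x)"
  using pr_act act_0[of y] unfolding pr_range by (metis rangeE rangeI)

lemma orbits_eq: "orbits integer_group X \<phi> = pr ` X"
  by (auto simp: orbits_def pr_def)

lemma sec:
  assumes "A \<in> pr ` X"
  shows "sec A \<in> X" "pr (sec A) = A"
proof -
  have "\<exists>x. x \<in> X \<and> pr x = A" using assms by auto
  from someI_ex[OF this] show "sec A \<in> X" "pr (sec A) = A" unfolding sec_def by auto
qed

lemma act_idx:
  assumes "x \<in> X"
  shows "\<phi> (idx x) (sec (pr x)) = x"
proof -
  have "\<exists>k. x = \<phi> k (sec (pr x))" using assms sec[of "pr x"] pr_eq_iff by auto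
  from someI_ex[OF this] show ?thesis unfolding idx_def by simp
qed

lemma idx_act:
  assumes "x \<in> X"
  shows "idx (\<phi> k x) = k + idx x"
proof -
  have s: "sec (pr x) \<in> X" using sec assms by auto
  have "\<phi> (idx (\<phi> k x)) (sec (pr x)) = \<phi> k x" using act_idx[OF act_in[OF assms], of k] pr_act[OF assms] by simp
  also have "\<dots> = \<phi> (k + idx x) (sec (pr x))" using act_add[OF s] act_idx[OF assms] by simp
  finally show ?thesis using act_inj[OF s] by blast
qed

lemma idx_sec: "A \<in> pr ` X \<Longrightarrow> idx (sec A) = 0"
  using act_idx[of "sec A"] sec[of A] free[of "sec A"] by auto

end

section \<open>The periodic tree and its finite quotient\<close>

locale weighted_periodic_tree = Z_periodic_tree W \<phi> \<psi>
  for W :: "('v, 'e) weighted_graph" and \<phi> \<psi> +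
  assumes weights: "standard_weights W \<or> combinatorial_weights W"
begin

abbreviation "T \<equiv> graph_of W"
abbreviation "Q \<equiv> quotient_weighted_graph \<phi> \<psi> W"
abbreviation "G \<equiv> graph_of Q"

sublocale AV: free_Z_action "verts T" \<phi>
  by (rule free_Z_action.intro) (rule action_verts free_verts; assumption)+
sublocale AE: free_Z_action "arcs T" \<psi>
  by (rule free_Z_action.intro) (rule action_arcs free_arcs; assumption)+

lemma wfT: "wf_digraph T" using tree by (simp add: undirected_tree_def)

lemma endsT: "e \<in> arcs T \<Longrightarrow> head T e \<in> verts T" "e \<in> arcs T \<Longrightarrow> tail T e \<in> verts T"
  using wfT by (auto simp: wf_digraph_def)

lemma G_simps: "verts G = AV.pr ` verts T" "arcs G = AE.pr ` arcs T"
  by (simp_all add: quotient_weighted_graph_def quotient_graph_def AV.orbits_eq AE.orbits_eq)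

lemma G_ends:
  assumes "e \<in> arcs T"
  shows "head G (AE.pr e) = AV.pr (head T e)" "tail G (AE.pr e) = AV.pr (tail T e)"
  using assms head_equivariant[of e] tail_equivariant[of e]
  by (auto simp: quotient_weighted_graph_def quotient_graph_def AE.pr_range AV.pr_range image_image)

lemma finG: "fin_digraph G"
proof -
  interpret wf_digraph G by unfold_locales (use endsT G_ends G_simps in auto)
  have "finite (verts G)" "finite (arcs G)"
    using finite_quotient_verts finite_quotient_arcs by (auto simp: quotient_weighted_graph_def)
  then show ?thesis by (rule fin_digraphI)
qed

text \<open>The covering property: a translation that maps an edge at \<open>v\<close> to an edge at
  \<open>v\<close> at the same kind of end fixes \<open>v\<close>, hence is trivial. Treating heads
  and tails separately keeps degrees right when edges become loops in the quotient.\<close>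

lemma arcs_at_bij_aux:
  assumes v: "v \<in> verts T"
    and g: "\<And>e k. e \<in> arcs T \<Longrightarrow> g (\<psi> k e) = \<phi> k (g e)" "\<And>e. e \<in> arcs T \<Longrightarrow> g e \<in> verts T"
      "\<And>e. e \<in> arcs T \<Longrightarrow> g' (AE.pr e) = AV.pr (g e)"
  shows "bij_betw AE.pr {e \<in> arcs T. g e = v} {B \<in> arcs G. g' B = AV.pr v}"
  unfolding bij_betw_def
proof
  show "inj_on AE.pr {e \<in> arcs T. g e = v}"
  proof (rule inj_onI, clarify)
    fix e e' assume e: "e \<in> arcs T" "e' \<in> arcs T" "AE.pr e = AE.pr e'" "v = g e" "g e' = g e"
    obtain k where k: "e' = \<psi> k e" using AE.pr_eq_iff e by auto
    then have "\<phi> k v = v" using g(1)[of e k] e by simp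
    then have "k = 0" using free_verts v by blast
    then show "e = e'" using k AE.act_0 e by simp
  qed
  show "AE.pr ` {e \<in> arcs T. g e = v} = {B \<in> arcs G. g' B = AV.pr v}"
  proof
    show "AE.pr ` {e \<in> arcs T. g e = v} \<subseteq> {B \<in> arcs G. g' B = AV.pr v}" using g(3) G_simps by auto
    show "{B \<in> arcs G. g' B = AV.pr v} \<subseteq> AE.pr ` {e \<in> arcs T. g e = v}"
    proof clarify
      fix B assume B: "B \<in> arcs G" "g' B = AV.pr v"
      then obtain e where e: "e \<in> arcs T" "B = AE.pr e" using G_simps by auto
      then obtain k where "v = \<phi> k (g e)" using AV.pr_eq_iff[of "g e" v] g(2,3) v B by auto
      then have "\<psi> k e \<in> {e \<in> arcs T. g e = v}" "AE.pr (\<psi> k e) = B"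
        using g(1) e AE.act_in AE.pr_act by auto
      then show "B \<in> AE.pr ` {e \<in> arcs T. g e = v}" by blast
    qed
  qed
qed

lemma arcs_at_bij:
  assumes v: "v \<in> verts T"
  shows "bij_betw AE.pr (in_arcs T v) (in_arcs G (AV.pr v))"
    and "bij_betw AE.pr (out_arcs T v) (out_arcs G (AV.pr v))"
  unfolding in_arcs_def out_arcs_def
  by (rule arcs_at_bij_aux[OF v]; simp add: head_equivariant tail_equivariant endsT G_ends)+

lemma finite_arcs_at:
  assumes "v \<in> verts T"
  shows "finite (in_arcs T v)" "finite (out_arcs T v)"
proof -
  interpret G: fin_digraph G by (rule finG)
  show "finite (in_arcs T v)" "finite (out_arcs T v)"
    using arcs_at_bij[OF assms] G.finite_in_arcs G.finite_out_arcs by (metis bij_betw_finite)+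
qed

lemma degree_G: "v \<in> verts T \<Longrightarrow> degree G (AV.pr v) = degree T v"
  using bij_betw_same_card[OF arcs_at_bij(1)] bij_betw_same_card[OF arcs_at_bij(2)]
  by (simp add: degree_def in_degree_def out_degree_def)

lemma weight_G:
  "v \<in> verts T \<Longrightarrow> vweight Q (AV.pr v) = vweight W v"
  "e \<in> arcs T \<Longrightarrow> eweight Q (AE.pr e) = eweight W e"
proof -
  assume "v \<in> verts T"
  then have "vweight W ` AV.pr v = {vweight W v}"
    using vweight_invariant by (simp add: AV.pr_range image_image)
  then show "vweight Q (AV.pr v) = vweight W v" by (simp add: quotient_weighted_graph_def)
next
  assume "e \<in> arcs T"
  then have "eweight W ` AE.pr e = {eweight W e}"
    using eweight_invariant by (simp add: AE.pr_range image_image)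
  then show "eweight Q (AE.pr e) = eweight W e" by (simp add: quotient_weighted_graph_def)
qed

lemma linkedT: "linked T (arcs T)" and verts_T_ne: "verts T \<noteq> {}"
  using connected_imp_linked tree by (auto simp: undirected_tree_def)

lemma linkedG: "linked G (arcs G)"
  unfolding linked_def
proof (intro allI impI)
  fix S assume S: "S \<subseteq> verts G" "S \<noteq> {}" "\<forall>e\<in>arcs G. (tail G e \<in> S) = (head G e \<in> S)"
  have "{v \<in> verts T. AV.pr v \<in> S} = verts T"
  proof (rule linkedD[OF linkedT])
    show "{v \<in> verts T. AV.pr v \<in> S} \<noteq> {}" using S G_simps by auto
    fix e assume e: "e \<in> arcs T"
    then show "(tail T e \<in> {v \<in> verts T. AV.pr v \<in> S}) = (head T e \<in> {v \<in> verts T. AV.pr v \<in> S})"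
      using S(3) G_simps(2) G_ends[OF e] endsT[OF e] by auto
  qed auto
  then show "S = verts G" using S G_simps by auto
qed

text \<open>An isolated vertex would be the whole connected graph, which is infinite. This makes
  standard vertex weights positive.\<close>

lemma degree_pos:
  assumes v: "v \<in> verts T"
  shows "degree T v > 0"
proof (rule ccontr)
  assume "\<not> degree T v > 0"
  then have no: "in_arcs T v = {}" "out_arcs T v = {}"
    using finite_arcs_at[OF v] by (auto simp: degree_def in_degree_def out_degree_def)
  have "{v} = verts T"
    by (rule linkedD[OF linkedT]) (use v no in \<open>auto simp: in_arcs_def out_arcs_def\<close>)
  then show False using infinite_verts by (metis finite.emptyI finite_insert)
qed

lemma weights_pos: "e \<in> arcs T \<Longrightarrow> eweight W e = 1" "v \<in> verts T \<Longrightarrow> vweight W v > 0"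
  using weights degree_pos by (auto simp: standard_weights_def combinatorial_weights_def)

lemma rel_weight_eq:
  "v \<in> verts T \<Longrightarrow> rel_weight W v = real (degree T v) / vweight W v"
  "v \<in> verts T \<Longrightarrow> rel_weight Q (AV.pr v) = rel_weight W v"
proof -
  assume v: "v \<in> verts T"
  then show *: "rel_weight W v = real (degree T v) / vweight W v"
    by (simp add: rel_weight_def weights_pos degree_def in_degree_def out_degree_def)
  have e: "eweight Q B = 1" if "B \<in> arcs G" for B
    using that G_simps weight_G(2) weights_pos(1) by auto
  have "rel_weight Q (AV.pr v) = real (degree G (AV.pr v)) / vweight W v"
    using v weight_G(1)[OF v] by (simp add: rel_weight_def e degree_def in_degree_def out_degree_def)
  then show "rel_weight Q (AV.pr v) = rel_weight W v" using * degree_G[OF v] by simp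
qed

definition \<rho> :: real where "\<rho> = rho_inf W"

lemma rho_G: "rho_inf Q = \<rho>"
  unfolding \<rho>_def rho_inf_def G_simps image_image
  by (rule arg_cong[of _ _ Sup]) (use rel_weight_eq(2) in auto)

text \<open>The supremum is taken over finitely many values, one for each vertex orbit, so it is a
  genuine upper bound.\<close>

lemma degree_le_rho:
  assumes v: "v \<in> verts T"
  shows "real (degree T v) \<le> \<rho> * vweight W v"
proof -
  have "rel_weight W ` verts T = rel_weight Q ` verts G"
    unfolding G_simps image_image using rel_weight_eq(2) by auto
  then have "finite (rel_weight W ` verts T)" using finG by (simp add: fin_digraph_def fin_digraph_axioms_def)
  then have "rel_weight W v \<le> \<rho>"
    unfolding \<rho>_def rho_inf_def using v by (intro cSUP_upper bdd_above_finite) auto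
  then show ?thesis using rel_weight_eq(1)[OF v] weights_pos(2)[OF v] by (simp add: pos_divide_le_eq)
qed

lemma rho_pos: "\<rho> > 0"
proof -
  obtain v where v: "v \<in> verts T" using verts_T_ne by blast
  have "0 < \<rho> * vweight W v" using degree_le_rho[OF v] degree_pos[OF v] by linarith
  then show ?thesis using weights_pos(2)[OF v] by (simp add: zero_less_mult_iff)
qed

sublocale WT: unit_weighted_graph W \<rho>
  by (rule unit_weighted_graph.intro)
     (use wfT weights_pos finite_arcs_at degree_le_rho rho_pos in \<open>auto simp: less_imp_le\<close>)

sublocale WQ: finite_weighted_graph Q \<rho>
proof -
  interpret G: fin_digraph G by (rule finG)
  show "finite_weighted_graph Q \<rho>"
  proof (intro finite_weighted_graph.intro unit_weighted_graph.intro finite_weighted_graph_axioms.intro)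
    show "wf_digraph G" by (rule G.wf_digraph)
    show "eweight Q e = 1" if "e \<in> arcs G" for e using that G_simps weight_G(2) weights_pos(1) by auto
    show "0 < vweight Q v" if "v \<in> verts G" for v using that G_simps weight_G(1) weights_pos(2) by auto
    show "finite (in_arcs G v)" "finite (out_arcs G v)" for v
      using G.finite_in_arcs G.finite_out_arcs by auto
    show "real (degree G v) \<le> \<rho> * vweight Q v" if "v \<in> verts G" for v
      using that G_simps weight_G(1) degree_G degree_le_rho by auto
    show "0 \<le> \<rho>" using rho_pos by simp
    show "finite (verts G)" "finite (arcs G)" by auto
  qed
qed

text \<open>
  Acyclicity is applied to \<open>N\<close> consecutive translates of edge orbit representatives: as \<open>N\<close> grows,
  the number of their endpoints outside the same translates of vertex orbit representatives is negligible.
\<close>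

lemma card_arcs_G_le: "card (arcs G) \<le> card (verts G)"
proof (rule ccontr)
  assume "\<not> ?thesis"
  then have gt: "card (verts G) + 1 \<le> card (arcs G)" by simp
  let ?t = "\<lambda>B. AV.idx (tail T (AE.sec B))" and ?h = "\<lambda>B. AV.idx (head T (AE.sec B))"
  \<comment> \<open>Bounds the position of both ends of every representative edge, so widening the
    window of vertex translates by \<open>C\<close> on each side captures all ends of edges in
    \<open>F\<close>.\<close>
  define C where "C = (\<Sum>B\<in>arcs G. nat \<bar>?t B\<bar> + nat \<bar>?h B\<bar>)"
  have Cb: "nat \<bar>?t B\<bar> + nat \<bar>?h B\<bar> \<le> C" if "B \<in> arcs G" for B
    unfolding C_def by (rule member_le_sum[OF that]) (use WQ.finite_E in auto)
  define n where "n = card (verts G)"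
  \<comment> \<open>Just large enough to contradict
    \<open>(n + 1) * N \<le> n * (N + 2 * C)\<close>.\<close>
  define N where "N = 2 * C * n + 1"
  define F where "F = (\<lambda>(B, j). \<psi> j (AE.sec B)) ` (arcs G \<times> {0..<int N})"
  define P where "P = (\<lambda>(A, j). \<phi> j (AV.sec A)) ` (verts G \<times> {- int C..<int (N + C)})"
  have sE: "AE.sec B \<in> arcs T" "AE.pr (AE.sec B) = B" if "B \<in> arcs G" for B
    using AE.sec that G_simps by auto
  have "inj_on (\<lambda>(B, j). \<psi> j (AE.sec B)) (arcs G \<times> {0..<int N})"
  proof (rule inj_onI, clarify)
    fix B j B' j' assume *: "B \<in> arcs G" "B' \<in> arcs G" "\<psi> j (AE.sec B) = \<psi> j' (AE.sec B')"
    then have "B = B'" using AE.pr_act sE by metis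
    then show "B = B' \<and> j = j'" using * AE.act_inj sE by blast
  qed
  then have cF: "card F = card (arcs G) * N" unfolding F_def by (simp add: card_image card_cartesian_product)
  have FT: "F \<subseteq> arcs T" unfolding F_def using sE AE.act_in by auto
  have finP: "finite P" unfolding P_def using WQ.finite_V by simp
  have cP: "card P \<le> n * (N + 2 * C)"
  proof -
    have "card P \<le> card (verts G \<times> {- int C..<int (N + C)})"
      unfolding P_def by (rule card_image_le) (use WQ.finite_V in simp)
    also have "\<dots> = n * nat (int (N + C) - (- int C))"
      by (simp only: card_cartesian_product n_def card_atLeastLessThan_int)
    also have "nat (int (N + C) - (- int C)) = N + 2 * C" by linarith
    finally show ?thesis .
  qed
  have inP: "\<phi> j v \<in> P" if "v \<in> verts T" "\<bar>AV.idx v\<bar> \<le> int C" "0 \<le> j" "j < int N" for v j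
  proof -
    have "\<phi> j v = \<phi> (j + AV.idx v) (AV.sec (AV.pr v))"
      using AV.act_add AV.act_idx that(1) AV.sec by (metis imageI)
    then show ?thesis unfolding P_def using that G_simps
      by (intro image_eqI[of _ _ "(AV.pr v, j + AV.idx v)"]) auto
  qed
  have "tail T ` F \<union> head T ` F \<subseteq> P"
  proof -
    have "tail T (\<psi> j (AE.sec B)) \<in> P \<and> head T (\<psi> j (AE.sec B)) \<in> P"
      if "B \<in> arcs G" "0 \<le> j" "j < int N" for B j
    proof -
      have "\<bar>?t B\<bar> \<le> int C" "\<bar>?h B\<bar> \<le> int C" using Cb[OF that(1)] by linarith+
      then show ?thesis using inP that sE endsT tail_equivariant head_equivariant by simp
    qed
    then show ?thesis unfolding F_def by auto
  qed
  then have "card (tail T ` F \<union> head T ` F) \<le> n * (N + 2 * C)"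
    using card_mono[OF finP] cP by (meson le_trans)
  moreover have "card F \<le> card (tail T ` F \<union> head T ` F)"
    by (rule acyclic_card_le[OF wfT _ FT])
       (use tree WQ.finite_E in \<open>auto simp: undirected_tree_def F_def\<close>)
  ultimately have "card (arcs G) * N \<le> n * (N + 2 * C)" using cF by simp
  moreover have "(n + 1) * N \<le> card (arcs G) * N" using gt by (intro mult_right_mono) (auto simp: n_def)
  ultimately have "(n + 1) * N \<le> n * (N + 2 * C)" by linarith
  then have "N \<le> 2 * C * n" by (simp add: algebra_simps)
  then show False by (simp add: N_def)
qed

text \<open>The integer cocycle of the covering: by how many translates a lift of the edge advances,
  relative to the chosen vertex representatives.\<close>

definition shift :: "'e set \<Rightarrow> int" where
  "shift B = AV.idx (head T (AE.sec B)) - AV.idx (tail T (AE.sec B))"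

text \<open>Translating a lift raises the positions of both its ends equally, so the difference does
  not depend on the lift.\<close>

lemma shift_pr:
  assumes e: "e \<in> arcs T"
  shows "shift (AE.pr e) = AV.idx (head T e) - AV.idx (tail T e)"
proof -
  let ?s = "AE.sec (AE.pr e)"
  have s: "?s \<in> arcs T" using AE.sec e by auto
  have ee: "e = \<psi> (AE.idx e) ?s" using AE.act_idx[OF e] by simp
  have "AV.idx (head T e) = AE.idx e + AV.idx (head T ?s)" "AV.idx (tail T e) = AE.idx e + AV.idx (tail T ?s)"
    using head_equivariant[OF s, of "AE.idx e"] tail_equivariant[OF s, of "AE.idx e"] AV.idx_act endsT[OF s] ee by auto
  then show ?thesis by (simp add: shift_def)
qed

text \<open>If it were the coboundary of \<open>U\<close>, the function \<open>idx\<close> minus the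
  lift of \<open>U\<close> would be constant on the connected tree, but translation by 1 raises it
  by 1.\<close>

lemma shift_not_coboundary: "\<not> (\<exists>U. \<forall>B\<in>arcs G. shift B = U (head G B) - U (tail G B))"
proof
  assume "\<exists>U. \<forall>B\<in>arcs G. shift B = U (head G B) - U (tail G B)"
  then obtain U where U: "\<And>B. B \<in> arcs G \<Longrightarrow> shift B = U (head G B) - U (tail G B)" by blast
  define g where "g v = AV.idx v - U (AV.pr v)" for v
  have const: "g (tail T e) = g (head T e)" if e: "e \<in> arcs T" for e
    using U[of "AE.pr e"] shift_pr[OF e] e G_simps G_ends[OF e] by (auto simp: g_def)
  obtain v0 where v0: "v0 \<in> verts T" using verts_T_ne by blast
  have "{v \<in> verts T. g v = g v0} = verts T"
    by (rule linkedD[OF linkedT]) (use v0 const endsT in auto)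
  then have "g (\<phi> 1 v0) = g v0" using AV.act_in v0 by blast
  then show False using AV.idx_act[OF v0, of 1] AV.pr_act[OF v0] by (simp add: g_def)
qed

text \<open>Every cocycle is a coboundary on a spanning tree, whereas \<open>shift\<close> is none
  on the whole quotient. So there is an edge outside the tree, and the upper bound allows no second
  one.\<close>

lemma card_arcs_G: "card (arcs G) = card (verts G)"
proof -
  have "verts G \<noteq> {}" using verts_T_ne G_simps by auto
  then obtain F where F: "F \<subseteq> arcs G" "finite F" "card F + 1 = card (verts G)"
    and cb: "\<And>\<sigma> :: 'e set \<Rightarrow> int. \<exists>U. \<forall>e\<in>F. \<sigma> e = U (head G e) - U (tail G e)"
    using spanning_tree_coboundary[OF WQ.wf WQ.finite_V _ subset_refl linkedG, where 'g = int] by blast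
  have "F \<noteq> arcs G"
    using cb[of shift] shift_not_coboundary by auto
  then have "card F < card (arcs G)" using F WQ.finite_E by (intro psubset_card_mono) auto
  then show ?thesis using F card_arcs_G_le by simp
qed

lemma regular_of_no_leaf:
  assumes "\<forall>v\<in>verts G. degree G v \<noteq> 1" "v \<in> verts G"
  shows "degree G v = 2"
proof (rule ccontr)
  assume d: "degree G v \<noteq> 2"
  have ge: "degree G u \<ge> 2" if "u \<in> verts G" for u
  proof -
    have "degree G u > 0" using that G_simps degree_G degree_pos by auto
    then show ?thesis using assms(1) that by (metis One_nat_def Suc_leI le_neq_implies_less numeral_2_eq_2)
  qed
  have "(\<Sum>u\<in>verts G. 2) < (\<Sum>u\<in>verts G. degree G u)"
    by (rule sum_strict_mono_ex1) (use WQ.finite_V ge d assms(2) in \<open>auto intro!: bexI[of _ v] le_neq_trans\<close>)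
  then show False using sum_degree[OF finG] card_arcs_G by simp
qed

lemma verts_G_ne: "verts G \<noteq> {}"
  using verts_T_ne G_simps by auto

lemma cycle_graph_iff_no_leaf: "is_cycle_graph G \<longleftrightarrow> (\<forall>v\<in>verts G. degree G v \<noteq> 1)"
proof
  assume "is_cycle_graph G"
  then show "\<forall>v\<in>verts G. degree G v \<noteq> 1" using cycle_graph_regular[OF finG] by simp
next
  assume "\<forall>v\<in>verts G. degree G v \<noteq> 1"
  then show "is_cycle_graph G" using two_regular_finite[OF finG linkedG verts_G_ne] regular_of_no_leaf by blast
qed

lemma lattice_of_cycle_graph:
  assumes "is_cycle_graph G"
  shows "undirected_iso T lattice_Z"
proof (rule two_regular_infinite[OF wfT linkedT infinite_verts])
  show "degree T v = 2" if "v \<in> verts T" for v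
    using cycle_graph_regular[OF finG assms, of "AV.pr v"] degree_G that G_simps by auto
qed (use finite_arcs_at in auto)

lemma no_leaf_of_no_magnetic_gap:
  assumes "magnetic_spectral_gaps Q = {}"
  shows "\<forall>v\<in>verts G. degree G v \<noteq> 1"
proof (rule ccontr)
  assume "\<not> ?thesis"
  then obtain l where l: "l \<in> verts G" "degree G l = 1" by blast
  obtain c e0 e1 b B where *: "e0 \<in> arcs G" "e1 \<in> arcs G" "e0 \<noteq> e1" "incident G e0 c"
     "{tail G e1, head G e1} = {c, b}" "B \<subseteq> verts G" "c \<in> verts G - B" "b \<in> B"
     "\<forall>e\<in>arcs G - {e1}. tail G e \<in> B \<longleftrightarrow> head G e \<in> B"
     "\<forall>\<sigma> :: 'e set \<Rightarrow> real. \<exists>U. \<forall>e\<in>arcs G - {e0}. \<sigma> e = U (head G e) - U (tail G e)"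
    using branch_on_cycle[OF finG linkedG card_arcs_G l, where 'g = real]
    by (elim exE conjE) (rule that; assumption)
  have "\<exists>t\<in>{0..2 * \<rho>}. complex_of_real t \<notin> (\<Union>\<alpha>. magnetic_spectrum Q \<alpha>)"
    by (rule WQ.magnetic_gap[OF linkedG rho_pos *(1-6) _ _ *(8) _ *(10)]) (use *(7,9) in auto)
  then show False
    using assms unfolding magnetic_spectral_gaps_def spectral_interval_def rho_G by blast
qed

end

section \<open>Floquet decomposition\<close>

lemma infsum_sum:
  fixes f :: "'i \<Rightarrow> 'a \<Rightarrow> 'b :: banach"
  assumes "finite I" "\<And>i. i \<in> I \<Longrightarrow> f i summable_on A"
  shows "(\<Sum>\<^sub>\<infinity>x\<in>A. \<Sum>i\<in>I. f i x) = (\<Sum>i\<in>I. \<Sum>\<^sub>\<infinity>x\<in>A. f i x)"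
    and "(\<lambda>x. \<Sum>i\<in>I. f i x) summable_on A"
  using assms by (induction I rule: finite_induct) (auto simp: infsum_add summable_on_add)

lemma (in weighted_set) ell2_finite_approximation:
  assumes f: "f \<in> ell2 A w" and d: "\<delta> > 0"
  obtains F where "finite F" "F \<subseteq> A" "N (\<lambda>x. if x \<in> F then 0 else f x) < \<delta>"
proof -
  let ?g = "\<lambda>x. (cmod (f x))\<^sup>2 * w x"
  have s: "?g summable_on A" by (rule ell2_summable[OF f])
  have "\<delta>\<^sup>2 / 4 > 0" using d by simp
  then obtain F where F: "finite F" "F \<subseteq> A" "dist (sum ?g F) (infsum ?g A) \<le> \<delta>\<^sup>2 / 4"
    using infsum_finite_approximation[OF s] by blast
  have "(N (\<lambda>x. if x \<in> F then 0 else f x))\<^sup>2 = infsum ?g (A - F)"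
    unfolding N_sq by (rule infsum_cong_neutral) auto
  also have "\<dots> = infsum ?g A - infsum ?g F"
    by (rule infsum_Diff) (use s F in auto)
  also have "\<dots> = infsum ?g A - sum ?g F" using F(1) by simp
  also have "\<dots> \<le> \<delta>\<^sup>2 / 4" using F(3) unfolding dist_real_def by linarith
  also have "\<dots> = (\<delta> / 2)\<^sup>2" by (simp add: power_divide)
  finally have "N (\<lambda>x. if x \<in> F then 0 else f x) \<le> \<delta> / 2" by (rule power2_le_imp_le) (use d in simp)
  then show ?thesis using that[OF F(1,2)] d by linarith
qed

text \<open>Orthogonality of the characters of the cyclic group of order \<open>N\<close>, as a
  geometric sum whose ratio is an \<open>N\<close>-th root of unity other than 1.\<close>

lemma sum_cis_period:
  fixes d :: int
  assumes "N > 0" "\<not> int N dvd d"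
  shows "(\<Sum>j<N. cis (2 * pi * real j / real N * real_of_int d)) = 0"
proof -
  define x where "x = cis (2 * pi * real_of_int d / real N)"
  have "x \<noteq> 1"
  proof
    assume "x = 1"
    then have "cos (2 * pi * real_of_int d / real N) = 1" by (metis x_def cis.sel(1) one_complex.sel(1))
    then obtain n :: int where "2 * pi * real_of_int d / real N = real_of_int n * 2 * pi"
      unfolding cos_one_2pi_int by blast
    then have "pi * real_of_int d = pi * (real_of_int n * real N)" using assms(1) by (simp add: field_simps)
    then have "real_of_int d = real_of_int n * real N" unfolding mult_cancel_left using pi_neq_zero by blast
    then have "real_of_int d = real_of_int (n * int N)" by simp
    then have "d = n * int N" by (simp only: of_int_eq_iff)
    then show False using assms(2) by simp
  qed
  moreover have "x ^ N = 1"
  proof -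
    have "x ^ N = cis (real N * (2 * pi * real_of_int d / real N))" by (simp only: x_def Complex.DeMoivre)
    also have "\<dots> = cis (2 * pi * real_of_int d)" using assms(1) by simp
    also have "\<dots> = 1" by (intro complex_eqI) (auto simp: cos_one_2pi_int sin_zero_iff_int2 intro!: exI[of _ d] exI[of _ "2 * d"])
    finally show ?thesis .
  qed
  moreover have "cis (2 * pi * real j / real N * real_of_int d) = x ^ j" for j
    by (simp add: x_def Complex.DeMoivre mult_ac)
  ultimately show ?thesis by (simp add: geometric_sum)
qed

text \<open>Differences of indices from the window are at most 2 M < N in absolute value, so
  distinct indices stay distinct modulo \<open>N\<close> and all cross terms cancel.\<close>

lemma Parseval_DFT:
  fixes a :: "int \<Rightarrow> complex" and M :: int
  assumes "2 * M < int N" "N > 0"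
  shows "(\<Sum>j<N. (cmod (\<Sum>k=-M..M. a k * cis (- (2 * pi * real j / real N * real_of_int k))))\<^sup>2)
       = real N * (\<Sum>k=-M..M. (cmod (a k))\<^sup>2)"
proof -
  let ?I = "{-M..M}"
  let ?\<theta> = "\<lambda>j. 2 * pi * real j / real N"
  have "complex_of_real (\<Sum>j<N. (cmod (\<Sum>k\<in>?I. a k * cis (- (?\<theta> j * real_of_int k))))\<^sup>2)
      = (\<Sum>j<N. \<Sum>k\<in>?I. \<Sum>l\<in>?I. (a k * cnj (a l)) * cis (?\<theta> j * real_of_int (l - k)))"
    unfolding of_real_sum
  proof (rule sum.cong[OF refl])
    fix j
    have "complex_of_real ((cmod (\<Sum>k\<in>?I. a k * cis (- (?\<theta> j * real_of_int k))))\<^sup>2)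
        = (\<Sum>k\<in>?I. a k * cis (- (?\<theta> j * real_of_int k))) * cnj (\<Sum>l\<in>?I. a l * cis (- (?\<theta> j * real_of_int l)))"
      by (simp only: complex_norm_square)
    also have "\<dots> = (\<Sum>k\<in>?I. \<Sum>l\<in>?I. (a k * cis (- (?\<theta> j * real_of_int k))) * (cnj (a l) * cis (?\<theta> j * real_of_int l)))"
      by (simp add: sum_product cis_cnj)
    also have "\<dots> = (\<Sum>k\<in>?I. \<Sum>l\<in>?I. (a k * cnj (a l)) * cis (?\<theta> j * real_of_int (l - k)))"
    proof (intro sum.cong refl)
      fix k l
      have "cis (- (?\<theta> j * real_of_int k)) * cis (?\<theta> j * real_of_int l) = cis (?\<theta> j * real_of_int (l - k))"
        by (simp add: cis_mult right_diff_distrib)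
      then show "(a k * cis (- (?\<theta> j * real_of_int k))) * (cnj (a l) * cis (?\<theta> j * real_of_int l))
          = (a k * cnj (a l)) * cis (?\<theta> j * real_of_int (l - k))"
        by (metis mult.assoc mult.left_commute)
    qed
    finally show "complex_of_real ((cmod (\<Sum>k\<in>?I. a k * cis (- (?\<theta> j * real_of_int k))))\<^sup>2)
        = (\<Sum>k\<in>?I. \<Sum>l\<in>?I. (a k * cnj (a l)) * cis (?\<theta> j * real_of_int (l - k)))" .
  qed
  also have "\<dots> = (\<Sum>k\<in>?I. \<Sum>l\<in>?I. (a k * cnj (a l)) * (\<Sum>j<N. cis (?\<theta> j * real_of_int (l - k))))"
    unfolding sum_distrib_left
    by (subst sum.swap, rule sum.cong[OF refl], rule sum.swap)
  also have "\<dots> = (\<Sum>k\<in>?I. \<Sum>l\<in>?I. if l = k then of_nat N * (a k * cnj (a k)) else 0)"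
  proof (intro sum.cong refl)
    fix k l assume kl: "k \<in> ?I" "l \<in> ?I"
    show "(a k * cnj (a l)) * (\<Sum>j<N. cis (?\<theta> j * real_of_int (l - k))) = (if l = k then of_nat N * (a k * cnj (a k)) else 0)"
    proof (cases "l = k")
      case False
      have "\<not> int N dvd l - k"
      proof
        assume "int N dvd l - k"
        then have "int N \<le> \<bar>l - k\<bar>" using False by (metis dvd_imp_le_int right_minus_eq abs_of_nat)
        then show False using kl assms(1) by auto
      qed
      then have "(\<Sum>j<N. cis (?\<theta> j * real_of_int (l - k))) = 0" by (rule sum_cis_period[OF assms(2)])
      then show ?thesis using False by (simp only: mult_zero_right if_False)
    qed simp
  qed
  also have "\<dots> = (\<Sum>k\<in>?I. of_nat N * (a k * cnj (a k)))" by simp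
  also have "\<dots> = complex_of_real (real N * (\<Sum>k\<in>?I. (cmod (a k))\<^sup>2))"
    by (simp only: complex_norm_square[symmetric] of_real_mult of_real_sum of_real_of_nat_eq sum_distrib_left)
  finally show ?thesis by (simp only: of_real_eq_iff)
qed

section \<open>The Floquet transform of finitely supported functions\<close>

context weighted_periodic_tree
begin

abbreviation "L \<equiv> mlap W (\<lambda>_. 1)"

text \<open>The Floquet-Bloch transform along orbits. Translation by \<open>j\<close> multiplies it
  by \<open>cis (\<theta> * j)\<close>, so it is determined by its values at the representatives,
  which \<open>floquet\<close> records as a function on the quotient.\<close>

definition fseries :: "real \<Rightarrow> ('v \<Rightarrow> complex) \<Rightarrow> 'v \<Rightarrow> complex" where
  "fseries \<theta> f v = (\<Sum>\<^sub>\<infinity>k\<in>UNIV. f (\<phi> k v) * cis (- (\<theta> * real_of_int k)))"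

definition floquet :: "real \<Rightarrow> ('v \<Rightarrow> complex) \<Rightarrow> 'v set \<Rightarrow> complex" where
  "floquet \<theta> f A = (if A \<in> verts G then fseries \<theta> f (AV.sec A) else 0)"

text \<open>The phases of the potential \<open>\<theta> * shift\<close> on the quotient, under which
  quasi-periodic functions on the tree become functions on the quotient.\<close>

definition flux :: "real \<Rightarrow> 'e set \<Rightarrow> complex" where
  "flux \<theta> B = cis (\<theta> * real_of_int (shift B))"

lemma sec_V: "A \<in> verts G \<Longrightarrow> AV.sec A \<in> verts T" "A \<in> verts G \<Longrightarrow> AV.pr (AV.sec A) = A"
  using AV.sec G_simps by auto

lemma finite_orbit_support:
  assumes "finite {v. f v \<noteq> 0}" "v \<in> verts T"
  shows "finite {k. f (\<phi> k v) \<noteq> 0}"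
proof (rule finite_imageD)
  show "finite ((\<lambda>k. \<phi> k v) ` {k. f (\<phi> k v) \<noteq> 0})"
    by (rule finite_subset[OF _ assms(1)]) auto
  show "inj_on (\<lambda>k. \<phi> k v) {k. f (\<phi> k v) \<noteq> 0}"
    by (rule inj_onI) (rule AV.act_inj[OF assms(2)])
qed

lemma fseries_summable:
  assumes "finite {v. f v \<noteq> 0}" "v \<in> verts T"
  shows "(\<lambda>k. f (\<phi> k v) * cis (- (\<theta> * real_of_int k))) summable_on UNIV"
  by (rule finite_nonzero_values_imp_summable_on)
     (rule finite_subset[OF _ finite_orbit_support[OF assms]], auto)

lemma fseries_shift:
  assumes v: "v \<in> verts T"
  shows "fseries \<theta> f (\<phi> j v) = cis (\<theta> * real_of_int j) * fseries \<theta> f v"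
proof -
  have "fseries \<theta> f (\<phi> j v)
      = (\<Sum>\<^sub>\<infinity>k\<in>UNIV. cis (\<theta> * real_of_int j) * (f (\<phi> (k + j) v) * cis (- (\<theta> * real_of_int (k + j)))))"
    unfolding fseries_def
  proof (rule infsum_cong)
    fix k
    have "cis (- (\<theta> * real_of_int k)) = cis (\<theta> * real_of_int j) * cis (- (\<theta> * real_of_int (k + j)))"
      by (simp add: cis_mult algebra_simps)
    then show "f (\<phi> k (\<phi> j v)) * cis (- (\<theta> * real_of_int k))
        = cis (\<theta> * real_of_int j) * (f (\<phi> (k + j) v) * cis (- (\<theta> * real_of_int (k + j))))"
      using AV.act_add[OF v, of k j] by (simp add: mult_ac)
  qed
  also have "\<dots> = cis (\<theta> * real_of_int j) * (\<Sum>\<^sub>\<infinity>k\<in>UNIV. f (\<phi> (k + j) v) * cis (- (\<theta> * real_of_int (k + j))))"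
    by (rule infsum_cmult_right')
  also have "(\<Sum>\<^sub>\<infinity>k\<in>UNIV. f (\<phi> (k + j) v) * cis (- (\<theta> * real_of_int (k + j)))) = fseries \<theta> f v"
    unfolding fseries_def
    by (rule infsum_reindex_bij_betw[where f = "\<lambda>k. f (\<phi> k v) * cis (- (\<theta> * real_of_int k))"])
       (rule bij_betw_byWitness[where f' = "\<lambda>k. k - j"], auto)
  finally show ?thesis .
qed

lemma fseries_floquet:
  assumes "v \<in> verts T"
  shows "fseries \<theta> f v = cis (\<theta> * real_of_int (AV.idx v)) * floquet \<theta> f (AV.pr v)"
proof -
  have p: "AV.pr v \<in> verts G" using assms G_simps by auto
  show ?thesis using fseries_shift[OF sec_V(1)[OF p], of \<theta> f "AV.idx v"] AV.act_idx[OF assms] p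
    by (simp add: floquet_def)
qed

lemma arcs_at_act:
  assumes v: "v \<in> verts T"
  shows "bij_betw (\<psi> k) (in_arcs T v) (in_arcs T (\<phi> k v))" "bij_betw (\<psi> k) (out_arcs T v) (out_arcs T (\<phi> k v))"
  by (rule bij_betw_byWitness[where f' = "\<psi> (- k)"];
      use v AE.act_minus AE.act_minus[of _ "- k"] AE.act_in head_equivariant tail_equivariant AV.act_minus in \<open>auto simp: image_subset_iff\<close>)+

lemma L_at:
  assumes v: "v \<in> verts T"
  shows "complex_of_real (vweight W v) * L f (\<phi> k v) =
    (\<Sum>e\<in>in_arcs T v. f (\<phi> k v) - f (\<phi> k (tail T e))) + (\<Sum>e\<in>out_arcs T v. f (\<phi> k v) - f (\<phi> k (head T e)))"
proof -
  have "(\<Sum>e\<in>in_arcs T (\<phi> k v). f (\<phi> k v) - f (tail T e)) = (\<Sum>e\<in>in_arcs T v. f (\<phi> k v) - f (tail T (\<psi> k e)))"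
    "(\<Sum>e\<in>out_arcs T (\<phi> k v). f (\<phi> k v) - f (head T e)) = (\<Sum>e\<in>out_arcs T v. f (\<phi> k v) - f (head T (\<psi> k e)))"
    by (rule sum.reindex_bij_betw[symmetric], rule arcs_at_act[OF v])+
  moreover have "(\<Sum>e\<in>in_arcs T v. f (\<phi> k v) - f (tail T (\<psi> k e))) = (\<Sum>e\<in>in_arcs T v. f (\<phi> k v) - f (\<phi> k (tail T e)))"
    "(\<Sum>e\<in>out_arcs T v. f (\<phi> k v) - f (head T (\<psi> k e))) = (\<Sum>e\<in>out_arcs T v. f (\<phi> k v) - f (\<phi> k (head T e)))"
    by (rule sum.cong[OF refl]; simp add: tail_equivariant head_equivariant)+
  ultimately show ?thesis
    using weights_pos(2)[OF v] AV.act_in[OF v, of k] vweight_invariant[OF v, of k] by (simp add: mlap_def Let_def)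
qed

text \<open>The transform intertwines the Laplacian of the tree with the magnetic Laplacian of the
  quotient. Evaluated at a representative, which has position 0, a neighbour has position
  \<open>shift\<close> along an outgoing edge and minus \<open>shift\<close> along an incoming one;
  hence the phase, respectively its conjugate.\<close>

lemma floquet_L:
  assumes f: "finite {v. f v \<noteq> 0}"
  shows "floquet \<theta> (L f) A = mlap Q (flux \<theta>) (floquet \<theta> f) A"
proof (cases "A \<in> verts G")
  case True
  define s where "s = AV.sec A"
  have s: "s \<in> verts T" "AV.pr s = A" "AV.idx s = 0"
    using sec_V[OF True] AV.idx_sec True G_simps by (auto simp: s_def)
  define c where "c k = cis (- (\<theta> * real_of_int k))" for k
  have fin: "finite (in_arcs T s)" "finite (out_arcs T s)" by (rule finite_arcs_at[OF s(1)])+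
  have sv: "(\<lambda>k. f (\<phi> k u) * c k) summable_on UNIV" if "u \<in> verts T" for u
    unfolding c_def by (rule fseries_summable[OF f that])
  have sd: "(\<lambda>k. f (\<phi> k s) * c k - f (\<phi> k u) * c k) summable_on UNIV" if "u \<in> verts T" for u
    using summable_on_add[OF sv[OF s(1)] summable_on_uminus[THEN iffD2, OF sv[OF that]]] by simp
  have id: "(\<Sum>\<^sub>\<infinity>k\<in>UNIV. f (\<phi> k s) * c k - f (\<phi> k u) * c k) = fseries \<theta> f s - fseries \<theta> f u" if "u \<in> verts T" for u
    using infsum_add[OF sv[OF s(1)] summable_on_uminus[THEN iffD2, OF sv[OF that]]]
    by (simp add: infsum_uminus fseries_def c_def)
  have ti: "tail T e \<in> verts T" if "e \<in> in_arcs T s" for e using that endsT by auto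
  have ho: "head T e \<in> verts T" if "e \<in> out_arcs T s" for e using that endsT by auto
  have "complex_of_real (vweight W s) * fseries \<theta> (L f) s
      = (\<Sum>\<^sub>\<infinity>k\<in>UNIV. complex_of_real (vweight W s) * L f (\<phi> k s) * c k)"
    unfolding fseries_def c_def infsum_cmult_right'[symmetric] by (simp add: mult.assoc)
  also have "\<dots> = (\<Sum>\<^sub>\<infinity>k\<in>UNIV. (\<Sum>e\<in>in_arcs T s. f (\<phi> k s) * c k - f (\<phi> k (tail T e)) * c k) +
      (\<Sum>e\<in>out_arcs T s. f (\<phi> k s) * c k - f (\<phi> k (head T e)) * c k))"
    unfolding L_at[OF s(1)] by (simp add: distrib_right sum_distrib_right left_diff_distrib)
  also have "\<dots> = (\<Sum>\<^sub>\<infinity>k\<in>UNIV. \<Sum>e\<in>in_arcs T s. f (\<phi> k s) * c k - f (\<phi> k (tail T e)) * c k) +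
      (\<Sum>\<^sub>\<infinity>k\<in>UNIV. \<Sum>e\<in>out_arcs T s. f (\<phi> k s) * c k - f (\<phi> k (head T e)) * c k)"
    by (rule infsum_add; rule infsum_sum(2)[OF fin(1)] infsum_sum(2)[OF fin(2)]; rule sd; rule ti ho; assumption)
  also have "(\<Sum>\<^sub>\<infinity>k\<in>UNIV. \<Sum>e\<in>in_arcs T s. f (\<phi> k s) * c k - f (\<phi> k (tail T e)) * c k)
      = (\<Sum>e\<in>in_arcs T s. fseries \<theta> f s - fseries \<theta> f (tail T e))"
    by (subst infsum_sum(1)[OF fin(1) sd[OF ti]]) (auto simp: id ti)
  also have "(\<Sum>\<^sub>\<infinity>k\<in>UNIV. \<Sum>e\<in>out_arcs T s. f (\<phi> k s) * c k - f (\<phi> k (head T e)) * c k)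
      = (\<Sum>e\<in>out_arcs T s. fseries \<theta> f s - fseries \<theta> f (head T e))"
    by (subst infsum_sum(1)[OF fin(2) sd[OF ho]]) (auto simp: id ho)
  finally have 1: "complex_of_real (vweight W s) * fseries \<theta> (L f) s =
      (\<Sum>e\<in>in_arcs T s. fseries \<theta> f s - fseries \<theta> f (tail T e)) + (\<Sum>e\<in>out_arcs T s. fseries \<theta> f s - fseries \<theta> f (head T e))" .
  have fs: "fseries \<theta> f s = floquet \<theta> f A" using True by (simp add: floquet_def s_def)
  have i: "fseries \<theta> f s - fseries \<theta> f (tail T e)
      = floquet \<theta> f A - cnj (flux \<theta> (AE.pr e)) * floquet \<theta> f (tail G (AE.pr e))" if "e \<in> in_arcs T s" for e
    using that fseries_floquet[OF ti[OF that]] G_ends[of e] s(3) shift_pr[of e] by (simp add: fs flux_def cis_cnj)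
  have o: "fseries \<theta> f s - fseries \<theta> f (head T e)
      = floquet \<theta> f A - flux \<theta> (AE.pr e) * floquet \<theta> f (head G (AE.pr e))" if "e \<in> out_arcs T s" for e
    using that fseries_floquet[OF ho[OF that]] G_ends[of e] s(3) shift_pr[of e] by (simp add: fs flux_def)
  have "(\<Sum>e\<in>in_arcs T s. fseries \<theta> f s - fseries \<theta> f (tail T e))
      = (\<Sum>B\<in>in_arcs G A. floquet \<theta> f A - cnj (flux \<theta> B) * floquet \<theta> f (tail G B))"
    using sum.reindex_bij_betw[OF arcs_at_bij(1)[OF s(1)], of "\<lambda>B. floquet \<theta> f A - cnj (flux \<theta> B) * floquet \<theta> f (tail G B)"]
    by (simp only: s(2)) (metis (no_types, lifting) i sum.cong)
  moreover have "(\<Sum>e\<in>out_arcs T s. fseries \<theta> f s - fseries \<theta> f (head T e))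
      = (\<Sum>B\<in>out_arcs G A. floquet \<theta> f A - flux \<theta> B * floquet \<theta> f (head G B))"
    using sum.reindex_bij_betw[OF arcs_at_bij(2)[OF s(1)], of "\<lambda>B. floquet \<theta> f A - flux \<theta> B * floquet \<theta> f (head G B)"]
    by (simp only: s(2)) (metis (no_types, lifting) o sum.cong)
  ultimately have "complex_of_real (vweight W s) * floquet \<theta> (L f) A
      = complex_of_real (vweight W s) * mlap Q (flux \<theta>) (floquet \<theta> f) A"
    using 1 True weights_pos(2)[OF s(1)] weight_G(1)[OF s(1)] unfolding s(2)
    by (simp add: mlap_def Let_def floquet_def s_def)
  then show ?thesis using weights_pos(2)[OF s(1)] by simp
qed (simp add: floquet_def mlap_def)

lemma floquet_H: "floquet \<theta> f \<in> WQ.H"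
  by (rule WQ.H_finite) (simp add: floquet_def)

lemma floquet_diff:
  assumes f: "finite {v. f v \<noteq> 0}" and g: "finite {v. g v \<noteq> 0}"
  shows "floquet \<theta> (\<lambda>v. f v - c * g v) A = floquet \<theta> f A - c * floquet \<theta> g A"
proof (cases "A \<in> verts G")
  case True
  note s = sec_V(1)[OF True]
  have "fseries \<theta> (\<lambda>v. f v - c * g v) (AV.sec A)
      = (\<Sum>\<^sub>\<infinity>k\<in>UNIV. f (\<phi> k (AV.sec A)) * cis (- (\<theta> * real_of_int k))
          + (- c) * (g (\<phi> k (AV.sec A)) * cis (- (\<theta> * real_of_int k))))"
    unfolding fseries_def by (rule infsum_cong) (simp add: algebra_simps)
  also have "\<dots> = fseries \<theta> f (AV.sec A) + (- c) * fseries \<theta> g (AV.sec A)"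
    unfolding fseries_def infsum_cmult_right'[symmetric]
    by (rule infsum_add[OF fseries_summable[OF f s] summable_on_cmult_right[OF fseries_summable[OF g s]]])
  finally show ?thesis using True by (simp add: floquet_def)
qed (simp add: floquet_def)

text \<open>Each orbit is a copy of the integers on which the vertex weight is constant, so the
  finite Parseval identity is applied orbit by orbit.\<close>

lemma floquet_Parseval:
  fixes M :: int
  assumes f: "\<And>v. v \<notin> verts T \<Longrightarrow> f v = 0" "\<And>v. v \<in> verts T \<Longrightarrow> f v \<noteq> 0 \<Longrightarrow> \<bar>AV.idx v\<bar> \<le> M"
    and N: "2 * M < int N" "N > 0"
  shows "(\<Sum>j<N. (WQ.V.N (floquet (2 * pi * real j / real N) f))\<^sup>2) = real N * (WT.V.N f)\<^sup>2"
proof -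
  let ?I = "{-M..M}"
  have zero: "f (\<phi> k (AV.sec A)) = 0" if "A \<in> verts G" "k \<notin> ?I" for A k
  proof (rule ccontr)
    assume "f (\<phi> k (AV.sec A)) \<noteq> 0"
    then have "\<bar>AV.idx (\<phi> k (AV.sec A))\<bar> \<le> M" using f(2) AV.act_in sec_V that by blast
    then show False using that AV.idx_act[OF sec_V(1)[OF that(1)]] AV.idx_sec G_simps by auto
  qed
  have fl: "floquet \<theta> f A = (\<Sum>k\<in>?I. f (\<phi> k (AV.sec A)) * cis (- (\<theta> * real_of_int k)))" if "A \<in> verts G" for A \<theta>
  proof -
    have "fseries \<theta> f (AV.sec A) = (\<Sum>\<^sub>\<infinity>k\<in>?I. f (\<phi> k (AV.sec A)) * cis (- (\<theta> * real_of_int k)))"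
      unfolding fseries_def by (rule infsum_cong_neutral) (use zero[OF that] in auto)
    then show ?thesis using that by (simp add: floquet_def)
  qed
  have "(\<Sum>j<N. (WQ.V.N (floquet (2 * pi * real j / real N) f))\<^sup>2)
      = (\<Sum>j<N. \<Sum>A\<in>verts G. (cmod (\<Sum>k\<in>?I. f (\<phi> k (AV.sec A)) * cis (- (2 * pi * real j / real N * real_of_int k))))\<^sup>2 * vweight Q A)"
    unfolding WQ.N_finite by (intro sum.cong refl) (simp only: fl)
  also have "\<dots> = (\<Sum>A\<in>verts G. (\<Sum>j<N. (cmod (\<Sum>k\<in>?I. f (\<phi> k (AV.sec A)) * cis (- (2 * pi * real j / real N * real_of_int k))))\<^sup>2) * vweight Q A)"
    unfolding sum_distrib_right by (rule sum.swap)
  also have "\<dots> = (\<Sum>A\<in>verts G. (real N * (\<Sum>k\<in>?I. (cmod (f (\<phi> k (AV.sec A))))\<^sup>2)) * vweight Q A)"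
    unfolding Parseval_DFT[OF N] ..
  also have "\<dots> = real N * (\<Sum>A\<in>verts G. \<Sum>k\<in>?I. (cmod (f (\<phi> k (AV.sec A))))\<^sup>2 * vweight Q A)"
    by (simp add: sum_distrib_left sum_distrib_right mult.assoc)
  also have "(\<Sum>A\<in>verts G. \<Sum>k\<in>?I. (cmod (f (\<phi> k (AV.sec A))))\<^sup>2 * vweight Q A) = (WT.V.N f)\<^sup>2"
  proof -
    let ?K = "(\<lambda>(A, k). \<phi> k (AV.sec A)) ` (verts G \<times> ?I)"
    have KT: "?K \<subseteq> verts T" using AV.act_in sec_V by auto
    have inj: "inj_on (\<lambda>(A, k). \<phi> k (AV.sec A)) (verts G \<times> ?I)"
    proof (rule inj_onI, clarify)
      fix A k A' k' assume *: "A \<in> verts G" "A' \<in> verts G" "\<phi> k (AV.sec A) = \<phi> k' (AV.sec A')"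
      then have "A = A'" using AV.pr_act sec_V by metis
      then show "A = A' \<and> k = k'" using * AV.act_inj sec_V by blast
    qed
    have out: "f v = 0" if "v \<in> verts T" "v \<notin> ?K" for v
    proof (rule ccontr)
      assume "f v \<noteq> 0"
      then have "\<bar>AV.idx v\<bar> \<le> M" using f(2) that by blast
      then have "v \<in> ?K" using AV.act_idx[OF that(1)] that(1) G_simps
        by (intro image_eqI[of _ _ "(AV.pr v, AV.idx v)"]) auto
      then show False using that by blast
    qed
    have "(WT.V.N f)\<^sup>2 = (\<Sum>\<^sub>\<infinity>v\<in>?K. (cmod (f v))\<^sup>2 * vweight W v)"
      unfolding WT.V.N_sq by (rule infsum_cong_neutral) (use KT out in auto)
    also have "\<dots> = (\<Sum>v\<in>?K. (cmod (f v))\<^sup>2 * vweight W v)"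
      by (rule infsum_finite) (use WQ.finite_V in simp)
    also have "\<dots> = (\<Sum>(A, k)\<in>verts G \<times> ?I. (cmod (f (\<phi> k (AV.sec A))))\<^sup>2 * vweight W (\<phi> k (AV.sec A)))"
      by (subst sum.reindex[OF inj]) (simp add: case_prod_unfold)
    also have "\<dots> = (\<Sum>A\<in>verts G. \<Sum>k\<in>?I. (cmod (f (\<phi> k (AV.sec A))))\<^sup>2 * vweight W (\<phi> k (AV.sec A)))"
      by (rule sum.cartesian_product[symmetric])
    also have "\<dots> = (\<Sum>A\<in>verts G. \<Sum>k\<in>?I. (cmod (f (\<phi> k (AV.sec A))))\<^sup>2 * vweight Q A)"
    proof (intro sum.cong refl)
      fix A k assume A: "A \<in> verts G"
      have "vweight Q A = vweight W (\<phi> k (AV.sec A))"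
        using weight_G(1)[OF sec_V(1)[OF A]] sec_V(2)[OF A] vweight_invariant[OF sec_V(1)[OF A]] by simp
      then show "(cmod (f (\<phi> k (AV.sec A))))\<^sup>2 * vweight W (\<phi> k (AV.sec A)) = (cmod (f (\<phi> k (AV.sec A))))\<^sup>2 * vweight Q A"
        by simp
    qed
    finally show ?thesis by simp
  qed
  finally show ?thesis .
qed

lemma finite_support_L:
  assumes f: "finite {v. f v \<noteq> 0}"
  shows "finite {v. L f v \<noteq> 0}"
proof -
  let ?K = "{v \<in> verts T. f v \<noteq> 0}"
  let ?S = "?K \<union> (\<Union>v\<in>?K. head T ` out_arcs T v \<union> tail T ` in_arcs T v)"
  have "L f v = 0" if "v \<notin> ?S" for v
  proof (cases "v \<in> verts T")
    case True
    then have fv: "f v = 0" using that by auto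
    have "f (tail T e) = 0" if "e \<in> in_arcs T v" for e
      using that \<open>v \<notin> ?S\<close> endsT by force
    moreover have "f (head T e) = 0" if "e \<in> out_arcs T v" for e
      using that \<open>v \<notin> ?S\<close> endsT by force
    ultimately show ?thesis using fv by (simp add: mlap_def Let_def)
  qed (simp add: mlap_def)
  moreover have "finite ?S" using f finite_arcs_at by (auto intro: finite_subset[OF _ f])
  ultimately show ?thesis by (metis (mono_tags, lifting) finite_subset mem_Collect_eq subsetI)
qed

text \<open>
  Averaging over the \<open>N\<close>-th roots of unity, which by Parseval preserves norms of functions
  supported in fewer than \<open>N\<close> translates, replaces the direct integral of Floquet theory.
\<close>

lemma floquet_approximate_eigenvector:
  assumes f: "f \<in> WT.H" "finite {v. f v \<noteq> 0}"
    and less: "WT.V.N (residual W (\<lambda>_. 1) t f) < \<epsilon> * WT.V.N f"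
  shows "\<exists>\<theta> F. F \<in> WQ.H \<and> WQ.V.N F = 1 \<and> WQ.V.N (residual Q (flux \<theta>) t F) < \<epsilon>"
proof -
  let ?g = "residual W (\<lambda>_. 1) t f"
  have fg: "finite {v. ?g v \<noteq> 0}"
    by (rule finite_subset[of _ "{v. L f v \<noteq> 0} \<union> {v. f v \<noteq> 0}"]) (use f finite_support_L in auto)
  \<comment> \<open>Bounds the positions in the supports of both \<open>f\<close> and its residual,
    so that one \<open>N\<close> serves both Parseval identities.\<close>
  define M where "M = (\<Sum>v\<in>{v. f v \<noteq> 0} \<union> {v. ?g v \<noteq> 0}. \<bar>AV.idx v\<bar>)"
  have M: "\<bar>AV.idx v\<bar> \<le> M" if "f v \<noteq> 0 \<or> ?g v \<noteq> 0" for v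
    unfolding M_def by (rule member_le_sum) (use that f fg in auto)
  have M0: "M \<ge> 0" by (auto simp: M_def sum_nonneg)
  define N where "N = nat (2 * M + 1)"
  have N: "2 * M < int N" "N > 0" using M0 by (auto simp: N_def)
  define \<theta> where "\<theta> j = 2 * pi * real j / real N" for j
  have fT: "f v = 0" if "v \<notin> verts T" for v using f(1) that by (rule WT.V.ell2_vanish)
  have Pf: "(\<Sum>j<N. (WQ.V.N (floquet (\<theta> j) f))\<^sup>2) = real N * (WT.V.N f)\<^sup>2"
    unfolding \<theta>_def by (rule floquet_Parseval[OF fT _ N]) (assumption, rule M, blast)
  have gT: "?g v = 0" if "v \<notin> verts T" for v using fT that by (simp add: mlap_def)
  have Pg: "(\<Sum>j<N. (WQ.V.N (floquet (\<theta> j) ?g))\<^sup>2) = real N * (WT.V.N ?g)\<^sup>2"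
    unfolding \<theta>_def by (rule floquet_Parseval[OF gT _ N]) (assumption, rule M, blast)
  have pos: "\<epsilon> * WT.V.N f > 0" using less WT.V.N_nonneg[of ?g] by linarith
  then have e: "\<epsilon> > 0" using WT.V.N_nonneg[of f] by (auto simp: zero_less_mult_iff)
  \<comment> \<open>Averaging: if the estimate failed at all the roots of unity, summing over them
    would, by Parseval, contradict \<open>less\<close>.\<close>
  have "\<exists>j<N. (WQ.V.N (floquet (\<theta> j) ?g))\<^sup>2 < \<epsilon>\<^sup>2 * (WQ.V.N (floquet (\<theta> j) f))\<^sup>2"
  proof (rule ccontr)
    assume "\<not> ?thesis"
    then have "\<epsilon>\<^sup>2 * (WQ.V.N (floquet (\<theta> j) f))\<^sup>2 \<le> (WQ.V.N (floquet (\<theta> j) ?g))\<^sup>2" if "j < N" for j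
      using that linorder_not_less by blast
    then have "\<epsilon>\<^sup>2 * (\<Sum>j<N. (WQ.V.N (floquet (\<theta> j) f))\<^sup>2) \<le> (\<Sum>j<N. (WQ.V.N (floquet (\<theta> j) ?g))\<^sup>2)"
      unfolding sum_distrib_left by (intro sum_mono) simp
    then have "real N * (\<epsilon> * WT.V.N f)\<^sup>2 \<le> real N * (WT.V.N ?g)\<^sup>2"
      unfolding Pf Pg by (simp add: power_mult_distrib mult_ac)
    then have "(\<epsilon> * WT.V.N f)\<^sup>2 \<le> (WT.V.N ?g)\<^sup>2" using N by simp
    then have "\<epsilon> * WT.V.N f \<le> WT.V.N ?g" by (rule power2_le_imp_le) simp
    then show False using less by simp
  qed
  then obtain j where j: "(WQ.V.N (floquet (\<theta> j) ?g))\<^sup>2 < \<epsilon>\<^sup>2 * (WQ.V.N (floquet (\<theta> j) f))\<^sup>2" by blast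
  define h where "h = floquet (\<theta> j) f"
  have hH: "h \<in> WQ.H" unfolding h_def by (rule floquet_H)
  have res: "floquet (\<theta> j) ?g = residual Q (flux (\<theta> j)) t h"
    using floquet_diff[OF finite_support_L[OF f(2)] f(2)] floquet_L[OF f(2)] by (auto simp: h_def)
  have "(WQ.V.N (floquet (\<theta> j) ?g))\<^sup>2 < (\<epsilon> * WQ.V.N h)\<^sup>2" using j by (simp add: h_def power_mult_distrib)
  then have lt: "WQ.V.N (floquet (\<theta> j) ?g) < \<epsilon> * WQ.V.N h" by (rule power2_less_imp_less) (use e in simp)
  then have "\<epsilon> * WQ.V.N h > 0" using WQ.V.N_nonneg[of "floquet (\<theta> j) ?g"] by linarith
  then have Nh: "WQ.V.N h > 0" using e by (simp add: zero_less_mult_iff)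
  define c where "c = complex_of_real (1 / WQ.V.N h)"
  have c: "cmod c = 1 / WQ.V.N h" using Nh by (simp add: c_def norm_divide)
  have "WQ.V.N (residual Q (flux (\<theta> j)) t (\<lambda>A. c * h A))
      = WQ.V.N (floquet (\<theta> j) ?g) / WQ.V.N h"
    unfolding residual_scale res
    using WQ.V.ell2_scale(2)[OF floquet_H, of c "\<theta> j" ?g, unfolded res] c by simp
  also have "\<dots> < \<epsilon>" using lt Nh by (simp add: pos_divide_less_eq)
  finally have "WQ.V.N (residual Q (flux (\<theta> j)) t (\<lambda>A. c * h A)) < \<epsilon>" .
  moreover have "(\<lambda>A. c * h A) \<in> WQ.H" "WQ.V.N (\<lambda>A. c * h A) = 1"
    using WQ.V.ell2_scale[OF hH, of c] c Nh by auto
  ultimately show ?thesis by blast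
qed

text \<open>Boundedness of the Laplacian lets an approximate eigenfunction on the tree be cut off to
  finite support, which Floquet averaging requires. The resulting fluxes depend on the precision,
  and compactness extracts a limiting potential.\<close>

lemma spectrum_subset_magnetic:
  assumes t: "complex_of_real t \<in> laplacian_spectrum W"
  shows "complex_of_real t \<in> (\<Union>\<alpha>. magnetic_spectrum Q \<alpha>)"
proof -
  have ex: "\<exists>\<theta> F. F \<in> WQ.H \<and> WQ.V.N F = 1 \<and>
      WQ.V.N (residual Q (flux \<theta>) t F) < \<epsilon>" if e: "\<epsilon> > 0" for \<epsilon>
  proof -
    let ?T = "residual W (\<lambda>_. 1) t"
    have "\<forall>\<epsilon>>0. \<exists>f\<in>WT.H. WT.V.N f = 1 \<and> WT.V.N (?T f) < \<epsilon>"
      using t unfolding laplacian_spectrum_def WT.real_spectrum_iff by simp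
    moreover have "\<epsilon> / 4 > 0" using e by simp
    ultimately have "\<exists>f\<in>WT.H. WT.V.N f = 1 \<and> WT.V.N (?T f) < \<epsilon> / 4" by blast
    then obtain f where f: "f \<in> WT.H" "WT.V.N f = 1" "WT.V.N (?T f) < \<epsilon> / 4" by blast
    define K where "K = 2 * \<rho> + \<bar>t\<bar> + 1"
    have K: "K > 0" using rho_pos by (simp add: K_def)
    \<comment> \<open>The bound 1/2 keeps the norm of the truncation at least 1/2. The bound
      \<open>\<epsilon> / (4 * K)\<close>, with \<open>K\<close> bounding the operator
      \<open>?T\<close>, keeps the residual of the discarded part at most a quarter of
      \<open>\<epsilon>\<close>.\<close>
    define \<delta> where "\<delta> = min (1 / 2) (\<epsilon> / (4 * K))"
    have d: "\<delta> > 0" "\<delta> \<le> 1 / 2" "\<delta> \<le> \<epsilon> / (4 * K)" using e K by (auto simp: \<delta>_def)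
    obtain F where F: "finite F" "F \<subseteq> verts T" "WT.V.N (\<lambda>x. if x \<in> F then 0 else f x) < \<delta>"
      by (rule WT.V.ell2_finite_approximation[OF f(1) d(1)])
    define r where "r x = (if x \<in> F then 0 else f x)" for x
    define f' where "f' x = f x - r x" for x
    have fin: "finite {v. f' v \<noteq> 0}" by (rule finite_subset[OF _ F(1)]) (auto simp: f'_def r_def)
    have f'H: "f' \<in> WT.H" by (rule WT.V.ell2_finite_support[OF _ F(1,2)]) (auto simp: f'_def r_def)
    have rH: "r \<in> WT.H" using WT.V.ell2_diff(1)[OF f(1) f'H] by (simp add: f'_def)
    have Nr: "WT.V.N r < \<delta>" using F(3) unfolding r_def .
    have "WT.V.N f \<le> WT.V.N f' + WT.V.N r"
      using WT.V.ell2_add(2)[OF f'H rH] by (simp add: f'_def)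
    then have half: "WT.V.N f' \<ge> 1 / 2" using Nr d f(2) by linarith
    note Lf = WT.L_in_H[where \<alpha> = "\<lambda>_. 0", simplified] WT.L_bounded[where \<alpha> = "\<lambda>_. 0", simplified]
      WT.L_lin[where \<alpha> = "\<lambda>_. 0", simplified]
    have TH: "?T g \<in> WT.H" if "g \<in> WT.H" for g
      using that by (intro WT.V.ell2_diff WT.V.ell2_scale Lf)
    have "?T f' = (\<lambda>v. ?T f v - ?T r v)"
      unfolding f'_def[abs_def] Lf(3) by (simp add: algebra_simps)
    then have "WT.V.N (?T f') \<le> WT.V.N (?T f) + WT.V.N (?T r)"
      using WT.V.ell2_diff(2)[OF TH[OF f(1)] TH[OF rH]] by simp
    also have "WT.V.N (?T r) \<le> WT.V.N (L r) + WT.V.N (\<lambda>v. complex_of_real t * r v)"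
      using rH by (intro WT.V.ell2_diff Lf WT.V.ell2_scale)
    also have "\<dots> \<le> 2 * \<rho> * WT.V.N r + \<bar>t\<bar> * WT.V.N r"
      using Lf(2)[OF rH] WT.V.ell2_scale(2)[OF rH, of "complex_of_real t"] by simp
    also have "\<dots> \<le> K * WT.V.N r" by (simp add: K_def algebra_simps)
    also have "\<dots> \<le> K * (\<epsilon> / (4 * K))" using Nr d K by (intro mult_left_mono) auto
    also have "\<dots> = \<epsilon> / 4" using K by simp
    finally have "WT.V.N (?T f') < \<epsilon> / 2" using f(3) by simp
    also have "\<dots> \<le> \<epsilon> * WT.V.N f'" using half e mult_left_mono[OF half, of \<epsilon>] by simp
    finally show ?thesis by (rule floquet_approximate_eigenvector[OF f'H fin])
  qed
  define P where "P k \<theta> F \<longleftrightarrow> F \<in> WQ.H \<and> WQ.V.N F = 1 \<and>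
      WQ.V.N (residual Q (flux \<theta>) t F) < 1 / real (Suc k)" for k \<theta> F
  have "\<exists>\<theta> F. P k \<theta> F" for k unfolding P_def by (rule ex) simp
  then obtain \<theta> F where "\<And>k. P k (\<theta> k) (F k)" by metis
  then have F: "\<And>k. F k \<in> WQ.H" "\<And>k. WQ.V.N (F k) = 1"
    "\<And>k. WQ.V.N (residual Q (flux (\<theta> k)) t (F k)) < 1 / real (Suc k)"
    unfolding P_def by blast+
  have res: "(\<lambda>k. WQ.V.N (residual Q (flux (\<theta> k)) t (F k))) \<longlonglongrightarrow> 0"
    by (rule tendsto_sandwich[OF _ _ tendsto_const lim_inverse_n'[THEN LIMSEQ_Suc]])
       (use F(3) in \<open>auto intro!: always_eventually less_imp_le\<close>)
  have u: "cmod (flux (\<theta> k) e) = 1" for k e by (simp add: flux_def)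
  show ?thesis unfolding WQ.in_magnetic_spectra_iff
    by (rule WQ.approximate_eigenvector_limit[OF u F(1,2) tendsto_const res]) blast
qed

end

section \<open>The lattice\<close>

context weighted_periodic_tree
begin

text \<open>Truncations of the generalized eigenfunction \<open>n \<mapsto> e\<^sup>i\<^sup>\<theta>\<^sup>n\<close> have a residual supported at four vertices.\<close>

lemma spectrum_lattice:
  assumes iso: "undirected_iso T lattice_Z" and t: "0 \<le> t" "t \<le> 2 * \<rho>"
  shows "complex_of_real t \<in> laplacian_spectrum W"
proof -
  obtain h :: "'v \<Rightarrow> int" and k :: "'e \<Rightarrow> int" where h: "bij_betw h (verts T) UNIV" and k: "bij_betw k (arcs T) UNIV"
    and hk: "\<forall>e\<in>arcs T. {k e, k e + 1} = {h (tail T e), h (head T e)}"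
    using iso unfolding undirected_iso_def lattice_Z_def pre_digraph.simps by blast
  \<comment> \<open>Coordinates on the tree: \<open>x i\<close> is the vertex at position
    \<open>i\<close>, and \<open>a i\<close> the edge between positions \<open>i\<close> and
    \<open>i + 1\<close>, with unknown orientation.\<close>
  define x where "x i = the_inv_into (verts T) h i" for i :: int
  define a where "a i = the_inv_into (arcs T) k i" for i :: int
  have x: "x i \<in> verts T" "h (x i) = i" for i
    using h unfolding x_def bij_betw_def by (auto simp: the_inv_into_into f_the_inv_into_f)
  have xh: "x (h v) = v" if "v \<in> verts T" for v
    using h that unfolding x_def bij_betw_def by (simp add: the_inv_into_f_f)
  have a: "a i \<in> arcs T" "k (a i) = i" for i
    using k unfolding a_def bij_betw_def by (auto simp: the_inv_into_into f_the_inv_into_f)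
  have ak: "a (k e) = e" if "e \<in> arcs T" for e
    using k that unfolding a_def bij_betw_def by (simp add: the_inv_into_f_f)
  have x_inj: "x i = x j \<longleftrightarrow> i = j" for i j using x(2) by metis
  have a_inj: "a i = a j \<longleftrightarrow> i = j" for i j using a(2) by metis
  have ends: "(tail T (a i) = x i \<and> head T (a i) = x (i + 1)) \<or> (tail T (a i) = x (i + 1) \<and> head T (a i) = x i)" for i
  proof -
    have "{i, i + 1} = {h (tail T (a i)), h (head T (a i))}" using bspec[OF hk a(1)[of i]] a(2) by simp
    then show ?thesis using xh endsT[OF a(1)[of i]] by (metis doubleton_eq_iff)
  qed
  have at: "in_arcs T (x i) = {e \<in> {a i, a (i - 1)}. head T e = x i}"
    "out_arcs T (x i) = {e \<in> {a i, a (i - 1)}. tail T e = x i}" for i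
  proof -
    have *: "e = a i \<or> e = a (i - 1)" if e: "e \<in> arcs T" "head T e = x i \<or> tail T e = x i" for e
    proof -
      have "x (k e) = x i \<or> x (k e + 1) = x i" using ends[of "k e"] ak[OF e(1)] e(2) by auto
      then have "k e = i \<or> k e = i - 1" using x_inj by auto
      then show ?thesis using ak[OF e(1)] by auto
    qed
    show "in_arcs T (x i) = {e \<in> {a i, a (i - 1)}. head T e = x i}"
      "out_arcs T (x i) = {e \<in> {a i, a (i - 1)}. tail T e = x i}"
      unfolding in_arcs_def out_arcs_def using * a(1) by blast+
  qed
  \<comment> \<open>Whatever the orientations of \<open>a i\<close> and \<open>a (i - 1)\<close>,
    each of them contributes its far end exactly once.\<close>
  have nbr_sum: "(\<Sum>e\<in>in_arcs T (x i). F (tail T e)) + (\<Sum>e\<in>out_arcs T (x i). F (head T e)) = F (x (i + 1)) + F (x (i - 1))"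
    for F :: "'v \<Rightarrow> complex" and i
  proof -
    have ne: "a i \<noteq> a (i - 1)" by (simp add: a_inj)
    have "(\<Sum>e\<in>in_arcs T (x i). F (tail T e)) + (\<Sum>e\<in>out_arcs T (x i). F (head T e))
        = (\<Sum>e\<in>{a i, a (i - 1)}. (if head T e = x i then F (tail T e) else 0) + (if tail T e = x i then F (head T e) else 0))"
      unfolding at sum.distrib by (simp only: sum.inter_filter finite.insertI finite.emptyI)
    also have "\<dots> = F (x (i + 1)) + F (x (i - 1))"
      using ne ends[of i] ends[of "i - 1"] x_inj[of i "i + 1"] x_inj[of i "i - 1"] by auto
    finally show ?thesis .
  qed
  have deg: "degree T v = 2" if "v \<in> verts T" for v
  proof -
    have "complex_of_real (real (degree T v)) = complex_of_real 2"
      using nbr_sum[of "\<lambda>_. 1" "h v"] xh[OF that]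
      by (simp add: degree_def in_degree_def out_degree_def)
    then show ?thesis by (simp only: of_real_eq_iff)
  qed
  \<comment> \<open>All degrees are 2, so the vertex weight is constant: 2 for standard and 1 for
    combinatorial weights.\<close>
  obtain \<mu> where m: "\<And>v. v \<in> verts T \<Longrightarrow> vweight W v = \<mu>"
    using weights deg unfolding standard_weights_def combinatorial_weights_def by (metis of_nat_numeral)
  have \<mu>: "\<mu> > 0" using weights_pos(2)[OF x(1)] m[OF x(1)] by simp
  have rho: "\<rho> = 2 / \<mu>"
  proof -
    have "rel_weight W ` verts T = {2 / \<mu>}"
      using verts_T_ne rel_weight_eq(1) deg m by (auto simp: image_iff)
    then show ?thesis unfolding \<rho>_def rho_inf_def by simp
  qed
  have Lx: "L f (x i) = (2 * f (x i) - f (x (i + 1)) - f (x (i - 1))) / complex_of_real \<mu>" for f i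
  proof -
    have "(\<Sum>e\<in>in_arcs T (x i). f (x i) - f (tail T e)) + (\<Sum>e\<in>out_arcs T (x i). f (x i) - f (head T e))
        = (f (x i) - f (x (i + 1))) + (f (x i) - f (x (i - 1)))"
      by (rule nbr_sum[of "\<lambda>v. f (x i) - f v"])
    then show ?thesis using x(1) m[OF x(1)] by (simp add: mlap_def Let_def algebra_simps)
  qed
  \<comment> \<open>Solves the dispersion relation
    \<open>(2 - 2 * cos \<theta>) / \<mu> = t\<close>. Since \<open>2 * \<rho> = 4 / \<mu>\<close>,
    the range of \<open>t\<close> is exactly what keeps the argument of \<open>arccos\<close>
    between -1 and 1.\<close>
  define \<theta> where "\<theta> = arccos (1 - t * \<mu> / 2)"
  have "t * \<mu> \<le> 4" using mult_right_mono[OF t(2), of \<mu>] \<mu> by (simp add: rho)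
  then have cos: "cos \<theta> = 1 - t * \<mu> / 2" unfolding \<theta>_def using t \<mu> by (intro cos_arccos) auto
  define f where "f n v = (if v \<in> verts T \<and> 0 \<le> h v \<and> h v < int n then cis (\<theta> * real_of_int (h v)) else 0)" for n v
  define g where "g n v = L (f n) v - complex_of_real t * f n v" for n v
  have fx: "f n (x i) = (if 0 \<le> i \<and> i < int n then cis (\<theta> * real_of_int i) else 0)" for n i
    using x by (simp add: f_def)
  have inf_sum: "(WT.V.N u)\<^sup>2 = (\<Sum>i\<in>J. (cmod (u (x i)))\<^sup>2 * \<mu>)"
    if "finite J" "\<And>i. i \<notin> J \<Longrightarrow> u (x i) = 0" for u and J :: "int set"
  proof -
    have "(WT.V.N u)\<^sup>2 = (\<Sum>\<^sub>\<infinity>v\<in>x ` J. (cmod (u v))\<^sup>2 * vweight W v)"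
      unfolding WT.V.N_sq
    proof (rule infsum_cong_neutral)
      fix v assume v: "v \<in> verts T - x ` J"
      then have "h v \<notin> J" using xh[of v] by (metis DiffD1 DiffD2 imageI)
      then have "u v = 0" using that(2)[of "h v"] xh[of v] v by simp
      then show "(cmod (u v))\<^sup>2 * vweight W v = 0" by simp
    qed (use x in auto)
    also have "\<dots> = (\<Sum>v\<in>x ` J. (cmod (u v))\<^sup>2 * vweight W v)" using that(1) by simp
    also have "\<dots> = (\<Sum>i\<in>J. (cmod (u (x i)))\<^sup>2 * \<mu>)"
      by (subst sum.reindex) (use x_inj m[OF x(1)] in \<open>auto simp: inj_on_def\<close>)
    finally show ?thesis .
  qed
  have fH: "f n \<in> WT.H" for n
  proof (rule WT.V.ell2_finite_support[of "x ` {0..<int n}"])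
    fix v assume v: "v \<notin> x ` {0..<int n}"
    show "f n v = 0"
    proof (rule ccontr)
      assume "f n v \<noteq> 0"
      then have "v \<in> verts T" "h v \<in> {0..<int n}" by (auto simp: f_def split: if_splits)
      then have "v \<in> x ` {0..<int n}" using xh[of v] by (metis imageI)
      then show False using v by simp
    qed
  qed (use x in auto)
  have Nf: "(WT.V.N (f n))\<^sup>2 = real n * \<mu>" for n
    by (subst inf_sum[of "{0..<int n}"]) (auto simp: fx)
  define C where "C = 4 / \<mu> + t"
  have f1: "cmod (f n v) \<le> 1" for n v by (simp add: f_def)
  have gC: "cmod (g n (x i)) \<le> C" for n i
  proof -
    have "cmod (2 * f n (x i) - f n (x (i + 1)) - f n (x (i - 1))) \<le>
        cmod (2 * f n (x i)) + cmod (f n (x (i + 1))) + cmod (f n (x (i - 1)))"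
      using norm_triangle_ineq4[of "2 * f n (x i) - f n (x (i + 1))" "f n (x (i - 1))"]
        norm_triangle_ineq4[of "2 * f n (x i)" "f n (x (i + 1))"] by linarith
    also have "\<dots> \<le> 4" using f1[of n "x i"] f1[of n "x (i + 1)"] f1[of n "x (i - 1)"] by (simp add: norm_mult)
    finally have "cmod (L (f n) (x i)) \<le> 4 / \<mu>"
      unfolding Lx using \<mu> by (simp add: norm_divide divide_right_mono)
    moreover have "cmod (complex_of_real t * f n (x i)) \<le> t"
      using f1[of n "x i"] t by (simp add: norm_mult mult_left_le)
    ultimately show ?thesis
      unfolding g_def C_def using norm_triangle_ineq4[of "L (f n) (x i)" "complex_of_real t * f n (x i)"] by linarith
  qed
  \<comment> \<open>Inside the support the plane wave solves the equation exactly, and away from it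
    everything vanishes. What remains are the vertices next to the two cuts, including
    \<open>-1\<close> and \<open>n\<close> just outside the support.\<close>
  have g0: "g n (x i) = 0" if "i \<notin> {-1, 0, int n - 1, int n}" for n i
  proof (cases "0 < i \<and> i < int n - 1")
    case True
    let ?c = "\<lambda>i. cis (\<theta> * real_of_int i)"
    have "?c (i + 1) + ?c (i - 1) = ?c i * (cis \<theta> + cis (- \<theta>))"
      by (simp add: distrib_left cis_mult right_diff_distrib)
    also have "cis \<theta> + cis (- \<theta>) = complex_of_real (2 * cos \<theta>)" by (simp add: complex_eq_iff)
    finally have s: "?c (i + 1) + ?c (i - 1) = ?c i * complex_of_real (2 * cos \<theta>)" .
    have fi: "f n (x i) = ?c i" "f n (x (i + 1)) = ?c (i + 1)" "f n (x (i - 1)) = ?c (i - 1)"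
      using True by (simp_all add: fx)
    have "L (f n) (x i) = (2 * ?c i - (?c (i + 1) + ?c (i - 1))) / complex_of_real \<mu>"
      unfolding Lx fi by simp
    also have "\<dots> = ?c i * complex_of_real ((2 - 2 * cos \<theta>) / \<mu>)"
      unfolding s by (simp add: algebra_simps)
    also have "(2 - 2 * cos \<theta>) / \<mu> = t" unfolding cos using \<mu> by (simp add: field_simps)
    finally show ?thesis by (simp add: g_def fi)
  next
    case False
    then have "i < -1 \<or> i > int n" using that by auto
    then show ?thesis by (auto simp: g_def Lx fx)
  qed
  have Ng: "(WT.V.N (g n))\<^sup>2 \<le> 4 * C\<^sup>2 * \<mu>" for n
  proof -
    let ?J = "{-1, 0, int n - 1, int n}"
    have "(WT.V.N (g n))\<^sup>2 = (\<Sum>i\<in>?J. (cmod (g n (x i)))\<^sup>2 * \<mu>)" by (rule inf_sum) (use g0 in auto)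
    also have "\<dots> \<le> (\<Sum>i\<in>?J. C\<^sup>2 * \<mu>)"
      using gC \<mu> by (intro sum_mono mult_right_mono power_mono) auto
    also have "\<dots> = real (card ?J) * (C\<^sup>2 * \<mu>)" by (rule sum_constant)
    also have "\<dots> \<le> 4 * (C\<^sup>2 * \<mu>)"
    proof (rule mult_right_mono)
      \<comment> \<open>Only an inequality, because positions coincide for small
        \<open>n\<close>.\<close>
      show "real (card ?J) \<le> 4" using card_length[of "[-1, 0, int n - 1, int n]"] by simp
    qed (use \<mu> in simp)
    finally show ?thesis by simp
  qed
  show ?thesis
  proof (rule ccontr)
    assume "complex_of_real t \<notin> laplacian_spectrum W"
    then obtain D where D: "\<And>f. f \<in> WT.H \<Longrightarrow> WT.V.N f \<le> D * WT.V.N (\<lambda>v. L f v - complex_of_real t * f v)"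
      using WT.bounded_below_of_not_in_spectrum[of "complex_of_real t" "\<lambda>_. 0"] by (auto simp: laplacian_spectrum_def)
    \<comment> \<open>The squared norm of \<open>f n\<close> grows like \<open>n * \<mu>\<close>
      while that of its residual stays bounded, so no constant \<open>D\<close> serves all
      \<open>n\<close>.\<close>
    obtain n :: nat where n: "real n > D\<^sup>2 * (4 * C\<^sup>2)" using reals_Archimedean2 by blast
    have "WT.V.N (f n) \<le> D * WT.V.N (g n)" using D[OF fH] by (simp add: g_def[abs_def])
    then have "(WT.V.N (f n))\<^sup>2 \<le> (D * WT.V.N (g n))\<^sup>2" by (rule power_mono) simp
    also have "\<dots> \<le> D\<^sup>2 * (4 * C\<^sup>2 * \<mu>)" using Ng by (simp add: power_mult_distrib mult_left_mono)
    finally have "real n * \<mu> \<le> D\<^sup>2 * (4 * C\<^sup>2) * \<mu>" unfolding Nf by (simp add: mult.assoc)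
    then show False using n \<mu> by (simp only: mult_le_cancel_right) simp
  qed
qed

section \<open>Comparison of the gap sets and the equivalences\<close>

lemma laplacian_spectrum_subset: "laplacian_spectrum W \<subseteq> spectral_interval W"
  using WT.spectrum_subset[of "\<lambda>_. 0"] by (simp add: laplacian_spectrum_def spectral_interval_def \<rho>_def)

lemma full_spectrum_iff: "full_spectrum_property W \<longleftrightarrow> spectral_gaps W = {}"
  using laplacian_spectrum_subset by (auto simp: full_spectrum_property_def spectral_gaps_def)

lemma no_gap_of_lattice: "undirected_iso T lattice_Z \<Longrightarrow> spectral_gaps W = {}"
  using spectrum_lattice by (auto simp: spectral_gaps_def spectral_interval_def \<rho>_def)

text \<open>The two spectral intervals agree because relative weights pass to the quotient, so the
  inclusion of spectra reverses to one of gaps.\<close>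

lemma magnetic_gaps_subset: "magnetic_spectral_gaps Q \<subseteq> spectral_gaps W"
  using spectrum_subset_magnetic
  by (auto simp: magnetic_spectral_gaps_def spectral_gaps_def spectral_interval_def rho_G \<rho>_def[symmetric])

end

theorem theorem5p8:
  fixes Wt :: "('v, 'e) weighted_graph"
    and W :: "('v set, 'e set) weighted_graph"
    and \<phi> :: "int \<Rightarrow> 'v \<Rightarrow> 'v"
    and \<psi> :: "int \<Rightarrow> 'e \<Rightarrow> 'e"
  assumes "Z_periodic_tree Wt \<phi> \<psi>"
    and "standard_weights Wt \<or> combinatorial_weights Wt"
    and "W = quotient_weighted_graph \<phi> \<psi> Wt"
  shows "(full_spectrum_property Wt \<longleftrightarrow> spectral_gaps Wt = {}) \<and>
         (spectral_gaps Wt = {} \<longleftrightarrow> undirected_iso (graph_of Wt) lattice_Z) \<and>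
         (undirected_iso (graph_of Wt) lattice_Z \<longleftrightarrow> magnetic_spectral_gaps W = {}) \<and>
         (magnetic_spectral_gaps W = {} \<longleftrightarrow> is_cycle_graph (graph_of W)) \<and>
         (is_cycle_graph (graph_of W) \<longleftrightarrow> (\<forall>v\<in>verts (graph_of W). degree (graph_of W) v \<noteq> 1))"
proof -
  interpret weighted_periodic_tree Wt \<phi> \<psi>
    using assms(1,2) by (simp add: weighted_periodic_tree_def weighted_periodic_tree_axioms_def)
  show ?thesis
    unfolding assms(3)
    using full_spectrum_iff no_gap_of_lattice magnetic_gaps_subset no_leaf_of_no_magnetic_gap
      cycle_graph_iff_no_leaf lattice_of_cycle_graph
    by blast
qed

end
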